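(* For every integer $n\geq 1$, the generalized flag manifold $\mathbb{F}(3n;n,n,n)=SU(3n)/S(U(n)\times U(n)\times U(n))$ has exactly two invariant almost complex structures, up to conjugation and equivalence: one is integrable and the other is non-integrable.
   Context: $S(U(n)\times U(n)\times U(n))\subset SU(3n)$ is the subgroup of block-diagonal matrices. An invariant almost complex structure on $M=U/K$ is an almost complex structure $J$ (a $(1,1)$-tensor with $J^2=-\mathrm{Id}$) commuting with the differentials of the left action of $U$ on $M$. It is integrable if the distribution $T^{1,0}M$ (the $+i$ eigenspaces of $J$) is integrable. The conjugate of $J$ is $-J$. Two almost complex structures $J_1,J_2$ on $M$ are equivalent if there is a diffeomorphism $\phi:M\to M$ with $d\phi\circ J_1=J_2\circ d\phi$ (for integrable structures: $(M,J_1)$ and $(M,J_2)$ are biholomorphic). "Up to conjugation and equivalence" means modulo the equivalence relation generated by $J\sim -J$ and equivalence. *)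

theory Defs
  imports "HOL-Analysis.Analysis"
begin

section \<open>Smooth functions on subsets of Euclidean space\<close>

primrec Ck_on :: "nat \<Rightarrow> 'a::euclidean_space set \<Rightarrow> ('a \<Rightarrow> real) \<Rightarrow> bool" where
  "Ck_on 0 U f \<longleftrightarrow> continuous_on U f"
| "Ck_on (Suc k) U f \<longleftrightarrow>
     (\<forall>x\<in>U. f differentiable (at x)) \<and>
     (\<forall>v. Ck_on k U (\<lambda>x. frechet_derivative f (at x) v))"

definition smooth_on :: "'a::euclidean_space set \<Rightarrow> ('a \<Rightarrow> real) \<Rightarrow> bool" where
  "smooth_on U f \<longleftrightarrow> (\<forall>k. Ck_on k U f)"

text \<open>For an arbitrary subset \<open>S\<close>, smooth means locally extendable to a smooth function on an
  open set of the ambient space; for an embedded submanifold these are exactly its smooth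
  functions.\<close>

definition smooth_on_subset :: "'a::euclidean_space set \<Rightarrow> ('a \<Rightarrow> real) \<Rightarrow> bool" where
  "smooth_on_subset S f \<longleftrightarrow>
     (\<forall>x\<in>S. \<exists>U F. open U \<and> x \<in> U \<and> smooth_on U F \<and> (\<forall>y\<in>S \<inter> U. F y = f y))"


section \<open>Almost complex structures\<close>

text \<open>A manifold is given by a type \<open>'a\<close> of points together with its algebra
  \<open>C :: ('a \<Rightarrow> real) set\<close> of smooth functions. Tangent vectors at \<open>p\<close> are the derivations of
  \<open>C\<close> at \<open>p\<close>; they are set to \<open>0\<close> outside \<open>C\<close>, so that equality of tangent vectors is equality
  on \<open>C\<close>.\<close>

type_synonym 'a vect = "('a \<Rightarrow> real) \<Rightarrow> real"
type_synonym 'a cvect = "('a \<Rightarrow> real) \<Rightarrow> complex"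

definition tangent_space :: "('a \<Rightarrow> real) set \<Rightarrow> 'a \<Rightarrow> 'a vect set" where
  "tangent_space C p = {v.
     (\<forall>f\<in>C. \<forall>g\<in>C. \<forall>a b. v (\<lambda>x. a * f x + b * g x) = a * v f + b * v g) \<and>
     (\<forall>f\<in>C. \<forall>g\<in>C. v (\<lambda>x. f x * g x) = f p * v g + g p * v f) \<and>
     (\<forall>f. f \<notin> C \<longrightarrow> v f = 0)}"

definition vector_field :: "('a \<Rightarrow> real) set \<Rightarrow> ('a \<Rightarrow> 'a vect) \<Rightarrow> bool" where
  "vector_field C X \<longleftrightarrow>
     (\<forall>p. X p \<in> tangent_space C p) \<and> (\<forall>f\<in>C. (\<lambda>p. X p f) \<in> C)"

text \<open>A \<open>(1,1)\<close>-tensor is smooth iff it maps smooth vector fields to smooth vector fields.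
  The values of \<open>J p\<close> outside the tangent space at \<open>p\<close> are irrelevant; two structures that
  differ only there are equivalent (via the identity) in the sense below.\<close>

definition almost_complex :: "('a \<Rightarrow> real) set \<Rightarrow> ('a \<Rightarrow> 'a vect \<Rightarrow> 'a vect) \<Rightarrow> bool" where
  "almost_complex C J \<longleftrightarrow>
     (\<forall>p. \<forall>v\<in>tangent_space C p. J p v \<in> tangent_space C p) \<and>
     (\<forall>p. \<forall>v\<in>tangent_space C p. \<forall>w\<in>tangent_space C p. \<forall>a b.
        J p (\<lambda>f. a * v f + b * w f) = (\<lambda>f. a * J p v f + b * J p w f)) \<and>
     (\<forall>p. \<forall>v\<in>tangent_space C p. J p (J p v) = (\<lambda>f. - v f)) \<and>
     (\<forall>X. vector_field C X \<longrightarrow> vector_field C (\<lambda>p. J p (X p)))"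

definition conjugate_structure :: "('a \<Rightarrow> 'a vect \<Rightarrow> 'a vect) \<Rightarrow> ('a \<Rightarrow> 'a vect \<Rightarrow> 'a vect)" where
  "conjugate_structure J = (\<lambda>p v f. - J p v f)"

definition diffeomorphism :: "('a \<Rightarrow> real) set \<Rightarrow> ('a \<Rightarrow> 'a) \<Rightarrow> bool" where
  "diffeomorphism C \<phi> \<longleftrightarrow> bij \<phi> \<and> (\<forall>f\<in>C. f \<circ> \<phi> \<in> C) \<and> (\<forall>f\<in>C. f \<circ> inv \<phi> \<in> C)"

text \<open>Differential of a diffeomorphism \<open>\<phi>\<close>, from the tangent space at \<open>p\<close> to the one at \<open>\<phi> p\<close>.\<close>

definition pushforward :: "('a \<Rightarrow> 'a) \<Rightarrow> 'a vect \<Rightarrow> 'a vect" where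
  "pushforward \<phi> v = (\<lambda>f. v (f \<circ> \<phi>))"

text \<open>\<open>d\<phi> \<circ> J\<^sub>1 = J\<^sub>2 \<circ> d\<phi>\<close>\<close>

definition intertwines ::
  "('a \<Rightarrow> real) set \<Rightarrow> ('a \<Rightarrow> 'a) \<Rightarrow> ('a \<Rightarrow> 'a vect \<Rightarrow> 'a vect) \<Rightarrow> ('a \<Rightarrow> 'a vect \<Rightarrow> 'a vect) \<Rightarrow> bool"
where
  "intertwines C \<phi> J1 J2 \<longleftrightarrow>
     (\<forall>p. \<forall>v\<in>tangent_space C p. pushforward \<phi> (J1 p v) = J2 (\<phi> p) (pushforward \<phi> v))"

definition equivalent_structures ::
  "('a \<Rightarrow> real) set \<Rightarrow> ('a \<Rightarrow> 'a vect \<Rightarrow> 'a vect) \<Rightarrow> ('a \<Rightarrow> 'a vect \<Rightarrow> 'a vect) \<Rightarrow> bool"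
where
  "equivalent_structures C J1 J2 \<longleftrightarrow> (\<exists>\<phi>. diffeomorphism C \<phi> \<and> intertwines C \<phi> J1 J2)"

definition same_up_to_conj_equiv ::
  "('a \<Rightarrow> real) set \<Rightarrow> ('a \<Rightarrow> 'a vect \<Rightarrow> 'a vect) \<Rightarrow> ('a \<Rightarrow> 'a vect \<Rightarrow> 'a vect) \<Rightarrow> bool"
where
  "same_up_to_conj_equiv C = equivclp (\<lambda>J1 J2.
     almost_complex C J1 \<and> almost_complex C J2 \<and>
     (J2 = conjugate_structure J1 \<or> equivalent_structures C J1 J2))"


subsection \<open>Integrability\<close>

text \<open>Elements of the complexified tangent space are complex-valued functionals on \<open>C\<close> whose
  real and imaginary parts are tangent vectors.\<close>

definition Re_vect :: "'a cvect \<Rightarrow> 'a vect" where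
  "Re_vect z = (\<lambda>f. Re (z f))"

definition Im_vect :: "'a cvect \<Rightarrow> 'a vect" where
  "Im_vect z = (\<lambda>f. Im (z f))"

definition complex_tangent_space :: "('a \<Rightarrow> real) set \<Rightarrow> 'a \<Rightarrow> 'a cvect set" where
  "complex_tangent_space C p =
     {z. Re_vect z \<in> tangent_space C p \<and> Im_vect z \<in> tangent_space C p}"

definition complexify :: "('a vect \<Rightarrow> 'a vect) \<Rightarrow> 'a cvect \<Rightarrow> 'a cvect" where
  "complexify T z = (\<lambda>f. of_real (T (Re_vect z) f) + \<i> * of_real (T (Im_vect z) f))"

definition T10 :: "('a \<Rightarrow> real) set \<Rightarrow> ('a \<Rightarrow> 'a vect \<Rightarrow> 'a vect) \<Rightarrow> 'a \<Rightarrow> 'a cvect set" where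
  "T10 C J p = {z \<in> complex_tangent_space C p. complexify (J p) z = (\<lambda>f. \<i> * z f)}"

definition complex_vector_field :: "('a \<Rightarrow> real) set \<Rightarrow> ('a \<Rightarrow> 'a cvect) \<Rightarrow> bool" where
  "complex_vector_field C Z \<longleftrightarrow>
     vector_field C (\<lambda>p. Re_vect (Z p)) \<and> vector_field C (\<lambda>p. Im_vect (Z p))"

text \<open>Complex-linear extension of a complex tangent vector to complex-valued functions.\<close>

definition cderiv :: "'a cvect \<Rightarrow> ('a \<Rightarrow> complex) \<Rightarrow> complex" where
  "cderiv z h = z (\<lambda>x. Re (h x)) + \<i> * z (\<lambda>x. Im (h x))"

definition lie_bracket :: "('a \<Rightarrow> 'a cvect) \<Rightarrow> ('a \<Rightarrow> 'a cvect) \<Rightarrow> ('a \<Rightarrow> 'a cvect)" where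
  "lie_bracket Z W = (\<lambda>p f. cderiv (Z p) (\<lambda>q. W q f) - cderiv (W p) (\<lambda>q. Z q f))"

text \<open>Integrability of the complex distribution of \<open>+\<i>\<close> eigenspaces: its smooth sections are
  closed under the Lie bracket.\<close>

definition integrable_structure :: "('a \<Rightarrow> real) set \<Rightarrow> ('a \<Rightarrow> 'a vect \<Rightarrow> 'a vect) \<Rightarrow> bool" where
  "integrable_structure C J \<longleftrightarrow>
     (\<forall>Z W. complex_vector_field C Z \<and> (\<forall>p. Z p \<in> T10 C J p) \<and>
            complex_vector_field C W \<and> (\<forall>p. W p \<in> T10 C J p) \<longrightarrow>
            (\<forall>p. lie_bracket Z W p \<in> T10 C J p))"


section \<open>The flag manifold\<close>

definition SU :: "(complex^'m^'m) set" where
  "SU = {A. (\<chi> i j. cnj (A $ j $ i)) ** A = mat 1 \<and> det A = 1}"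

text \<open>With \<open>n = CARD('n)\<close>, the \<open>3n\<close> coordinates are indexed by pairs (block, position in the
  block). As \<open>SU\<close> already forces unitarity and determinant \<open>1\<close>, its block-diagonal elements form
  \<open>S(U(n) \<times> U(n) \<times> U(n))\<close>.\<close>

definition S_UUU :: "(complex^(3 \<times> 'n::finite)^(3 \<times> 'n)) set" where
  "S_UUU = {A \<in> SU. \<forall>a b i j. a \<noteq> b \<longrightarrow> A $ (a, i) $ (b, j) = 0}"

text \<open>The points are the left cosets of \<open>S_UUU\<close> in \<open>SU\<close>.\<close>

typedef (overloaded) 'n flag =
  "{(\<lambda>k. g ** k) ` S_UUU | g :: complex^(3 \<times> 'n::finite)^(3 \<times> 'n). g \<in> SU}"
proof -
  have "(\<chi> i j. cnj ((mat 1 :: complex^(3 \<times> 'n)^(3 \<times> 'n)) $ j $ i)) = mat 1"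
    by (simp add: vec_eq_iff mat_def)
  then have "(mat 1 :: complex^(3 \<times> 'n)^(3 \<times> 'n)) \<in> SU"
    by (simp add: SU_def)
  then show ?thesis by blast
qed

definition flag_of :: "complex^(3 \<times> 'n)^(3 \<times> 'n) \<Rightarrow> 'n::finite flag" where
  "flag_of g = Abs_flag ((\<lambda>k. g ** k) ` S_UUU)"

definition left_action :: "complex^(3 \<times> 'n)^(3 \<times> 'n) \<Rightarrow> 'n::finite flag \<Rightarrow> 'n flag" where
  "left_action g p = Abs_flag ((\<lambda>h. g ** h) ` Rep_flag p)"

text \<open>Quotient smooth structure: as the projection from \<open>SU\<close> is a surjective submersion, a
  function on the quotient is smooth iff its lift to \<open>SU\<close> is.\<close>

definition flag_smooth :: "('n::finite flag \<Rightarrow> real) set" where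
  "flag_smooth = {f. smooth_on_subset SU (\<lambda>g. f (flag_of g))}"

definition invariant_acs :: "('n::finite flag \<Rightarrow> 'n flag vect \<Rightarrow> 'n flag vect) set" where
  "invariant_acs = {J. almost_complex flag_smooth J \<and>
     (\<forall>g\<in>SU. intertwines flag_smooth (left_action g) J J)}"

definition acs_rel ::
  "(('n::finite flag \<Rightarrow> 'n flag vect \<Rightarrow> 'n flag vect) \<times>
    ('n flag \<Rightarrow> 'n flag vect \<Rightarrow> 'n flag vect)) set" where
  "acs_rel = {(J1, J2). J1 \<in> invariant_acs \<and> J2 \<in> invariant_acs \<and>
     same_up_to_conj_equiv flag_smooth J1 J2}"

lemma equiv_acs_rel: "equiv invariant_acs acs_rel"
proof (rule equivI)
  show "acs_rel \<subseteq> invariant_acs \<times> invariant_acs"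
    by (auto simp: acs_rel_def)
  show "refl_on invariant_acs acs_rel"
    by (rule refl_onI) (simp add: acs_rel_def same_up_to_conj_equiv_def)
  show "sym acs_rel"
    by (rule symI) (simp add: acs_rel_def same_up_to_conj_equiv_def equivclp_sym)
  show "trans acs_rel"
    by (rule transI) (auto simp: acs_rel_def same_up_to_conj_equiv_def intro: equivclp_trans)
qed

end

(*
  The flag manifold is embedded as an orbit of Hermitian matrices by g K |-> g Lam g^*, where Lam is
  diagonal with eigenvalues 1, 0, -1 on the three blocks. Gram-Schmidt gives smooth local sections,
  so smooth functions are locally restrictions of ambient ones, and by Hadamard's lemma with a
  cut-off a derivation is determined by the Hermitian matrix of its values on the coordinates. At
  the base point these matrices are exactly those with vanishing diagonal blocks.

  An invariant structure is thus an operator on off-diagonal Hermitian matrices commuting with the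
  isotropy group. Its diagonal elements force the operator to act on the (i,j) entry as
  multiplication by i or -i, and its block permutations make the sign depend only on the blocks: an
  invariant structure is an orientation eps of the three pairs of blocks. Permuting the blocks and
  conjugation leave two classes, represented by the transitive and the cyclic orientation.

  A field has type (1,0) iff its (a,b) blocks with eps a b = -1 vanish. Differentiating this
  relation expresses these blocks of the bracket of two such fields through products of an (a,c)
  and a (c,b) block with eps a c = eps c b = 1. There are none in the transitive case, while in the
  cyclic case explicit fields give a nonzero block.
*)

theory Submission
  imports Defs
begin

section \<open>Smooth calculus\<close>

text \<open>The definitions offer no charts: smoothness on the quotient is tested on lifts to
  \<open>SU\<close>, and tangent vectors are derivations of a global function algebra. Everything is
  therefore read through the embedding. Its eigenvalues are the roots of x^3 = x, so an orbit point
  Y satisfies Y^3 = Y and its spectral projections are quadratic polynomials in Y. The structures,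
  the block permutations and the explicit fields are written with these projections
  (\<open>Jmat\<close>, \<open>weyl\<close>, \<open>upper\<close>). Such formulas are smooth on the
  whole matrix space and equivariant under conjugation, so pointwise claims reduce to Y =
  \<open>Lam\<close>, where the projections are diagonal 0-1 matrices.

  Of the eight orientations of three blocks, six are linear orders, permuted transitively by the
  block permutations, and two are 3-cycles, exchanged by conjugation. That the two families are not
  equivalent calls for an invariant of arbitrary diffeomorphisms. Integrability is one, so the
  bracket computation that decides integrability also separates the classes.\<close>

lemma Ck_on_cong:
  assumes "open U" "\<And>x. x \<in> U \<Longrightarrow> f x = g x"
  shows "Ck_on k U f \<longleftrightarrow> Ck_on k U g"
  using assms(2)
proof (induction k arbitrary: f g)
  case 0
  then show ?case by (auto cong: continuous_on_cong)
next
  case (Suc k)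
  have hd: "(f has_derivative D) (at x) \<longleftrightarrow> (g has_derivative D) (at x)" if "x \<in> U" for x D
    using has_derivative_transform_within_open[of _ _ x UNIV U] assms(1) that Suc.prems by metis
  have d: "f differentiable (at x) \<longleftrightarrow> g differentiable (at x)" if "x \<in> U" for x
    using hd[OF that] by (simp add: differentiable_def)
  have "frechet_derivative f (at x) = frechet_derivative g (at x)" if "x \<in> U" for x
    unfolding frechet_derivative_def using hd[OF that] by simp
  then have "Ck_on k U (\<lambda>x. frechet_derivative f (at x) v) \<longleftrightarrow>
      Ck_on k U (\<lambda>x. frechet_derivative g (at x) v)" for v
    by (intro Suc.IH) auto
  with d show ?case by simp
qed

text \<open>\<open>Ck_on\<close> is phrased with the chosen operator
  \<open>frechet_derivative\<close>; here any formula for the derivative may be supplied. Openness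
  of \<open>U\<close> allows the exchange, since derivatives at points of \<open>U\<close> then
  depend only on values on \<open>U\<close>.\<close>

lemma Ck_on_SucI:
  assumes "open U" "\<And>x. x \<in> U \<Longrightarrow> (f has_derivative f' x) (at x)"
    and "\<And>v. Ck_on k U (\<lambda>x. f' x v)"
  shows "Ck_on (Suc k) U f"
proof -
  have "Ck_on k U (\<lambda>x. frechet_derivative f (at x) v)" for v
    using assms frechet_derivative_at[OF assms(2)]
    by (subst Ck_on_cong[OF assms(1), where g = "\<lambda>x. f' x v"]) auto
  then show ?thesis
    using assms(2) by (auto simp: differentiable_def)
qed

lemma Ck_on_SucD_derivative:
  assumes "Ck_on (Suc k) U f" "x \<in> U"
  shows "(f has_derivative frechet_derivative f (at x)) (at x)"
  using assms by (simp add: frechet_derivative_works)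

lemma Ck_on_SucD: "Ck_on (Suc k) U f \<Longrightarrow> Ck_on k U f"
proof (induction k arbitrary: f)
  case 0
  then show ?case
    by (auto intro!: continuous_at_imp_continuous_on differentiable_imp_continuous_within)
next
  case (Suc k)
  then show ?case by (metis Ck_on.simps(2))
qed

lemma Ck_on_imp_continuous_on: "Ck_on k U f \<Longrightarrow> continuous_on U f"
proof (induction k)
  case (Suc k)
  then show ?case using Ck_on_SucD by blast
qed simp

lemma Ck_on_subset: "Ck_on k U f \<Longrightarrow> V \<subseteq> U \<Longrightarrow> Ck_on k V f"
  by (induction k arbitrary: f) (auto intro: continuous_on_subset)

lemma Ck_on_const: "open U \<Longrightarrow> Ck_on k U (\<lambda>x. c)"
proof (induction k arbitrary: c)
  case (Suc k)
  then show ?case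
    by (intro Ck_on_SucI[where f' = "\<lambda>_ _. 0"]) auto
qed simp

lemma Ck_on_linear:
  fixes f :: "'a::euclidean_space \<Rightarrow> real"
  assumes "open U" "linear f"
  shows "Ck_on k U f"
proof (cases k)
  case 0
  then show ?thesis using assms linear_continuous_on linear_conv_bounded_linear by auto
next
  case (Suc n)
  have "Ck_on (Suc n) U f"
    using assms by (intro Ck_on_SucI[where f' = "\<lambda>_. f"] Ck_on_const)
      (auto simp: linear_conv_bounded_linear bounded_linear_imp_has_derivative)
  then show ?thesis using Suc by simp
qed

lemma Ck_on_add:
  assumes "open U" "Ck_on k U f" "Ck_on k U g"
  shows "Ck_on k U (\<lambda>x. f x + g x)"
  using assms(2,3)
proof (induction k arbitrary: f g)
  case 0
  then show ?case by (auto intro: continuous_intros)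
next
  case (Suc k)
  show ?case
    using Suc.prems Suc.IH
    by (intro Ck_on_SucI[OF assms(1) has_derivative_add[OF Ck_on_SucD_derivative[OF Suc.prems(1)]
      Ck_on_SucD_derivative[OF Suc.prems(2)]]]) auto
qed

lemma Ck_on_mult:
  assumes "open U" "Ck_on k U f" "Ck_on k U g"
  shows "Ck_on k U (\<lambda>x. f x * g x)"
  using assms(2,3)
proof (induction k arbitrary: f g)
  case 0
  then show ?case by (auto intro: continuous_intros)
next
  case (Suc k)
  show ?case
    using Suc.prems Suc.IH[OF Ck_on_SucD[OF Suc.prems(1)]] Suc.IH[OF _ Ck_on_SucD[OF Suc.prems(2)]]
    by (intro Ck_on_SucI[OF assms(1) has_derivative_mult[OF Ck_on_SucD_derivative[OF Suc.prems(1)]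
      Ck_on_SucD_derivative[OF Suc.prems(2)]]] Ck_on_add assms) auto
qed

lemma Ck_on_sum:
  assumes "open U" "\<And>i. i \<in> I \<Longrightarrow> Ck_on k U (f i)"
  shows "Ck_on k U (\<lambda>x. \<Sum>i\<in>I. f i x)"
  using assms(2)
  by (induction I rule: infinite_finite_induct) (auto intro: Ck_on_const Ck_on_add assms(1))

text \<open>By the chain rule a directional derivative of the composite is a sum of products of a
  component derivative of \<open>h\<close> with a partial derivative of \<open>F\<close> composed
  with \<open>h\<close>. Hence the induction keeps \<open>h\<close> fixed and lets \<open>F\<close>
  vary.\<close>

lemma Ck_on_compose:
  fixes h :: "'a::euclidean_space \<Rightarrow> 'b::euclidean_space"
  assumes U: "open U" and F: "Ck_on k V F"
    and h: "\<And>b. b \<in> Basis \<Longrightarrow> Ck_on k U (\<lambda>x. h x \<bullet> b)" and hV: "h ` U \<subseteq> V"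
  shows "Ck_on k U (\<lambda>x. F (h x))"
  using F h
proof (induction k arbitrary: F)
  case 0
  then have "continuous_on U h"
    by (subst continuous_on_componentwise) auto
  with 0 show ?case
    by (auto intro: continuous_on_compose2[OF _ _ hV])
next
  case (Suc k)
  let ?D = "\<lambda>x v. \<Sum>b\<in>Basis. frechet_derivative (\<lambda>x. h x \<bullet> b) (at x) v *\<^sub>R b"
  have hD: "(h has_derivative ?D x) (at x)" if x: "x \<in> U" for x
  proof (subst has_derivative_componentwise_within, intro ballI)
    fix b :: 'b assume b: "b \<in> Basis"
    have "?D x v \<bullet> b = frechet_derivative (\<lambda>x. h x \<bullet> b) (at x) v" for v
      using b by (simp add: inner_sum_left inner_Basis if_distrib cong: if_cong)
    then show "((\<lambda>x. h x \<bullet> b) has_derivative (\<lambda>v. ?D x v \<bullet> b)) (at x)"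
      using Ck_on_SucD_derivative[OF Suc.prems(2)[OF b] x] by simp
  qed
  let ?F = "\<lambda>y. frechet_derivative F (at y)"
  have "((\<lambda>x. F (h x)) has_derivative (\<lambda>v. ?F (h x) (?D x v))) (at x)" if "x \<in> U" for x
    using diff_chain_at[OF hD[OF that] Ck_on_SucD_derivative[OF Suc.prems(1)], of] that hV
    by (auto simp: o_def)
  moreover have "?F (h x) (?D x v) =
      (\<Sum>b\<in>Basis. frechet_derivative (\<lambda>x. h x \<bullet> b) (at x) v * ?F (h x) b)" if "x \<in> U" for x v
  proof -
    have "linear (?F (h x))"
      using Ck_on_SucD_derivative[OF Suc.prems(1)] that hV has_derivative_linear by blast
    then show ?thesis by (simp add: linear_sum linear_scale)
  qed
  ultimately have D: "((\<lambda>x. F (h x)) has_derivative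
     (\<lambda>v. \<Sum>b\<in>Basis. frechet_derivative (\<lambda>x. h x \<bullet> b) (at x) v * ?F (h x) b)) (at x)" if "x \<in> U" for x
    using that by simp
  show ?case
  proof (rule Ck_on_SucI[OF U D])
    fix v
    have "Ck_on k U (\<lambda>x. frechet_derivative (\<lambda>x. h x \<bullet> b) (at x) v)" if "b \<in> Basis" for b
      using Suc.prems(2)[OF that] by simp
    moreover have "Ck_on k U (\<lambda>x. ?F (h x) b)" for b
      using Suc.prems(1) Ck_on_SucD[OF Suc.prems(2)] Suc.IH[of "\<lambda>y. frechet_derivative F (at y) b"]
      by simp
    ultimately show "Ck_on k U (\<lambda>x. \<Sum>b\<in>Basis.
        frechet_derivative (\<lambda>x. h x \<bullet> b) (at x) v * ?F (h x) b)"
      by (intro Ck_on_sum Ck_on_mult U)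
  qed
qed

lemma smooth_on_subset_mono: "smooth_on U f \<Longrightarrow> V \<subseteq> U \<Longrightarrow> smooth_on V f"
  unfolding smooth_on_def using Ck_on_subset by blast

lemma smooth_on_derivative:
  "smooth_on U f \<Longrightarrow> smooth_on U (\<lambda>x. frechet_derivative f (at x) v)"
  unfolding smooth_on_def by (metis Ck_on.simps(2))

lemma smooth_on_has_derivative:
  "smooth_on U f \<Longrightarrow> x \<in> U \<Longrightarrow> (f has_derivative frechet_derivative f (at x)) (at x)"
  unfolding smooth_on_def using Ck_on_SucD_derivative by blast

section \<open>Smooth maps between Euclidean spaces\<close>

definition smooth_map ::
  "'a::euclidean_space set \<Rightarrow> ('a \<Rightarrow> 'b::euclidean_space) \<Rightarrow> bool" where
  "smooth_map U h \<longleftrightarrow> (\<forall>b\<in>Basis. smooth_on U (\<lambda>x. h x \<bullet> b))"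

lemma smooth_map_real: "smooth_map U (f :: _ \<Rightarrow> real) \<longleftrightarrow> smooth_on U f"
  by (simp add: smooth_map_def)

lemma smooth_on_compose:
  "open U \<Longrightarrow> smooth_on V F \<Longrightarrow> smooth_map U h \<Longrightarrow> h ` U \<subseteq> V \<Longrightarrow> smooth_on U (\<lambda>x. F (h x))"
  unfolding smooth_on_def smooth_map_def by (metis Ck_on_compose)

lemma smooth_map_compose:
  "open U \<Longrightarrow> smooth_map V F \<Longrightarrow> smooth_map U h \<Longrightarrow> h ` U \<subseteq> V \<Longrightarrow> smooth_map U (\<lambda>x. F (h x))"
  using smooth_on_compose unfolding smooth_map_def[of V] smooth_map_def[of U "\<lambda>x. F (h x)"]
  by blast

lemma smooth_map_subset: "smooth_map U f \<Longrightarrow> V \<subseteq> U \<Longrightarrow> smooth_map V f"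
  unfolding smooth_map_def using smooth_on_subset_mono by blast

lemma smooth_map_linear: "open U \<Longrightarrow> linear f \<Longrightarrow> smooth_map U f"
  unfolding smooth_map_def smooth_on_def
  by (auto intro!: Ck_on_linear simp: linear_iff inner_add_left)

lemma smooth_map_const: "open U \<Longrightarrow> smooth_map U (\<lambda>x. c)"
  unfolding smooth_map_def smooth_on_def by (auto intro!: Ck_on_const)

lemma smooth_map_id: "open U \<Longrightarrow> smooth_map U (\<lambda>x. x)"
  using smooth_map_linear[OF _ linear_id] by (simp add: id_def)

lemma smooth_map_linear_compose:
  "open U \<Longrightarrow> linear f \<Longrightarrow> smooth_map U h \<Longrightarrow> smooth_map U (\<lambda>x. f (h x))"
  using smooth_map_compose[OF _ smooth_map_linear[of UNIV f]] by auto

lemma smooth_map_add: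
  "open U \<Longrightarrow> smooth_map U f \<Longrightarrow> smooth_map U g \<Longrightarrow> smooth_map U (\<lambda>x. f x + g x)"
  unfolding smooth_map_def smooth_on_def by (auto simp: inner_add_left intro: Ck_on_add)

lemma smooth_map_sum:
  "open U \<Longrightarrow> (\<And>i. i \<in> I \<Longrightarrow> smooth_map U (f i)) \<Longrightarrow> smooth_map U (\<lambda>x. \<Sum>i\<in>I. f i x)"
  unfolding smooth_map_def smooth_on_def by (auto simp: inner_sum_left intro: Ck_on_sum)

lemma smooth_map_scaleR:
  "open U \<Longrightarrow> smooth_on U f \<Longrightarrow> smooth_map U g \<Longrightarrow> smooth_map U (\<lambda>x. f x *\<^sub>R g x)"
  unfolding smooth_map_def smooth_on_def by (auto intro: Ck_on_mult)

lemma smooth_map_inner: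
  assumes "open U" "smooth_map U f" shows "smooth_on U (\<lambda>x. f x \<bullet> c)"
  using smooth_map_linear_compose[OF assms(1) _ assms(2), of "\<lambda>y. y \<bullet> c"]
  by (simp add: smooth_map_real linear_iff inner_add_left)

text \<open>Serves matrix products, Hermitian products, complex products and scalar multiplication
  alike.\<close>

lemma smooth_map_bilinear:
  assumes U: "open U" and B: "bilinear B" and f: "smooth_map U f" and g: "smooth_map U g"
  shows "smooth_map U (\<lambda>x. B (f x) (g x))"
proof -
  have "B (f x) (g x) = (\<Sum>i\<in>Basis. \<Sum>j\<in>Basis. ((f x \<bullet> i) * (g x \<bullet> j)) *\<^sub>R B i j)" for x
  proof -
    have "B (f x) (g x) = B (\<Sum>i\<in>Basis. (f x \<bullet> i) *\<^sub>R i) (\<Sum>j\<in>Basis. (g x \<bullet> j) *\<^sub>R j)"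
      by (simp add: euclidean_representation)
    also have "\<dots> = (\<Sum>(i,j)\<in>Basis \<times> Basis. B ((f x \<bullet> i) *\<^sub>R i) ((g x \<bullet> j) *\<^sub>R j))"
      by (rule bilinear_sum[OF B]) 
    finally show ?thesis
      by (simp add: sum.cartesian_product bilinear_lmul[OF B] bilinear_rmul[OF B] mult.commute)
  qed
  moreover have "smooth_map U (\<lambda>x. \<Sum>i\<in>Basis. \<Sum>j\<in>Basis. ((f x \<bullet> i) * (g x \<bullet> j)) *\<^sub>R B i j)"
    using f g U unfolding smooth_map_def[of U f] smooth_map_def[of U g]
    by (intro smooth_map_sum smooth_map_scaleR smooth_map_const)
       (auto simp: smooth_on_def intro!: Ck_on_mult)
  ultimately show ?thesis by simp
qed

lemma smooth_map_continuous_on: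
  "smooth_map U f \<Longrightarrow> continuous_on U f"
  unfolding smooth_map_def smooth_on_def
  by (subst continuous_on_componentwise) (metis Ck_on.simps(1))

text \<open>A family closed under differentiation, up to constant coefficients, is treated as a
  whole: if all members are of class k, then all are of class k + 1. Powers and flat exponentials
  are such families.\<close>

lemma smooth_on_real_derivative_family:
  fixes h :: "nat \<Rightarrow> real \<Rightarrow> real"
  assumes U: "open U" and d: "\<And>j x. x \<in> U \<Longrightarrow> (h j has_real_derivative (a j * h (s j) x + b j * h (t j) x)) (at x)"
  shows "smooth_on U (h j)"
proof -
  have "Ck_on k U (h j)" for k j
  proof (induction k arbitrary: j)
    case 0
    then show ?case
      using DERIV_isCont[OF d] by (simp add: continuous_at_imp_continuous_on)
  next
    case (Suc k)
    show ?case
      by (rule Ck_on_SucI[where f' = "\<lambda>x v. (a j * h (s j) x + b j * h (t j) x) * v"])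
         (use d[of _ j] Suc U in \<open>auto simp: has_field_derivative_def intro!: Ck_on_mult Ck_on_add Ck_on_const\<close>)
  qed
  then show ?thesis by (simp add: smooth_on_def)
qed

lemma smooth_on_powr: "smooth_on {0<..} (\<lambda>x::real. x powr r)"
proof -
  have "smooth_on {0<..} ((\<lambda>j x::real. x powr (r - real j)) 0)"
  proof (rule smooth_on_real_derivative_family[where a = "\<lambda>j. r - real j" and s = Suc and b = "\<lambda>_. 0" and t = id])
    show "((\<lambda>x. x powr (r - real j)) has_real_derivative
      ((r - real j) * x powr (r - real (Suc j)) + 0 * x powr (r - real (id j)))) (at x)"
      if "x \<in> {0<..}" for j x
      using has_real_derivative_powr[of x "r - real j"] that by (simp add: algebra_simps)
  qed simp
  then show ?thesis by simp
qed

section \<open>A smooth function that is flat at 0\<close>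

definition flat_exp :: "nat \<Rightarrow> real \<Rightarrow> real" where
  "flat_exp j x = (if x > 0 then inverse x ^ j * exp (- inverse x) else 0)"

lemma flat_exp_tendsto_0: "(flat_exp j \<longlongrightarrow> 0) (at 0)"
proof -
  have "((\<lambda>x. inverse x ^ j / exp (inverse x)) \<longlongrightarrow> 0) (at_right (0::real))"
    by (rule filterlim_compose[OF tendsto_power_div_exp_0 filterlim_inverse_at_top_right])
  then have "(flat_exp j \<longlongrightarrow> 0) (at_right 0)"
    by (rule Lim_transform_eventually)
       (auto simp: flat_exp_def eventually_at_right_field exp_minus field_simps intro!: exI[of _ 1])
  moreover have "(flat_exp j \<longlongrightarrow> 0) (at_left 0)"
    by (rule Lim_transform_eventually[OF tendsto_const])
       (auto simp: flat_exp_def eventually_at_left_field intro!: exI[of _ "-1"])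
  ultimately show ?thesis
    by (simp add: filterlim_at_split)
qed

lemma flat_exp_derivative:
  "(flat_exp j has_real_derivative (- real j * flat_exp (Suc j) x + 1 * flat_exp (j + 2) x)) (at x)"
proof -
  consider "x > 0" | "x < 0" | "x = 0" by linarith
  then show ?thesis
  proof cases
    case 1
    have aux: "j - 1 = 0 \<or> x ^ (j - 1) = x * x ^ (j - 1 - 1)"
      by (cases "j - 1") auto
    have "((\<lambda>x. inverse x ^ j * exp (- inverse x)) has_real_derivative
        (- real j * flat_exp (Suc j) x + 1 * flat_exp (j + 2) x)) (at x)"
      using 1 aux by (cases j) (auto intro!: derivative_eq_intros
          simp: flat_exp_def field_simps power2_eq_square)
    then show ?thesis
      by (rule has_field_derivative_transform_within_open[where S = "{0<..}"])
         (use 1 in \<open>auto simp: flat_exp_def\<close>)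
  next
    case 2
    have "((\<lambda>x. 0) has_real_derivative (- real j * flat_exp (Suc j) x + 1 * flat_exp (j + 2) x)) (at x)"
      using 2 by (simp add: flat_exp_def)
    then show ?thesis
      by (rule has_field_derivative_transform_within_open[where S = "{..<0}"])
         (use 2 in \<open>auto simp: flat_exp_def\<close>)
  next
    case 3
    \<comment> \<open>The difference quotient at 0 is the next member of the family, which tends to
      0.\<close>
    have "flat_exp j y / y = flat_exp (Suc j) y" for y
      by (simp add: flat_exp_def field_simps)
    then show ?thesis
      using flat_exp_tendsto_0[of "Suc j"] 3
      by (simp add: has_field_derivative_iff flat_exp_def[of _ 0])
  qed
qed

lemma smooth_on_flat_exp: "smooth_on UNIV (flat_exp j)"
  by (rule smooth_on_real_derivative_family[OF _ flat_exp_derivative]) simp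

section \<open>Hadamard's lemma on a ball\<close>

definition ray_integral :: "'a::euclidean_space \<Rightarrow> nat \<Rightarrow> ('a \<Rightarrow> real) \<Rightarrow> 'a \<Rightarrow> real" where
  "ray_integral y0 j F x = integral {0..1} (\<lambda>t. t ^ j * F (y0 + t *\<^sub>R (x - y0)))"

lemma ray_in_ball: "x \<in> ball y0 r \<Longrightarrow> t \<in> {0..1} \<Longrightarrow> y0 + t *\<^sub>R (x - y0) \<in> ball y0 r"
  for y0 :: "'a::euclidean_space"
  by (simp add: dist_norm norm_minus_commute)
     (metis abs_of_nonneg le_less_trans mult_left_le_one_le norm_ge_zero)

lemma continuous_on_ray:
  fixes y0 :: "'a::euclidean_space"
  assumes "continuous_on (ball y0 r) F"
  shows "continuous_on (ball y0 r \<times> cbox 0 (1::real)) (\<lambda>(x, t). t ^ j * F (y0 + t *\<^sub>R (x - y0)) :: real)"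
  unfolding case_prod_beta
  by (intro continuous_intros continuous_on_compose2[OF assms]) (auto intro!: ray_in_ball[simplified])

text \<open>Differentiation under the integral sign. The inner map contributes one factor t, and the
  weight t^j in \<open>ray_integral\<close> absorbs it, so the integrals of this form are closed
  under differentiation.\<close>

lemma ray_integral_derivative:
  fixes y0 :: "'a::euclidean_space"
  assumes F: "Ck_on (Suc k) (ball y0 r) F" and x: "x \<in> ball y0 r"
  shows "(ray_integral y0 j F has_derivative
    (\<lambda>v. ray_integral y0 (Suc j) (\<lambda>y. frechet_derivative F (at y) v) x)) (at x)"
proof -
  let ?D = "\<lambda>y. frechet_derivative F (at y)"
  \<comment> \<open>The derivative is packed as a bounded operator because
    \<open>leibniz_rule\<close> asks for continuity in the operator norm; in finite dimension this
    follows componentwise.\<close>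
  define fx where "fx x t = Blinfun (\<lambda>v. t ^ Suc j * ?D (y0 + t *\<^sub>R (x - y0)) v)" for x t
  have bl: "bounded_linear (\<lambda>v. t ^ Suc j * ?D (y0 + t *\<^sub>R (x - y0)) v)"
    if "x \<in> ball y0 r" "t \<in> {0..1}" for x t
    using Ck_on_SucD_derivative[OF F ray_in_ball[OF that]]
    by (intro bounded_linear_const_mult) (rule has_derivative_bounded_linear)
  have fx: "blinfun_apply (fx x t) = (\<lambda>v. t ^ Suc j * ?D (y0 + t *\<^sub>R (x - y0)) v)"
    if "x \<in> ball y0 r" "t \<in> {0..1}" for x t
    unfolding fx_def using bl[OF that] by (rule bounded_linear_Blinfun_apply)
  have contD: "continuous_on (ball y0 r \<times> cbox 0 1)
      (\<lambda>(x, t). t ^ Suc j * ?D (y0 + t *\<^sub>R (x - y0)) v)" for v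
  proof (rule continuous_on_ray)
    have "Ck_on k (ball y0 r) (\<lambda>y. ?D y v)" using F by simp
    then show "continuous_on (ball y0 r) (\<lambda>y. ?D y v)" by (rule Ck_on_imp_continuous_on)
  qed
  have cont: "continuous_on (ball y0 r \<times> cbox 0 1) (\<lambda>(x, t). fx x t)"
  proof (rule continuous_on_blinfun_componentwise)
    fix i :: 'a
    show "continuous_on (ball y0 r \<times> cbox 0 1) (\<lambda>p. blinfun_apply (case p of (x, t) \<Rightarrow> fx x t) i)"
      using contD[of i] by (rule continuous_on_cong[THEN iffD1, OF refl, rotated]) (auto simp: fx)
  qed
  have "((\<lambda>x. integral (cbox 0 1) (\<lambda>t. t ^ j * F (y0 + t *\<^sub>R (x - y0)))) has_derivative
     blinfun_apply (integral (cbox 0 1) (fx x))) (at x within ball y0 r)"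
  proof (rule leibniz_rule[OF _ _ cont x convex_ball])
    fix x t assume xt: "x \<in> ball y0 r" "t \<in> cbox 0 (1::real)"
    then have xt': "x \<in> ball y0 r" "t \<in> {0..1}" by auto
    have "((\<lambda>x. y0 + t *\<^sub>R (x - y0)) has_derivative (\<lambda>v. t *\<^sub>R v)) (at x)"
      by (auto intro!: derivative_eq_intros)
    from diff_chain_at[OF this Ck_on_SucD_derivative[OF F ray_in_ball[OF xt']]]
    have "((\<lambda>x. F (y0 + t *\<^sub>R (x - y0))) has_derivative
        (\<lambda>v. ?D (y0 + t *\<^sub>R (x - y0)) (t *\<^sub>R v))) (at x)"
      by (simp add: o_def)
    moreover have "?D (y0 + t *\<^sub>R (x - y0)) (t *\<^sub>R v) = t * ?D (y0 + t *\<^sub>R (x - y0)) v" for v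
      using Ck_on_SucD_derivative[OF F ray_in_ball[OF xt']] has_derivative_linear linear_scale
      by fastforce
    ultimately have "((\<lambda>x. F (y0 + t *\<^sub>R (x - y0))) has_derivative
        (\<lambda>v. t * ?D (y0 + t *\<^sub>R (x - y0)) v)) (at x)"
      by simp
    from has_derivative_mult_right[OF this, of "t ^ j"]
    have "((\<lambda>x. t ^ j * F (y0 + t *\<^sub>R (x - y0))) has_derivative blinfun_apply (fx x t)) (at x)"
      by (simp only: fx[OF xt'] power_Suc2 mult.assoc)
    then show "((\<lambda>x. t ^ j * F (y0 + t *\<^sub>R (x - y0))) has_derivative blinfun_apply (fx x t))
        (at x within ball y0 r)"
      by (rule has_derivative_at_withinI)
  next
    fix x assume xb: "x \<in> ball y0 r"
    have "Ck_on k (ball y0 r) F" using Ck_on_SucD[OF F] .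
    then have "continuous_on (ball y0 r) F" by (rule Ck_on_imp_continuous_on)
    from continuous_on_ray[OF this]
    have "continuous_on ((\<lambda>t. (x, t)) ` cbox 0 1) (\<lambda>(x, t). t ^ j * F (y0 + t *\<^sub>R (x - y0)))"
      by (rule continuous_on_subset) (use xb in auto)
    from continuous_on_compose[OF _ this]
    have "continuous_on (cbox 0 1) (\<lambda>t. t ^ j * F (y0 + t *\<^sub>R (x - y0)))"
      by (simp add: o_def continuous_on_Pair continuous_on_const continuous_on_id)
    then show "(\<lambda>t. t ^ j * F (y0 + t *\<^sub>R (x - y0))) integrable_on cbox 0 1"
      by (rule integrable_continuous)
  qed
  then have D: "(ray_integral y0 j F has_derivative blinfun_apply (integral (cbox 0 1) (fx x))) (at x)"
    by (simp add: ray_integral_def[abs_def] at_within_open[OF x open_ball])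
  have "blinfun_apply (integral (cbox 0 1) (fx x)) v =
      ray_integral y0 (Suc j) (\<lambda>y. ?D y v) x" for v
  proof -
    have "continuous_on ((\<lambda>t. (x, t)) ` cbox 0 1) (\<lambda>(x, t). fx x t)"
      using cont by (rule continuous_on_subset) (use x in auto)
    from continuous_on_compose[OF _ this] have "continuous_on (cbox 0 1) (fx x)"
      by (simp add: o_def continuous_on_Pair continuous_on_const continuous_on_id)
    then have "fx x integrable_on cbox 0 1"
      by (rule integrable_continuous)
    then have "blinfun_apply (integral (cbox 0 1) (fx x)) v = integral (cbox 0 1) (\<lambda>t. fx x t v)"
      by (rule blinfun_apply_integral)
    also have "\<dots> = ray_integral y0 (Suc j) (\<lambda>y. ?D y v) x"
      unfolding ray_integral_def using x by (auto intro!: integral_cong simp: fx)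
    finally show ?thesis .
  qed
  then have "blinfun_apply (integral (cbox 0 1) (fx x)) = (\<lambda>v. ray_integral y0 (Suc j) (\<lambda>y. ?D y v) x)"
    by (rule ext)
  with D show ?thesis by metis
qed

lemma Ck_on_ray_integral:
  fixes y0 :: "'a::euclidean_space"
  assumes "Ck_on k (ball y0 r) F"
  shows "Ck_on k (ball y0 r) (ray_integral y0 j F)"
  using assms
proof (induction k arbitrary: F j)
  case 0
  then have "continuous_on (ball y0 r) F" by simp
  from integral_continuous_on_param[OF continuous_on_ray[OF this], of j] show ?case
    by (simp add: ray_integral_def[abs_def])
next
  case (Suc k)
  show ?case
  proof (rule Ck_on_SucI[OF open_ball ray_integral_derivative[OF Suc.prems]])
    fix v
    show "Ck_on k (ball y0 r) (ray_integral y0 (Suc j) (\<lambda>y. frechet_derivative F (at y) v))"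
      using Suc.prems by (intro Suc.IH) simp
  qed
qed

text \<open>F y - F y0 is the integral, along the segment from y0 to y, of the derivative in
  direction y - y0. Expanding this direction in the basis gives the coefficients as integrals of
  partial derivatives, which are smooth by \<open>Ck_on_ray_integral\<close>.\<close>

lemma Hadamard_expansion:
  fixes y0 :: "'a::euclidean_space"
  assumes "smooth_on (ball y0 r) F" "r > 0"
  obtains G where "\<And>b. b \<in> Basis \<Longrightarrow> smooth_on (ball y0 r) (G b)"
    and "\<And>b. b \<in> Basis \<Longrightarrow> G b y0 = frechet_derivative F (at y0) b"
    and "\<And>y. y \<in> ball y0 r \<Longrightarrow> F y = F y0 + (\<Sum>b\<in>Basis. ((y - y0) \<bullet> b) * G b y)"
proof
  let ?D = "\<lambda>y. frechet_derivative F (at y)"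
  let ?G = "\<lambda>b. ray_integral y0 0 (\<lambda>y. ?D y b)"
  show "smooth_on (ball y0 r) (?G b)" for b
    using smooth_on_derivative[OF assms(1), of b] unfolding smooth_on_def
    by (auto intro: Ck_on_ray_integral)
  show "?G b y0 = ?D y0 b" for b
    by (simp add: ray_integral_def)
  show "F y = F y0 + (\<Sum>b\<in>Basis. ((y - y0) \<bullet> b) * ?G b y)" if y: "y \<in> ball y0 r" for y
  proof -
    have dF: "(F has_derivative ?D z) (at z)" if "z \<in> ball y0 r" for z
      using smooth_on_has_derivative[OF assms(1) that] .
    have "((\<lambda>t. F (y0 + t *\<^sub>R (y - y0))) has_vector_derivative ?D (y0 + t *\<^sub>R (y - y0)) (y - y0))
        (at t within {0..1})" if t: "t \<in> {0..1}" for t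
    proof -
      have "((\<lambda>t. y0 + t *\<^sub>R (y - y0)) has_derivative (\<lambda>s. s *\<^sub>R (y - y0))) (at t)"
        by (auto intro!: derivative_eq_intros)
      from diff_chain_at[OF this dF[OF ray_in_ball[OF y t]]]
      have "((\<lambda>t. F (y0 + t *\<^sub>R (y - y0))) has_derivative
          (\<lambda>s. ?D (y0 + t *\<^sub>R (y - y0)) (s *\<^sub>R (y - y0)))) (at t)"
        by (simp add: o_def)
      moreover have "?D (y0 + t *\<^sub>R (y - y0)) (s *\<^sub>R (y - y0))
          = s *\<^sub>R ?D (y0 + t *\<^sub>R (y - y0)) (y - y0)" for s
        using dF[OF ray_in_ball[OF y t]] has_derivative_linear linear_scale by blast
      ultimately show ?thesis
        unfolding has_vector_derivative_def by (auto intro: has_derivative_at_withinI)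
    qed
    from fundamental_theorem_of_calculus[OF _ this]
    have "((\<lambda>t. ?D (y0 + t *\<^sub>R (y - y0)) (y - y0)) has_integral (F y - F y0)) {0..1}"
      by simp
    then have "F y - F y0 = integral {0..1} (\<lambda>t. ?D (y0 + t *\<^sub>R (y - y0)) (y - y0))"
      by (simp add: integral_unique)
    also have "\<dots> = integral {0..1} (\<lambda>t. \<Sum>b\<in>Basis. ((y - y0) \<bullet> b) * ?D (y0 + t *\<^sub>R (y - y0)) b)"
    proof (rule integral_cong)
      fix t :: real assume t: "t \<in> {0..1}"
      have "linear (?D (y0 + t *\<^sub>R (y - y0)))"
        using dF[OF ray_in_ball[OF y t]] has_derivative_linear by blast
      then show "?D (y0 + t *\<^sub>R (y - y0)) (y - y0) =
          (\<Sum>b\<in>Basis. ((y - y0) \<bullet> b) * ?D (y0 + t *\<^sub>R (y - y0)) b)"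
        by (subst euclidean_representation[of "y - y0", symmetric])
           (simp add: linear_sum linear_scale)
    qed
    also have "\<dots> = (\<Sum>b\<in>Basis. ((y - y0) \<bullet> b) * ?G b y)"
    proof (subst integral_sum)
      fix b :: 'a
      have "Ck_on 0 (ball y0 r) (\<lambda>z. ?D z b)"
        using smooth_on_derivative[OF assms(1), of b] unfolding smooth_on_def by blast
      then have c: "continuous_on (ball y0 r) (\<lambda>z. ?D z b)" by simp
      have "continuous_on {0..1} (\<lambda>t. ?D (y0 + t *\<^sub>R (y - y0)) b)"
        by (rule continuous_on_compose2[OF c]) (auto intro!: continuous_intros ray_in_ball[OF y])
      then show "(\<lambda>t. ((y - y0) \<bullet> b) * ?D (y0 + t *\<^sub>R (y - y0)) b) integrable_on {0..1}"
        by (intro integrable_continuous_real continuous_intros)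
    qed (simp_all add: ray_integral_def)
    finally show ?thesis by simp
  qed
qed

lemmas scaleR_complex = scaleR_conv_of_real[where 'a=complex]

section \<open>Unitary matrices and the embedding of the flag manifold\<close>

type_synonym 'n cmat = "complex^(3 \<times> 'n)^(3 \<times> 'n)"

definition adj :: "complex^'m^'m \<Rightarrow> complex^'m^'m" where
  "adj A = (\<chi> i j. cnj (A $ j $ i))"

definition diag :: "('m \<Rightarrow> complex) \<Rightarrow> complex^'m^'m" where
  "diag d = (\<chi> i j. if i = j then d i else 0)"

lemma adj_nth [simp]: "adj A $ i $ j = cnj (A $ j $ i)"
  by (simp add: adj_def)

lemma adj_adj [simp]: "adj (adj A) = A"
  by (simp add: vec_eq_iff)

lemma adj_one [simp]: "adj (mat 1) = mat 1"
  by (simp add: vec_eq_iff mat_def)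

lemma adj_mult: "adj (A ** B) = adj B ** adj A"
  by (simp add: vec_eq_iff matrix_matrix_mult_def mult.commute)

lemma diag_nth: "diag d $ i $ j = (if i = j then d i else 0)"
  by (simp add: diag_def)

lemma diag_mult_nth [simp]: "(diag d ** A) $ i $ j = d i * A $ i $ j"
  by (simp add: matrix_matrix_mult_def diag_nth if_distrib if_distribR cong: if_cong)

lemma mult_diag_nth [simp]: "(A ** diag d) $ i $ j = A $ i $ j * d j"
  by (simp add: matrix_matrix_mult_def diag_nth if_distrib if_distribR cong: if_cong)

lemma adj_diag: "adj (diag d) = diag (\<lambda>i. cnj (d i))"
  by (simp add: vec_eq_iff diag_nth)

lemma det_diag: "det (diag d) = (\<Prod>i\<in>UNIV. d i)"
  by (subst det_diagonal) (simp_all add: diag_nth)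

lemma det_adj: "det (adj A) = cnj (det A)"
proof -
  have "det (adj A) = det (transpose (adj A))"
    by (simp add: det_transpose)
  also have "\<dots> = cnj (det A)"
    by (simp add: det_def transpose_def)
  finally show ?thesis .
qed

lemma SU_iff: "A \<in> SU \<longleftrightarrow> adj A ** A = mat 1 \<and> det A = 1"
  by (simp add: SU_def adj_def)

lemma SU_adj_mult: "A \<in> SU \<Longrightarrow> adj A ** A = mat 1"
  by (simp add: SU_iff)

lemma SU_mult_adj: "A \<in> SU \<Longrightarrow> A ** adj A = mat 1"
  using matrix_left_right_inverse SU_adj_mult by blast

lemma SU_one: "mat 1 \<in> SU"
  by (simp add: SU_iff)

lemma SU_mult: "A \<in> SU \<Longrightarrow> B \<in> SU \<Longrightarrow> A ** B \<in> SU"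
  by (auto simp: SU_iff adj_mult det_mul)
     (metis matrix_mul_assoc matrix_mul_lid)

lemma SU_adj: "A \<in> SU \<Longrightarrow> adj A \<in> SU"
  using SU_mult_adj[of A] by (simp add: SU_iff det_adj)

lemma unitary_det:
  assumes "adj V ** V = mat 1" shows "cnj (det V) * det V = 1"
  using arg_cong[OF assms, of det] by (simp add: det_mul det_adj)

text \<open>Distinct values make the stabiliser of \<open>Lam\<close> block-diagonal, real ones make
  the orbit Hermitian, and the roots of x^3 = x give a relation with trivial coefficients.\<close>

definition lam :: "3 \<Rightarrow> real" where
  "lam a = (if a = 1 then 1 else if a = 2 then 0 else -1)"

lemma lam_simps [simp]: "lam 1 = 1" "lam 2 = 0" "lam 3 = -1"
  by (simp_all add: lam_def)

lemma lam_eq_iff [simp]: "lam a = lam b \<longleftrightarrow> a = b"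
  using exhaust_3[of a] exhaust_3[of b] by (auto simp: lam_def)

definition Lam :: "'n::finite cmat" where
  "Lam = diag (\<lambda>i. of_real (lam (fst i)))"

lemma adj_Lam [simp]: "adj Lam = Lam"
  by (simp add: Lam_def adj_diag)

text \<open>Comparing the (i,j) entries of the two products, an entry between blocks with different
  eigenvalues must vanish.\<close>

lemma S_UUU_iff: "A \<in> S_UUU \<longleftrightarrow> A \<in> SU \<and> A ** Lam = Lam ** A"
proof -
  have "A ** Lam = Lam ** A \<longleftrightarrow> (\<forall>i j. lam (fst i) = lam (fst j) \<or> A $ i $ j = 0)"
    by (auto simp: vec_eq_iff Lam_def)
       (metis lam_eq_iff mult.commute mult_right_cancel of_real_eq_iff)+
  then show ?thesis
    by (auto simp: S_UUU_def)
qed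

lemma S_UUU_one: "mat 1 \<in> S_UUU"
  by (simp add: S_UUU_iff SU_one)

lemma S_UUU_mult: "A \<in> S_UUU \<Longrightarrow> B \<in> S_UUU \<Longrightarrow> A ** B \<in> S_UUU"
  by (auto simp: S_UUU_iff SU_mult) (metis matrix_mul_assoc)

lemma S_UUU_adj: "A \<in> S_UUU \<Longrightarrow> adj A \<in> S_UUU"
  by (auto simp: S_UUU_iff SU_adj) (metis adj_Lam adj_mult)

lemma S_UUU_SU: "A \<in> S_UUU \<Longrightarrow> A \<in> SU"
  by (simp add: S_UUU_iff)

lemma Rep_flag_of: "g \<in> SU \<Longrightarrow> Rep_flag (flag_of g) = (\<lambda>k. g ** k) ` S_UUU"
  unfolding flag_of_def by (rule Abs_flag_inverse) auto

lemma flag_cases: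
  obtains g where "g \<in> SU" "p = flag_of g"
  using Rep_flag[of p] unfolding flag_of_def
  by auto (metis Rep_flag_inverse)

lemma coset_eqI:
  assumes "g = h ** k" "k \<in> S_UUU"
  shows "(\<lambda>k. g ** k) ` S_UUU = (\<lambda>k. h ** k) ` S_UUU"
proof
  show "(\<lambda>k. g ** k) ` S_UUU \<subseteq> (\<lambda>k. h ** k) ` S_UUU"
    using assms S_UUU_mult by (auto simp: matrix_mul_assoc[symmetric])
  have "h ** k' = g ** (adj k ** k')" if "k' \<in> S_UUU" for k'
    using \<open>g = h ** k\<close> SU_mult_adj[OF S_UUU_SU[OF \<open>k \<in> S_UUU\<close>]]
    by (metis matrix_mul_assoc matrix_mul_lid)
  then show "(\<lambda>k. h ** k) ` S_UUU \<subseteq> (\<lambda>k. g ** k) ` S_UUU"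
    using assms(2) S_UUU_mult S_UUU_adj by blast
qed

text \<open>One direction makes the orbit map well defined on cosets, the other makes it injective.
  Both amount to \<open>adj h ** g\<close> commuting with \<open>Lam\<close>, that is, lying in the
  isotropy group.\<close>

lemma flag_of_eq_iff:
  assumes "g \<in> SU" "h \<in> SU"
  shows "flag_of g = flag_of h \<longleftrightarrow> g ** Lam ** adj g = h ** Lam ** adj h"
proof
  assume "flag_of g = flag_of h"
  then have "(\<lambda>k. g ** k) ` S_UUU = (\<lambda>k. h ** k) ` S_UUU"
    using Rep_flag_of assms by metis
  then have "g ** mat 1 \<in> (\<lambda>k. h ** k) ` S_UUU"
    using S_UUU_one by blast
  then obtain k where k: "k \<in> S_UUU" "g = h ** k" by auto
  then have "g ** Lam ** adj g = h ** (k ** Lam ** adj k) ** adj h"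
    by (simp add: adj_mult matrix_mul_assoc)
  also have "k ** Lam ** adj k = Lam"
    using k(1) by (metis S_UUU_iff SU_mult_adj matrix_mul_assoc matrix_mul_rid)
  finally show "g ** Lam ** adj g = h ** Lam ** adj h" .
next
  assume eq: "g ** Lam ** adj g = h ** Lam ** adj h"
  define k where "k = adj h ** g"
  have "adj h ** (g ** Lam ** adj g) ** g = adj h ** (h ** Lam ** adj h) ** g"
    using eq by simp
  then have "k ** Lam ** (adj g ** g) = (adj h ** h) ** Lam ** k"
    by (simp add: k_def matrix_mul_assoc)
  then have "k ** Lam = Lam ** k"
    using assms by (simp add: SU_adj_mult)
  then have "k \<in> S_UUU"
    using assms by (simp add: S_UUU_iff k_def SU_mult SU_adj)
  moreover have "g = h ** k"
    using assms by (simp add: k_def matrix_mul_assoc SU_mult_adj)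
  ultimately show "flag_of g = flag_of h"
    using coset_eqI unfolding flag_of_def by metis
qed

definition Phi :: "'n::finite flag \<Rightarrow> 'n cmat" where
  "Phi p = (let g = (SOME g. g \<in> SU \<and> p = flag_of g) in g ** Lam ** adj g)"

lemma Phi_flag_of: "g \<in> SU \<Longrightarrow> Phi (flag_of g) = g ** Lam ** adj g"
  unfolding Phi_def Let_def
  by (rule someI2[of _ g]) (use flag_of_eq_iff[of g] in \<open>auto dest: sym\<close>)

lemma Phi_inject [simp]: "Phi p = Phi q \<longleftrightarrow> p = q"
  by (metis Phi_flag_of flag_cases flag_of_eq_iff)

lemma left_action_flag_of:
  assumes "g \<in> SU" "h \<in> SU"
  shows "left_action g (flag_of h) = flag_of (g ** h)"
  unfolding left_action_def Rep_flag_of[OF assms(2)] image_image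
  by (simp add: flag_of_def matrix_mul_assoc)

lemma Phi_left_action: "g \<in> SU \<Longrightarrow> Phi (left_action g p) = g ** Phi p ** adj g"
  by (rule flag_cases[of p]) (simp add: left_action_flag_of Phi_flag_of SU_mult adj_mult matrix_mul_assoc)

lemma left_action_adj [simp]:
  "g \<in> SU \<Longrightarrow> left_action (adj g) (left_action g p) = p"
  "g \<in> SU \<Longrightarrow> left_action g (left_action (adj g) p) = p"
  by (rule flag_cases[of p],
      simp add: left_action_flag_of SU_mult SU_adj matrix_mul_assoc SU_adj_mult SU_mult_adj)+

text \<open>Rescaling one column by the conjugate of the determinant corrects the determinant. The
  diagonal factor commutes with \<open>Lam\<close>, so the orbit point is unchanged. The formula for
  \<open>g\<close> is part of the conclusion because its smooth dependence on \<open>V\<close>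
  matters in \<open>local_section\<close>.\<close>

lemma unitary_orbit_SU:
  fixes V :: "'n::finite cmat"
  assumes "adj V ** V = mat 1"
  obtains g where "g \<in> SU" "g ** Lam ** adj g = V ** Lam ** adj V"
    "g = V ** diag (\<lambda>j. if j = undefined then cnj (det V) else 1)"
proof
  let ?d = "\<lambda>j::3 \<times> 'n. if j = undefined then cnj (det V) else 1"
  have c: "cnj (det V) * det V = 1" by (rule unitary_det[OF assms])
  have D: "diag ?d ** Lam ** adj (diag ?d) = Lam"
    using c by (auto simp: vec_eq_iff adj_diag Lam_def diag_nth mult_ac)
  have "(V ** diag ?d) ** Lam ** adj (V ** diag ?d) = V ** (diag ?d ** Lam ** adj (diag ?d)) ** adj V"
    by (simp only: adj_mult matrix_mul_assoc)
  then show "(V ** diag ?d) ** Lam ** adj (V ** diag ?d) = V ** Lam ** adj V"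
    by (simp only: D)
  have D1: "adj (diag ?d) ** diag ?d = mat 1"
    using c by (auto simp: vec_eq_iff adj_diag diag_nth mat_def mult_ac)
  have "adj (V ** diag ?d) ** (V ** diag ?d) = adj (diag ?d) ** (adj V ** V) ** diag ?d"
    by (simp only: adj_mult matrix_mul_assoc)
  then have "adj (V ** diag ?d) ** (V ** diag ?d) = mat 1"
    by (simp only: assms D1 matrix_mul_rid)
  moreover have "det (V ** diag ?d) = 1"
    using c by (simp add: det_mul det_diag mult.commute)
  ultimately show "V ** diag ?d \<in> SU"
    by (simp add: SU_iff)
qed (rule refl)

lemma ex_Phi_unitary:
  assumes "adj V ** V = mat 1"
  shows "\<exists>p. Phi p = V ** Lam ** adj V"
  by (metis Phi_flag_of assms unitary_orbit_SU)

section \<open>Polynomial relations and spectral projections of orbit points\<close>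

lemma adj_Phi [simp]: "adj (Phi p) = Phi p"
  by (rule flag_cases[of p]) (simp add: Phi_flag_of adj_mult matrix_mul_assoc)

lemma conj_mult:
  assumes "adj g ** g = mat 1"
  shows "(g ** A ** adj g) ** (g ** B ** adj g) = g ** (A ** B) ** adj g"
proof -
  have "(g ** A ** adj g) ** (g ** B ** adj g) = g ** A ** (adj g ** g) ** B ** adj g"
    by (simp only: matrix_mul_assoc)
  then show ?thesis by (simp add: assms matrix_mul_assoc)
qed

lemma Lam_cube: "Lam ** Lam ** Lam = Lam"
proof -
  have "lam a * lam a * lam a = lam a" for a
    using exhaust_3[of a] by auto
  then show ?thesis
    by (auto simp: vec_eq_iff Lam_def diag_nth simp flip: of_real_mult)
qed

lemma Phi_cube: "Phi p ** Phi p ** Phi p = Phi p"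
  by (rule flag_cases[of p]) (simp add: Phi_flag_of conj_mult SU_adj_mult Lam_cube)

text \<open>\<open>proj2\<close>, \<open>proj1\<close> and \<open>proj0\<close> are the coefficients
  of x^2, x and 1 in the interpolation polynomials (x^2 + x) / 2, 1 - x^2 and (x^2 - x) / 2, for the
  blocks 1, 2 and 3, written uniformly in \<open>lam a\<close>.\<close>

definition proj2 :: "3 \<Rightarrow> real" where "proj2 a = (3 * (lam a)\<^sup>2 - 2) / 2"
definition proj1 :: "3 \<Rightarrow> real" where "proj1 a = lam a / 2"
definition proj0 :: "3 \<Rightarrow> real" where "proj0 a = 1 - (lam a)\<^sup>2"

text \<open>Lagrange interpolation: for \<open>Y\<close> with eigenvalues among the \<open>lam a\<close>, this is the spectral
  projection onto the eigenspace of \<open>lam a\<close>.\<close>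

definition Proj :: "3 \<Rightarrow> complex^'m^'m \<Rightarrow> complex^'m^'m" where
  "Proj a Y = proj2 a *\<^sub>R (Y ** Y) + proj1 a *\<^sub>R Y + proj0 a *\<^sub>R mat 1"

lemma matrix_scaleR_left: "(c *\<^sub>R A) ** B = c *\<^sub>R (A ** B)" for A B :: "complex^'m^'m"
  by (simp add: vec_eq_iff matrix_matrix_mult_def scaleR_sum_right)

lemma matrix_scaleR_right: "A ** (c *\<^sub>R B) = c *\<^sub>R (A ** B)" for A B :: "complex^'m^'m"
  by (simp add: vec_eq_iff matrix_matrix_mult_def scaleR_sum_right)

lemma matrix_add_rdistrib: "(A + B) ** C = A ** C + B ** C" for A B C :: "complex^'m^'m"
  by (simp add: vec_eq_iff matrix_matrix_mult_def distrib_right sum.distrib)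

lemma matrix_diff_ldistrib: "A ** (B - C) = A ** B - A ** C" for A B C :: "complex^'m^'m"
  by (simp add: vec_eq_iff matrix_matrix_mult_def right_diff_distrib sum_subtractf)

lemma matrix_diff_rdistrib: "(A - B) ** C = A ** C - B ** C" for A B C :: "complex^'m^'m"
  by (simp add: vec_eq_iff matrix_matrix_mult_def left_diff_distrib sum_subtractf)

text \<open>The interpolation polynomial times x - \<open>lam a\<close> is a constant multiple of
  x^3 - x.\<close>

lemma Proj_eigen:
  assumes "Y ** Y ** Y = Y"
  shows "Y ** Proj a Y = lam a *\<^sub>R Proj a Y"
  using exhaust_3[of a] assms
  by (auto simp: Proj_def matrix_add_ldistrib matrix_diff_ldistrib matrix_scaleR_right
      matrix_mul_assoc proj0_def proj1_def proj2_def algebra_simps)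

lemma Proj_Lam: "Proj a Lam = diag (\<lambda>i. if fst i = a then 1 else 0)"
proof -
  have "proj2 a * (lam b * lam b) + proj1 a * lam b + proj0 a = (if b = a then 1 else 0)" for b
    using exhaust_3[of a] exhaust_3[of b]
    by (auto simp: proj0_def proj1_def proj2_def)
  then have *: "complex_of_real (proj2 a) * (of_real (lam b) * of_real (lam b)) +
     of_real (proj1 a) * of_real (lam b) + of_real (proj0 a) = (if b = a then 1 else 0)" for b
    by (simp flip: of_real_mult of_real_add)
  show ?thesis
    by (auto simp: vec_eq_iff Proj_def Lam_def diag_nth mat_def scaleR_complex *)
qed

lemma Proj_conj:
  assumes "adj g ** g = mat 1"
  shows "Proj a (g ** Y ** adj g) = g ** Proj a Y ** adj g"
proof -
  have "g ** adj g = mat 1" using assms matrix_left_right_inverse by blast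
  then show ?thesis
    by (simp add: Proj_def conj_mult[OF assms] matrix_add_ldistrib matrix_add_rdistrib
        matrix_scaleR_left matrix_scaleR_right)
qed

section \<open>Local sections by Gram-Schmidt orthonormalisation\<close>

definition hip :: "complex^'m \<Rightarrow> complex^'m \<Rightarrow> complex" where
  "hip x y = (\<Sum>i\<in>UNIV. cnj (x $ i) * y $ i)"

lemma bilinear_hip: "bilinear hip"
  by (auto simp: bilinear_def linear_iff hip_def algebra_simps sum.distrib sum_distrib_left
      scaleR_complex)

lemma bilinear_times: "bilinear ((*) :: complex \<Rightarrow> _)"
  by (auto simp: bilinear_def linear_iff algebra_simps)

lemma bilinear_vector_scalar_mult: "bilinear ((*s) :: complex \<Rightarrow> complex^'m \<Rightarrow> _)"
  by (auto simp: bilinear_def linear_iff vec_eq_iff algebra_simps scaleR_complex)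

lemma bilinear_matrix_mult: "bilinear ((**) :: complex^'m^'m \<Rightarrow> complex^'m^'m \<Rightarrow> _)"
  by (auto simp: bilinear_def linear_iff matrix_add_ldistrib matrix_add_rdistrib
        matrix_scaleR_left matrix_scaleR_right)

lemma linear_matrix_vector_left: "linear (\<lambda>A :: complex^'m^'m. A *v x)"
  by (auto simp: linear_iff vec_eq_iff matrix_vector_mult_def algebra_simps sum.distrib
      scaleR_sum_right)

lemma hip_add_right: "hip x (y + z) = hip x y + hip x z"
  by (simp add: hip_def algebra_simps sum.distrib)

lemma hip_diff_right: "hip x (y - z) = hip x y - hip x z"
  by (simp add: hip_def algebra_simps sum_subtractf)

lemma hip_scale_right: "hip x (c *s y) = c * hip x y"
  by (simp add: hip_def sum_distrib_left algebra_simps)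

lemma hip_scaleR_right: "hip x (c *\<^sub>R y) = c *\<^sub>R hip x y"
  by (simp add: hip_def scaleR_sum_right)

lemma hip_scaleR_left: "hip (c *\<^sub>R x) y = c *\<^sub>R hip x y"
  by (simp add: hip_def scaleR_sum_right)

lemma hip_sum_right: "hip x (\<Sum>i\<in>S. f i) = (\<Sum>i\<in>S. hip x (f i))"
  by (induction S rule: infinite_finite_induct) (simp_all add: hip_add_right, simp_all add: hip_def)

lemma hip_cnj: "cnj (hip x y) = hip y x"
  by (simp add: hip_def mult.commute)

lemma hip_self: "hip x x = of_real (Re (hip x x))"
  using hip_cnj[of x x] by (metis Reals_cnj_iff of_real_Re)

lemma hip_axis: "hip (axis i 1) (axis j 1) = (if i = j then 1 else 0)"
proof -
  have "cnj (axis i 1 $ k) * axis j 1 $ k = (if k = i then axis j 1 $ k else (0::complex))" for k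
    by (simp add: axis_def)
  then have "hip (axis i 1) (axis j 1) = axis j 1 $ i"
    by (simp add: hip_def)
  then show ?thesis by (simp add: axis_def)
qed

lemma matrix_vector_axis: "(A *v axis j 1) $ i = A $ i $ j" for A :: "complex^'m^'k"
proof -
  have "A $ i $ k * axis j 1 $ k = (if k = j then A $ i $ k else 0)" for k
    by (simp add: axis_def)
  then show ?thesis by (simp add: matrix_vector_mult_def)
qed

lemma matrix_vector_scaleR: "A *v (c *\<^sub>R x) = c *\<^sub>R (A *v x)" for A :: "complex^'m^'k"
  by (simp add: vec_eq_iff matrix_vector_mult_def scaleR_sum_right)

lemma hip_adj: "hip x (A *v y) = hip (adj A *v x) y"
proof -
  have "hip x (A *v y) = (\<Sum>i\<in>UNIV. \<Sum>j\<in>UNIV. cnj (x $ i) * (A $ i $ j * y $ j))"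
    by (simp add: hip_def matrix_vector_mult_def sum_distrib_left)
  also have "\<dots> = (\<Sum>j\<in>UNIV. \<Sum>i\<in>UNIV. cnj (x $ i) * (A $ i $ j * y $ j))"
    by (rule sum.swap)
  also have "\<dots> = hip (adj A *v x) y"
    by (simp add: hip_def matrix_vector_mult_def sum_distrib_right sum_distrib_left mult_ac)
  finally show ?thesis .
qed

lemma hip_eigen_orthogonal:
  assumes "adj Y = Y" "Y *v x = a *\<^sub>R x" "Y *v y = b *\<^sub>R y" "a \<noteq> b"
  shows "hip x y = 0"
proof -
  have "b *\<^sub>R hip x y = a *\<^sub>R hip x y"
    using hip_adj[of x Y y] assms by (simp add: hip_scaleR_left hip_scaleR_right)
  then show ?thesis using assms(4) by simp
qed

lemma smooth_Proj: "open U \<Longrightarrow> smooth_map U (\<lambda>Y :: complex^'m^'m. Proj a Y)"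
  unfolding Proj_def
  by (intro smooth_map_add smooth_map_scaleR smooth_map_bilinear[OF _ bilinear_matrix_mult]
      smooth_map_id smooth_map_const)
     (auto simp: smooth_on_def Ck_on_const)

lemma smooth_map_matrix:
  fixes A :: "'a::euclidean_space \<Rightarrow> complex^'m^'k"
  assumes "open U" "\<And>i j. smooth_map U (\<lambda>x. A x $ i $ j)"
  shows "smooth_map U A"
proof -
  have "axis i (axis j z) $ k $ l = (if j = l then (if i = k then z else 0) else 0)"
    for i k :: 'k and j l :: 'm and z :: complex
    by (simp add: axis_def)
  then have "A x = (\<Sum>i\<in>UNIV. \<Sum>j\<in>UNIV. axis i (axis j (A x $ i $ j)))" for x
    by (simp add: vec_eq_iff)
  moreover have "smooth_map U (\<lambda>x. \<Sum>i\<in>UNIV. \<Sum>j\<in>UNIV. axis i (axis j (A x $ i $ j)))"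
    by (intro smooth_map_sum smooth_map_linear_compose[OF _ _ assms(2)] assms(1))
       (auto simp: linear_iff vec_eq_iff axis_def)
  ultimately show ?thesis by simp
qed

lemma smooth_map_entry:
  fixes A :: "'a::euclidean_space \<Rightarrow> complex^'m^'k"
  assumes "open U" "smooth_map U A"
  shows "smooth_map U (\<lambda>x. A x $ i $ j)"
  by (rule smooth_map_linear_compose[OF assms(1) _ assms(2), of "\<lambda>M. M $ i $ j"])
     (auto simp: linear_iff)

lemma smooth_map_prod:
  assumes U: "open U" and f: "\<And>i. i \<in> I \<Longrightarrow> smooth_map U (f i :: _ \<Rightarrow> complex)"
  shows "smooth_map U (\<lambda>x. \<Prod>i\<in>I. f i x)"
  using f
proof (induction I rule: infinite_finite_induct)
  case (insert i I)
  then have "smooth_map U (\<lambda>x. f i x * (\<Prod>i\<in>I. f i x))"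
    by (intro smooth_map_bilinear[OF U bilinear_times]) auto
  then show ?case using insert by simp
qed (auto simp: smooth_map_const U)

lemma smooth_map_det:
  fixes A :: "'a::euclidean_space \<Rightarrow> complex^'m^'m"
  assumes U: "open U" and A: "smooth_map U A"
  shows "smooth_map U (\<lambda>x. det (A x))"
  unfolding det_def
  by (intro smooth_map_sum smooth_map_bilinear[OF U bilinear_times] smooth_map_prod
      smooth_map_const smooth_map_entry U A)

text \<open>The columns remain eigenvectors of \<open>Y\<close>: projecting onto the complement of the previous columns
  only subtracts multiples of columns with the same eigenvalue.\<close>

lemma smooth_eigenbasis:
  fixes S :: "(3 \<times> 'n::finite) set"
  shows "\<exists>N (u :: 3 \<times> 'n \<Rightarrow> 'n cmat \<Rightarrow> complex^(3 \<times> 'n)). open N \<and> Lam \<in> N \<and>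
    (\<forall>j\<in>S. smooth_map N (u j) \<and> u j Lam = axis j 1) \<and>
    (\<forall>Y\<in>N. adj Y = Y \<and> Y ** Y ** Y = Y \<longrightarrow>
      (\<forall>j\<in>S. Y *v u j Y = lam (fst j) *\<^sub>R u j Y) \<and>
      (\<forall>i\<in>S. \<forall>j\<in>S. hip (u i Y) (u j Y) = (if i = j then 1 else 0)))"
proof -
  have "finite S" by simp
  then show ?thesis
  proof (induction S rule: finite_induct)
    case empty
    show ?case by (intro exI[of _ UNIV]) auto
  next
    case (insert j S)
    from insert.IH obtain N and u :: "3 \<times> 'n \<Rightarrow> 'n cmat \<Rightarrow> complex^(3 \<times> 'n)"
      where N: "open N" "Lam \<in> N"
      and smu: "\<forall>j\<in>S. smooth_map N (u j) \<and> u j Lam = axis j 1"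
      and eo: "\<forall>Y\<in>N. adj Y = Y \<and> Y ** Y ** Y = Y \<longrightarrow>
        (\<forall>j\<in>S. Y *v u j Y = lam (fst j) *\<^sub>R u j Y) \<and>
        (\<forall>i\<in>S. \<forall>j\<in>S. hip (u i Y) (u j Y) = (if i = j then 1 else 0))"
      by (elim exE conjE) (rule that)
    have sm: "\<And>i. i \<in> S \<Longrightarrow> smooth_map N (u i)" and uL: "\<And>i. i \<in> S \<Longrightarrow> u i Lam = axis i 1"
      using smu by auto
    have eig: "\<And>Y i. \<lbrakk>Y \<in> N; adj Y = Y; Y ** Y ** Y = Y; i \<in> S\<rbrakk> \<Longrightarrow>
          Y *v u i Y = lam (fst i) *\<^sub>R u i Y"
      and on: "\<And>Y i k. \<lbrakk>Y \<in> N; adj Y = Y; Y ** Y ** Y = Y; i \<in> S; k \<in> S\<rbrakk> \<Longrightarrow>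
          hip (u i Y) (u k Y) = (if i = k then 1 else 0)"
      using eo by simp_all
    \<comment> \<open>For every \<open>Y\<close> with Y^3 = Y the projection turns the coordinate
      vector into an element of the required eigenspace, possibly zero; at \<open>Lam\<close> it
      leaves the coordinate vector unchanged.\<close>
    define c where "c Y = Proj (fst j) Y *v axis j 1" for Y :: "'n cmat"
    define b where "b Y = c Y + - (\<Sum>i\<in>S. hip (u i Y) (c Y) *s u i Y)" for Y
    define q where "q Y = Re (hip (b Y) (b Y))" for Y
    define w where "w Y = q Y powr (- 1 / 2) *\<^sub>R b Y" for Y
    \<comment> \<open>Normalisation needs a positive norm. This is an open condition because
      \<open>q\<close> is continuous, and it holds at \<open>Lam\<close>, where \<open>q\<close> is
      1.\<close>
    define N' where "N' = N \<inter> q -` {0<..}"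
    have smc: "smooth_map N c" unfolding c_def
      by (rule smooth_map_linear_compose[OF N(1) linear_matrix_vector_left smooth_Proj[OF N(1)]])
    have smb: "smooth_map N b" unfolding b_def
      by (intro smooth_map_add smooth_map_linear_compose[of N uminus] smooth_map_sum smc N
        smooth_map_bilinear[OF _ bilinear_vector_scalar_mult] smooth_map_bilinear[OF _ bilinear_hip] sm)
        (auto simp: linear_iff)
    have smq: "smooth_map N q" unfolding q_def
      by (intro smooth_map_linear_compose[OF N(1), of Re] smooth_map_bilinear[OF N(1) bilinear_hip] smb)
         (simp add: linear_iff)
    have N': "open N'" unfolding N'_def
      using smooth_map_continuous_on[OF smq] N(1) by (auto intro: continuous_open_preimage)
    have cL: "c Lam = axis j 1"
      by (auto simp: vec_eq_iff c_def Proj_Lam matrix_vector_axis diag_nth) (auto simp: axis_def)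
    have bL: "b Lam = axis j 1"
    proof -
      have "hip (u i Lam) (c Lam) = 0" if "i \<in> S" for i
        using that insert.hyps uL by (auto simp: cL hip_axis)
      then show ?thesis by (simp add: b_def cL)
    qed
    then have qL: "q Lam = 1" by (simp add: q_def hip_axis)
    have smw: "smooth_map N' w" unfolding w_def
    proof (intro smooth_map_scaleR N')
      show "smooth_map N' b" using smb by (rule smooth_map_subset) (auto simp: N'_def)
      show "smooth_on N' (\<lambda>Y. q Y powr (- 1 / 2))"
        by (rule smooth_on_compose[OF N' smooth_on_powr]) 
           (auto simp: N'_def intro: smooth_map_subset[OF smq])
    qed
    have Yc: "Y *v c Y = lam (fst j) *\<^sub>R c Y" if "Y ** Y ** Y = Y" for Y
      using Proj_eigen[OF that, of "fst j"] unfolding c_def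
      using linear_scale[OF linear_matrix_vector_left] by (simp add: matrix_vector_mul_assoc)
    have props: "Y *v b Y = lam (fst j) *\<^sub>R b Y \<and> (\<forall>i\<in>S. hip (u i Y) (b Y) = 0)"
      if Y: "Y \<in> N" "adj Y = Y" "Y ** Y ** Y = Y" for Y
    proof
      have "Y *v (hip (u i Y) (c Y) *s u i Y) = lam (fst j) *\<^sub>R (hip (u i Y) (c Y) *s u i Y)"
        if i: "i \<in> S" for i
      proof (cases "fst i = fst j")
        case True
        then show ?thesis
          using eig[OF Y i] by (simp add: vec.scale vec_eq_iff scaleR_complex)
      next
        case False
        then have "hip (u i Y) (c Y) = 0"
          using hip_eigen_orthogonal[OF Y(2) eig[OF Y i] Yc[OF Y(3)]] by simp
        then show ?thesis by simp
      qed
      then have "Y *v (\<Sum>i\<in>S. hip (u i Y) (c Y) *s u i Y) =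
          lam (fst j) *\<^sub>R (\<Sum>i\<in>S. hip (u i Y) (c Y) *s u i Y)"
        by (simp add: vec.sum scaleR_sum_right)
      then show "Y *v b Y = lam (fst j) *\<^sub>R b Y"
        using Yc[OF Y(3)] by (simp add: b_def vec.diff scaleR_diff_right)
      show "\<forall>i\<in>S. hip (u i Y) (b Y) = 0"
      proof
        fix i assume i: "i \<in> S"
        have "(\<Sum>k\<in>S. hip (u k Y) (c Y) * hip (u i Y) (u k Y)) =
            (\<Sum>k\<in>S. if k = i then hip (u i Y) (c Y) else 0)"
          using on[OF Y i] by (intro sum.cong) auto
        then show "hip (u i Y) (b Y) = 0"
          using i insert.hyps(1) by (simp add: b_def hip_diff_right hip_sum_right hip_scale_right)
      qed
    qed
    show ?case
    proof (intro exI[of _ N'] exI[of _ "u(j := w)"] conjI ballI impI)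
      show "open N'" by (rule N')
      show "Lam \<in> N'" using N qL by (simp add: N'_def)
      show "smooth_map N' ((u(j := w)) i)" if "i \<in> insert j S" for i
        using that smw smooth_map_subset[OF sm[of i], of N'] by (cases "i = j") (auto simp: N'_def)
      show "(u(j := w)) i Lam = axis i 1" if "i \<in> insert j S" for i
        using that uL[of i] by (cases "i = j") (auto simp: w_def bL qL)
    next
      fix Y i assume Y: "Y \<in> N'" "adj Y = Y \<and> Y ** Y ** Y = Y" and i: "i \<in> insert j S"
      then have Y': "Y \<in> N" "adj Y = Y" "Y ** Y ** Y = Y" by (auto simp: N'_def)
      show "Y *v (u(j := w)) i Y = lam (fst i) *\<^sub>R (u(j := w)) i Y"
        using i eig[OF Y', of i] props[OF Y']
        by (cases "i = j") (auto simp: w_def matrix_vector_scaleR mult.commute)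
    next
      fix Y i k assume Y: "Y \<in> N'" "adj Y = Y \<and> Y ** Y ** Y = Y"
        and ik: "i \<in> insert j S" "k \<in> insert j S"
      then have Y': "Y \<in> N" "adj Y = Y" "Y ** Y ** Y = Y" and q: "q Y > 0" by (auto simp: N'_def)
      have jw: "hip (u i Y) (w Y) = 0" "hip (w Y) (u i Y) = 0" if "i \<in> S" for i
        using props[OF Y'] that hip_cnj[of "u i Y" "w Y"]
        by (auto simp: w_def hip_scaleR_right)
      have "hip (w Y) (w Y) = of_real (q Y powr (- 1 / 2) * (q Y powr (- 1 / 2) * q Y))"
        using hip_self[of "b Y"]
        by (simp add: w_def hip_scaleR_right hip_scaleR_left q_def scaleR_complex)
      also have "q Y powr (- 1 / 2) * (q Y powr (- 1 / 2) * q Y) = 1"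
      proof -
        have "q Y powr (- 1 / 2) * q Y powr (- 1 / 2) = q Y powr (- 1)"
          by (subst powr_add[symmetric]) simp
        also have "\<dots> = inverse (q Y)" using q by (simp add: powr_minus)
        finally show ?thesis using q by (simp only: mult.assoc[symmetric]) simp
      qed
      finally show "hip ((u(j := w)) i Y) ((u(j := w)) k Y) = (if i = k then 1 else 0)"
        using ik on[OF Y', of i k] jw[of i] jw[of k] insert.hyps(2)
        by (cases "i = j"; cases "k = j") auto
    qed
  qed
qed

text \<open>With the smooth eigenbasis as columns, V is unitary and Y V = V \<open>Lam\<close> at
  every orbit point Y near \<open>Lam\<close>. The rescaling of \<open>unitary_orbit_SU\<close> then
  brings V into \<open>SU\<close>.\<close>

lemma local_section:
  obtains N and W :: "'n::finite cmat \<Rightarrow> 'n cmat" where "open N" "Lam \<in> N" "smooth_map N W"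
    "W Lam = mat 1"
    "\<And>p. Phi p \<in> N \<Longrightarrow> W (Phi p) \<in> SU \<and> flag_of (W (Phi p)) = p"
proof -
  obtain N and u :: "3 \<times> 'n \<Rightarrow> 'n cmat \<Rightarrow> complex^(3 \<times> 'n)"
    where N: "open N" "Lam \<in> N"
    and sm: "\<forall>j\<in>UNIV. smooth_map N (u j) \<and> u j Lam = axis j 1"
    and eo: "\<forall>Y\<in>N. adj Y = Y \<and> Y ** Y ** Y = Y \<longrightarrow>
      (\<forall>j\<in>UNIV. Y *v u j Y = lam (fst j) *\<^sub>R u j Y) \<and>
      (\<forall>i\<in>UNIV. \<forall>j\<in>UNIV. hip (u i Y) (u j Y) = (if i = j then 1 else 0))"
    using smooth_eigenbasis[of UNIV] by (elim exE conjE) (rule that)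
  define V :: "'n cmat \<Rightarrow> 'n cmat" where "V Y = (\<chi> i j. u j Y $ i)" for Y
  define D :: "'n cmat \<Rightarrow> 'n cmat" where "D Y = diag (\<lambda>j. if j = undefined then cnj (det (V Y)) else 1)" for Y
  have smV: "smooth_map N V"
    unfolding V_def
  proof (rule smooth_map_matrix[OF N(1)])
    fix i j
    show "smooth_map N (\<lambda>Y. (\<chi> i j. u j Y $ i) $ i $ j)"
      using smooth_map_linear_compose[OF N(1) _ sm[rule_format, THEN conjunct1, of j], of "\<lambda>x. x $ i"]
      by (simp add: linear_iff)
  qed
  have smD: "smooth_map N D"
    unfolding D_def
  proof (rule smooth_map_matrix[OF N(1)])
    fix i j
    have "smooth_map N (\<lambda>Y. cnj (det (V Y)))"
      by (rule smooth_map_linear_compose[OF N(1) _ smooth_map_det[OF N(1) smV]]) (simp add: linear_iff)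
    then show "smooth_map N (\<lambda>Y. diag (\<lambda>j. if j = undefined then cnj (det (V Y)) else 1) $ i $ j)"
      by (cases "i = j"; cases "j = undefined") (auto simp: diag_nth smooth_map_const N(1))
  qed
  have VL: "V Lam = mat 1"
    using sm by (auto simp: V_def vec_eq_iff mat_def axis_def)
  have "D Lam = mat 1"
  proof -
    have "det (V Lam) = 1" by (simp add: VL)
    then show ?thesis by (simp add: D_def vec_eq_iff diag_nth mat_def)
  qed
  then have WL: "V Lam ** D Lam = mat 1" by (simp add: VL)
  have "V (Phi p) ** D (Phi p) \<in> SU \<and> flag_of (V (Phi p) ** D (Phi p)) = p" if "Phi p \<in> N" for p
  proof -
    let ?Y = "Phi p"
    have eig: "?Y *v u j ?Y = lam (fst j) *\<^sub>R u j ?Y"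
      and on: "hip (u i ?Y) (u j ?Y) = (if i = j then 1 else 0)" for i j
      using eo that Phi_cube adj_Phi by blast+
    have un: "adj (V ?Y) ** V ?Y = mat 1"
      using on by (simp add: vec_eq_iff matrix_matrix_mult_def V_def hip_def mat_def)
    have "(?Y ** V ?Y) $ i $ j = (V ?Y ** Lam) $ i $ j" for i j
    proof -
      have "(?Y ** V ?Y) $ i $ j = (?Y *v u j ?Y) $ i"
        by (simp add: matrix_matrix_mult_def matrix_vector_mult_def V_def)
      then show ?thesis by (simp add: eig Lam_def V_def scaleR_complex)
    qed
    then have YV: "?Y ** V ?Y = V ?Y ** Lam" by (simp add: vec_eq_iff)
    obtain g where g: "g \<in> SU" "g ** Lam ** adj g = V ?Y ** Lam ** adj (V ?Y)" "g = V ?Y ** D ?Y"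
      using unitary_orbit_SU[OF un] unfolding D_def by metis
    have "V ?Y ** Lam ** adj (V ?Y) = ?Y ** (V ?Y ** adj (V ?Y))"
      by (simp add: YV[symmetric] matrix_mul_assoc)
    also have "V ?Y ** adj (V ?Y) = mat 1"
      using un matrix_left_right_inverse by blast
    finally have "Phi (flag_of g) = Phi p"
      using g(1,2) by (simp add: Phi_flag_of)
    then show ?thesis using g by simp
  qed
  then show ?thesis
    using that[of N "\<lambda>Y. V Y ** D Y"] N WL smooth_map_bilinear[OF N(1) bilinear_matrix_mult smV smD]
    by blast
qed

section \<open>Smooth functions on the quotient as local restrictions of ambient functions\<close>

definition smooth_at :: "('n::finite flag \<Rightarrow> real) \<Rightarrow> 'n flag \<Rightarrow> bool" where
  "smooth_at f p \<longleftrightarrow> (\<exists>U F. open U \<and> Phi p \<in> U \<and> smooth_on U F \<and>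
     (\<forall>q. Phi q \<in> U \<longrightarrow> f q = F (Phi q)))"

lemma linear_adj: "linear adj"
  by (simp add: linear_iff vec_eq_iff)

lemma smooth_map_conj: "open U \<Longrightarrow> smooth_map U (\<lambda>Y. a ** Y ** b)" for a b :: "complex^'m^'m"
  by (intro smooth_map_bilinear[OF _ bilinear_matrix_mult] smooth_map_const smooth_map_id)

text \<open>From lifts to ambient functions one composes with a smooth local section; from ambient
  functions to lifts one composes with the polynomial map g |-> g \<open>Lam\<close>
  \<open>adj\<close> g, which is defined on all matrices.\<close>

theorem flag_smooth_iff:
  fixes f :: "'n::finite flag \<Rightarrow> real"
  shows "f \<in> flag_smooth \<longleftrightarrow> (\<forall>p. smooth_at f p)"
proof
  assume f: "f \<in> flag_smooth"
  show "\<forall>p. smooth_at f p"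
  proof
    fix p :: "'n flag"
    obtain g where g: "g \<in> SU" "p = flag_of g" by (rule flag_cases)
    obtain N and W :: "'n cmat \<Rightarrow> 'n cmat" where N: "open N" "Lam \<in> N" "smooth_map N W"
      and WL: "W Lam = mat 1"
      and W: "\<And>p. Phi p \<in> N \<Longrightarrow> W (Phi p) \<in> SU \<and> flag_of (W (Phi p)) = p"
      using local_section by blast
    obtain H F where H: "open H" "g \<in> H" "smooth_on H F" "\<forall>y\<in>SU \<inter> H. F y = f (flag_of y)"
      using f g(1) unfolding flag_smooth_def smooth_on_subset_def by blast
    define N' where "N' = (\<lambda>Y. adj g ** Y ** g) -` N"
    \<comment> \<open>The section near \<open>Lam\<close>, transported by the action of
      \<open>g\<close>. It sends \<open>Phi p\<close> to \<open>g\<close>, around which the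
      extension \<open>F\<close> of the lift is given.\<close>
    define s where "s Y = g ** W (adj g ** Y ** g)" for Y
    have N': "open N'"
      unfolding N'_def
      by (intro open_vimage N smooth_map_continuous_on smooth_map_conj open_UNIV)
    have sms: "smooth_map N' s"
      unfolding s_def
      by (intro smooth_map_bilinear[OF N' bilinear_matrix_mult] smooth_map_const N'
          smooth_map_compose[OF N' N(3)] smooth_map_conj) (auto simp: N'_def)
    have base: "adj g ** Phi p ** g = Lam"
      using g SU_adj_mult[OF g(1)]
      by (simp add: Phi_flag_of) (metis matrix_mul_assoc matrix_mul_lid matrix_mul_rid)
    define U where "U = N' \<inter> s -` H"
    have U: "open U"
      unfolding U_def
      by (rule continuous_open_preimage[OF smooth_map_continuous_on[OF sms] N' H(1)])
    have pU: "Phi p \<in> U"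
      using N(2) H(2) by (simp add: U_def N'_def s_def base WL)
    have "f q = F (s (Phi q))" if q: "Phi q \<in> U" for q
    proof -
      let ?q = "left_action (adj g) q"
      have Pq: "adj g ** Phi q ** g = Phi ?q"
        using g by (simp add: Phi_left_action SU_adj)
      then have "W (Phi ?q) \<in> SU" "flag_of (W (Phi ?q)) = ?q"
        using W q by (auto simp: U_def N'_def)
      then have "s (Phi q) \<in> SU" "flag_of (s (Phi q)) = q"
        using g left_action_flag_of[OF g(1), of "W (Phi ?q)"] by (simp_all add: s_def Pq SU_mult)
      then show ?thesis using H(4) q by (simp add: U_def)
    qed
    moreover have "smooth_on U (\<lambda>Y. F (s Y))"
      by (rule smooth_on_compose[OF U H(3)]) (auto simp: U_def intro: smooth_map_subset[OF sms])
    ultimately show "smooth_at f p"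
      unfolding smooth_at_def using U pU by blast
  qed
next
  assume *: "\<forall>p. smooth_at f p"
  show "f \<in> flag_smooth"
    unfolding flag_smooth_def smooth_on_subset_def
  proof (intro CollectI ballI)
    fix g :: "'n cmat" assume g: "g \<in> SU"
    obtain U F where UF: "open U" "Phi (flag_of g) \<in> U" "smooth_on U F" "\<forall>q. Phi q \<in> U \<longrightarrow> f q = F (Phi q)"
      using * unfolding smooth_at_def by blast
    let ?h = "\<lambda>g :: 'n cmat. g ** Lam ** adj g"
    have smh: "smooth_map V ?h" if "open V" for V
      by (intro smooth_map_bilinear[OF that bilinear_matrix_mult] smooth_map_const smooth_map_id that
          smooth_map_linear_compose[OF that linear_adj])
    have o: "open (?h -` U)"
      by (intro open_vimage UF smooth_map_continuous_on smh open_UNIV)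
    have "smooth_on (?h -` U) (\<lambda>g. F (?h g))"
      by (rule smooth_on_compose[OF o UF(3) smh[OF o]]) auto
    moreover have "\<forall>y\<in>SU \<inter> ?h -` U. F (?h y) = f (flag_of y)"
      using UF(4) by (auto simp: Phi_flag_of)
    ultimately show "\<exists>V F. open V \<and> g \<in> V \<and> smooth_on V F \<and> (\<forall>y\<in>SU \<inter> V. F y = f (flag_of y))"
      using o UF(2) g by (intro exI[of _ "?h -` U"]) (auto simp: Phi_flag_of)
  qed
qed

section \<open>Tangent vectors of the flag manifold\<close>

lemma diffeomorphism_comp_iff:
  assumes "diffeomorphism C \<phi>" shows "f \<circ> \<phi> \<in> C \<longleftrightarrow> f \<in> C"
proof
  assume "f \<circ> \<phi> \<in> C"
  then have "f \<circ> \<phi> \<circ> inv \<phi> \<in> C" using assms by (simp add: diffeomorphism_def)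
  moreover have "f \<circ> \<phi> \<circ> inv \<phi> = f"
    using assms by (auto simp: diffeomorphism_def bij_def surj_f_inv_f)
  ultimately show "f \<in> C" by simp
qed (use assms in \<open>simp add: diffeomorphism_def\<close>)

lemma pushforward_tangent:
  assumes \<phi>: "diffeomorphism C \<phi>" and v: "v \<in> tangent_space C p"
  shows "pushforward \<phi> v \<in> tangent_space C (\<phi> p)"
proof -
  have L: "v (\<lambda>x. a * f x + b * g x) = a * v f + b * v g" if "f \<in> C" "g \<in> C" for f g a b
    using v that by (simp add: tangent_space_def)
  have M: "v (\<lambda>x. f x * g x) = f p * v g + g p * v f" if "f \<in> C" "g \<in> C" for f g
    using v that by (simp add: tangent_space_def)
  have Z: "v f = 0" if "f \<notin> C" for f
    using v that by (simp add: tangent_space_def)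
  note [simp] = diffeomorphism_comp_iff[OF \<phi>]
  show ?thesis
    unfolding tangent_space_def pushforward_def
  proof (intro CollectI conjI ballI allI impI)
    fix f g :: "'a \<Rightarrow> real" and a b :: real assume fg: "f \<in> C" "g \<in> C"
    then have fg': "f \<circ> \<phi> \<in> C" "g \<circ> \<phi> \<in> C" by simp_all
    show "v ((\<lambda>x. a * f x + b * g x) \<circ> \<phi>) = a * v (f \<circ> \<phi>) + b * v (g \<circ> \<phi>)"
      using L[OF fg', of a b] by (simp add: o_def)
    show "v ((\<lambda>x. f x * g x) \<circ> \<phi>) = f (\<phi> p) * v (g \<circ> \<phi>) + g (\<phi> p) * v (f \<circ> \<phi>)"
      using M[OF fg'] by (simp add: o_def)
  qed (use Z in auto)
qed

lemma tangent_linear: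
  "v \<in> tangent_space C p \<Longrightarrow> f \<in> C \<Longrightarrow> g \<in> C \<Longrightarrow> v (\<lambda>x. a * f x + b * g x) = a * v f + b * v g"
  by (simp add: tangent_space_def)

lemma tangent_mult:
  "v \<in> tangent_space C p \<Longrightarrow> f \<in> C \<Longrightarrow> g \<in> C \<Longrightarrow> v (\<lambda>x. f x * g x) = f p * v g + g p * v f"
  by (simp add: tangent_space_def)

lemma tangent_outside: "v \<in> tangent_space C p \<Longrightarrow> f \<notin> C \<Longrightarrow> v f = 0"
  by (simp add: tangent_space_def)

lemma tangent_space_lincomb:
  "v \<in> tangent_space C p \<Longrightarrow> w \<in> tangent_space C p \<Longrightarrow> (\<lambda>f. a * v f + b * w f) \<in> tangent_space C p"
  by (simp add: tangent_space_def algebra_simps)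

lemma tangent_space_uminus:
  "v \<in> tangent_space C p \<Longrightarrow> (\<lambda>f. - v f) \<in> tangent_space C p"
  using tangent_space_lincomb[of v C p v "-1" 0] by simp

section \<open>The algebra of smooth functions and its derivations\<close>

lemma flag_smoothD: "f \<in> flag_smooth \<Longrightarrow> smooth_at f p"
  by (simp add: flag_smooth_iff)

lemma flag_smoothI: "(\<And>p. smooth_at f p) \<Longrightarrow> f \<in> flag_smooth"
  by (simp add: flag_smooth_iff)

lemma smooth_atI:
  "open U \<Longrightarrow> Phi p \<in> U \<Longrightarrow> smooth_on U F \<Longrightarrow> (\<And>q. Phi q \<in> U \<Longrightarrow> f q = F (Phi q)) \<Longrightarrow>
    smooth_at f p"
  unfolding smooth_at_def by blast

lemma smooth_atE:
  assumes "smooth_at f p"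
  obtains U F where "open U" "Phi p \<in> U" "smooth_on U F" "\<And>q. Phi q \<in> U \<Longrightarrow> f q = F (Phi q)"
  using assms unfolding smooth_at_def by blast

lemma smooth_at_cong:
  assumes "smooth_at f p" "open U" "Phi p \<in> U" "\<And>q. Phi q \<in> U \<Longrightarrow> g q = f q"
  shows "smooth_at g p"
proof -
  obtain V F where V: "open V" "Phi p \<in> V" "smooth_on V F" "\<And>q. Phi q \<in> V \<Longrightarrow> f q = F (Phi q)"
    using smooth_atE[OF assms(1)] by blast
  show ?thesis
    by (rule smooth_atI[of "U \<inter> V" p F]) (use V assms smooth_on_subset_mono[OF V(3)] in auto)
qed

lemma flag_smooth_ambient: "smooth_on UNIV F \<Longrightarrow> (\<lambda>q. F (Phi q)) \<in> flag_smooth"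
  by (intro flag_smoothI smooth_atI[of UNIV _ F]) simp_all

lemma flag_smooth_const [simp]: "(\<lambda>q. c) \<in> flag_smooth"
  using flag_smooth_ambient[of "\<lambda>_. c"] by (simp add: smooth_on_def Ck_on_const)

lemma smooth_at_add:
  assumes "smooth_at f p" "smooth_at g p" shows "smooth_at (\<lambda>q. f q + g q) p"
proof -
  obtain U F where U: "open U" "Phi p \<in> U" "smooth_on U F" "\<And>q. Phi q \<in> U \<Longrightarrow> f q = F (Phi q)"
    using smooth_atE[OF assms(1)] by blast
  obtain V G where V: "open V" "Phi p \<in> V" "smooth_on V G" "\<And>q. Phi q \<in> V \<Longrightarrow> g q = G (Phi q)"
    using smooth_atE[OF assms(2)] by blast
  have "smooth_on (U \<inter> V) (\<lambda>y. F y + G y)"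
    using smooth_on_subset_mono[OF U(3), of "U \<inter> V"] smooth_on_subset_mono[OF V(3), of "U \<inter> V"] U V
    by (auto simp: smooth_on_def intro!: Ck_on_add)
  then show ?thesis
    by (rule smooth_atI[rotated 2]) (use U V in auto)
qed

lemma smooth_at_mult:
  assumes "smooth_at f p" "smooth_at g p" shows "smooth_at (\<lambda>q. f q * g q) p"
proof -
  obtain U F where U: "open U" "Phi p \<in> U" "smooth_on U F" "\<And>q. Phi q \<in> U \<Longrightarrow> f q = F (Phi q)"
    using smooth_atE[OF assms(1)] by blast
  obtain V G where V: "open V" "Phi p \<in> V" "smooth_on V G" "\<And>q. Phi q \<in> V \<Longrightarrow> g q = G (Phi q)"
    using smooth_atE[OF assms(2)] by blast
  have "smooth_on (U \<inter> V) (\<lambda>y. F y * G y)"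
    using smooth_on_subset_mono[OF U(3), of "U \<inter> V"] smooth_on_subset_mono[OF V(3), of "U \<inter> V"] U V
    by (auto simp: smooth_on_def intro!: Ck_on_mult)
  then show ?thesis
    by (rule smooth_atI[rotated 2]) (use U V in auto)
qed

lemma smooth_at_sum:
  "(\<And>i. i \<in> I \<Longrightarrow> smooth_at (f i) p) \<Longrightarrow> smooth_at (\<lambda>q. \<Sum>i\<in>I. f i q) p"
  by (induction I rule: infinite_finite_induct)
     (auto intro: smooth_at_add flag_smoothD[OF flag_smooth_const])

lemma flag_smooth_add:
  "f \<in> flag_smooth \<Longrightarrow> g \<in> flag_smooth \<Longrightarrow> (\<lambda>q. f q + g q) \<in> flag_smooth"
  by (simp add: flag_smooth_iff smooth_at_add)

lemma flag_smooth_mult: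
  "f \<in> flag_smooth \<Longrightarrow> g \<in> flag_smooth \<Longrightarrow> (\<lambda>q. f q * g q) \<in> flag_smooth"
  by (simp add: flag_smooth_iff smooth_at_mult)

lemma flag_smooth_lincomb:
  "f \<in> flag_smooth \<Longrightarrow> g \<in> flag_smooth \<Longrightarrow> (\<lambda>q. a * f q + b * g q) \<in> flag_smooth"
  by (intro flag_smooth_add flag_smooth_mult flag_smooth_const)

lemma flag_smooth_sum:
  "(\<And>i. i \<in> I \<Longrightarrow> f i \<in> flag_smooth) \<Longrightarrow> (\<lambda>q. \<Sum>i\<in>I. f i q) \<in> flag_smooth"
  by (induction I rule: infinite_finite_induct) (auto intro: flag_smooth_add)

lemma flag_smooth_linear:
  "linear (L :: _ \<Rightarrow> real) \<Longrightarrow> (\<lambda>q. L (Phi q)) \<in> flag_smooth"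
  by (intro flag_smooth_ambient) (simp add: smooth_on_def Ck_on_linear)

lemma linear_inner_left: "linear (\<lambda>y. y \<bullet> b)"
  by (simp add: linear_iff inner_add_left)

lemma flag_smooth_coord: "(\<lambda>q. Phi q \<bullet> b) \<in> flag_smooth"
  using flag_smooth_linear[OF linear_inner_left] .

context
  fixes v :: "'n::finite flag vect" and p :: "'n flag"
  assumes v: "v \<in> tangent_space flag_smooth p"
begin

lemma tangent_const: "v (\<lambda>q. c) = 0"
proof -
  have "v (\<lambda>q. 1) = 0"
    using tangent_mult[OF v, of "\<lambda>q. 1" "\<lambda>q. 1"] by simp
  then show ?thesis
    using tangent_linear[OF v, of "\<lambda>q. 1" "\<lambda>q. 1" c 0] by simp
qed

lemma tangent_add: "f \<in> flag_smooth \<Longrightarrow> g \<in> flag_smooth \<Longrightarrow> v (\<lambda>q. f q + g q) = v f + v g"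
  using tangent_linear[OF v, of f g 1 1] by simp

lemma tangent_sum:
  "(\<And>i. i \<in> I \<Longrightarrow> f i \<in> flag_smooth) \<Longrightarrow> v (\<lambda>q. \<Sum>i\<in>I. f i q) = (\<Sum>i\<in>I. v (f i))"
  by (induction I rule: infinite_finite_induct) (auto simp: tangent_const tangent_add flag_smooth_sum)

end

text \<open>The differential of the embedding applied to \<open>v\<close>: the velocity in the
  ambient space, assembled from the derivatives of the real coordinate functions.\<close>

definition mvec :: "'n::finite flag vect \<Rightarrow> 'n cmat" where
  "mvec v = (\<Sum>b\<in>Basis. v (\<lambda>q. Phi q \<bullet> b) *\<^sub>R b)"

lemma mvec_inner: "b \<in> Basis \<Longrightarrow> mvec v \<bullet> b = v (\<lambda>q. Phi q \<bullet> b)"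
  by (simp add: mvec_def inner_sum_left inner_Basis if_distrib cong: if_cong)

lemma mvec_lincomb: "mvec (\<lambda>f. a * v f + b * w f) = a *\<^sub>R mvec v + b *\<^sub>R mvec w"
  by (simp add: mvec_def scaleR_sum_right sum.distrib algebra_simps)

lemma mvec_uminus: "mvec (\<lambda>f. - v f) = - mvec v"
  using mvec_lincomb[of "-1" v 0 v] by simp

text \<open>With a cut-off \<open>\<psi>\<close> around \<open>p\<close> and the Hadamard expansion of \<open>F\<close>, the product
  \<open>(f - f p) \<psi>\<^sup>2\<close> is a sum of products of global smooth functions vanishing at \<open>p\<close> with
  global smooth functions, which determines its derivation at \<open>p\<close>.\<close>

lemma tangent_chain:
  fixes v :: "'n::finite flag vect"
  assumes v: "v \<in> tangent_space flag_smooth p" and f: "f \<in> flag_smooth"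
    and U: "open U" "Phi p \<in> U" and F: "smooth_on U F" and fF: "\<And>q. Phi q \<in> U \<Longrightarrow> f q = F (Phi q)"
  shows "v f = frechet_derivative F (at (Phi p)) (mvec v)"
proof -
  let ?y = "Phi p"
  obtain r where r: "r > 0" "ball ?y r \<subseteq> U"
    using U by (meson openE)
  have Fb: "smooth_on (ball ?y r) F" using F r(2) by (rule smooth_on_subset_mono)
  obtain G where G: "\<And>b. b \<in> Basis \<Longrightarrow> smooth_on (ball ?y r) (G b)"
    and Gy: "\<And>b. b \<in> Basis \<Longrightarrow> G b ?y = frechet_derivative F (at ?y) b"
    and FG: "\<And>y. y \<in> ball ?y r \<Longrightarrow> F y = F ?y + (\<Sum>b\<in>Basis. ((y - ?y) \<bullet> b) * G b y)"
  proof (rule Hadamard_expansion[OF Fb r(1)], goal_cases)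
    case (1 G)
    from this(2-4) show thesis by (rule 1(1))
  qed
  \<comment> \<open>A bump function of the squared distance, positive at \<open>Phi p\<close> and
    zero from radius r / 2 on. The margin up to radius r makes the extension of \<open>g b\<close>
    by 0 smooth.\<close>
  define \<Psi> where "\<Psi> y = flat_exp 0 ((r / 2)\<^sup>2 - (y - ?y) \<bullet> (y - ?y))" for y
  define \<psi> where "\<psi> q = \<Psi> (Phi q)" for q :: "'n flag"
  define c where "c = \<psi> p"
  have c: "c > 0" using r by (simp add: c_def \<psi>_def \<Psi>_def flat_exp_def)
  have sm\<Psi>: "smooth_on V \<Psi>" if "open V" for V
    unfolding \<Psi>_def
  proof (rule smooth_on_compose[OF that smooth_on_flat_exp])
    have B: "bilinear (\<lambda>x y :: 'n cmat. - (x \<bullet> y))"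
      by (auto simp: bilinear_def linear_iff inner_add_left inner_add_right)
    have "smooth_map V (\<lambda>y. y + - ?y)"
      by (intro smooth_map_add smooth_map_id smooth_map_const that)
    from smooth_map_add[OF that smooth_map_const[OF that] smooth_map_bilinear[OF that B this this]]
    show "smooth_map V (\<lambda>y. (r / 2)\<^sup>2 - (y - ?y) \<bullet> (y - ?y))"
      by (simp del: add_uminus_conv_diff add: diff_conv_add_uminus)
  qed simp
  have \<psi>C: "\<psi> \<in> flag_smooth"
    unfolding \<psi>_def by (rule flag_smooth_ambient[OF sm\<Psi>]) simp
  have zero: "\<Psi> y = 0" if "dist ?y y \<ge> r / 2" for y
  proof -
    have "(r / 2)\<^sup>2 \<le> (dist ?y y)\<^sup>2" using that r(1) by (intro power_mono) auto
    then show ?thesis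
      by (simp add: \<Psi>_def flat_exp_def dist_norm norm_minus_commute power2_norm_eq_inner)
  qed
  define g where "g b q = (if Phi q \<in> ball ?y r then G b (Phi q) else 0) * \<psi> q" for b q
  have gC: "g b \<in> flag_smooth" if b: "b \<in> Basis" for b
  proof (rule flag_smoothI)
    fix q
    show "smooth_at (g b) q"
    proof (cases "Phi q \<in> ball ?y r")
      case True
      have "smooth_on (ball ?y r) (\<lambda>y. G b y * \<Psi> y)"
        using G[OF b] sm\<Psi>[of "ball ?y r"] by (auto simp: smooth_on_def intro!: Ck_on_mult)
      then show ?thesis
        using True by (intro smooth_atI[of "ball ?y r" _ "\<lambda>y. G b y * \<Psi> y"])
          (auto simp: g_def \<psi>_def)
    next
      case False
      then have "Phi q \<in> - cball ?y (r / 2)" using r(1) by auto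
      then show ?thesis
        by (intro smooth_atI[of "- cball ?y (r / 2)" _ "\<lambda>y. 0"])
          (auto simp: g_def \<psi>_def zero smooth_on_def intro!: Ck_on_const)
    qed
  qed
  define a where "a b q = (Phi q - ?y) \<bullet> b" for b and q :: "'n flag"
  have a_eq: "a b = (\<lambda>q. 1 * (Phi q \<bullet> b) + (- (?y \<bullet> b)) * 1)" for b
    by (simp add: a_def inner_diff_left fun_eq_iff)
  have aC: "a b \<in> flag_smooth" for b
    unfolding a_eq by (intro flag_smooth_lincomb flag_smooth_coord flag_smooth_const)
  have va: "v (a b) = v (\<lambda>q. Phi q \<bullet> b)" for b
    unfolding a_eq
    by (subst tangent_linear[OF v]) (simp_all add: flag_smooth_coord tangent_const[OF v])
  define f0 where "f0 q = 1 * f q + (- f p) * 1" for q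
  have f0C: "f0 \<in> flag_smooth" unfolding f0_def by (intro flag_smooth_lincomb f flag_smooth_const)
  have vf0: "v f0 = v f"
    unfolding f0_def by (subst tangent_linear[OF v]) (simp_all add: f tangent_const[OF v])
  \<comment> \<open>One factor \<psi> accompanies the coordinate and the other the coefficient, so
    that both factors of each product are globally smooth.\<close>
  have eq: "(\<lambda>q. f0 q * (\<psi> q * \<psi> q)) = (\<lambda>q. \<Sum>b\<in>Basis. (a b q * \<psi> q) * g b q)"
  proof
    fix q
    show "f0 q * (\<psi> q * \<psi> q) = (\<Sum>b\<in>Basis. (a b q * \<psi> q) * g b q)"
    proof (cases "Phi q \<in> ball ?y r")
      case True
      then have "f0 q = (\<Sum>b\<in>Basis. a b q * G b (Phi q))"
        using fF[of q] fF[of p] FG[of "Phi q"] r U(2) by (auto simp: f0_def a_def)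
      then show ?thesis using True by (simp add: g_def sum_distrib_left sum_distrib_right mult_ac)
    next
      case False
      then have "\<psi> q = 0" using r(1) by (auto simp: \<psi>_def intro!: zero)
      then show ?thesis by simp
    qed
  qed
  \<comment> \<open>As \<open>f0\<close> vanishes at p, a single Leibniz term survives; below the
    same happens with \<open>a b\<close>.\<close>
  have "v (\<lambda>q. f0 q * (\<psi> q * \<psi> q)) = c * c * v f"
    using tangent_mult[OF v f0C flag_smooth_mult[OF \<psi>C \<psi>C]] vf0 by (simp add: f0_def c_def)
  moreover have "v (\<lambda>q. \<Sum>b\<in>Basis. (a b q * \<psi> q) * g b q) =
      (\<Sum>b\<in>Basis. c * c * (v (\<lambda>q. Phi q \<bullet> b) * frechet_derivative F (at ?y) b))"
  proof (subst tangent_sum[OF v])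
    fix b :: "'n cmat" assume b: "b \<in> Basis"
    show "(\<lambda>q. a b q * \<psi> q * g b q) \<in> flag_smooth"
      using b by (intro flag_smooth_mult aC \<psi>C gC)
  next
    have "v (\<lambda>q. a b q * \<psi> q * g b q) = c * c * (v (\<lambda>q. Phi q \<bullet> b) * frechet_derivative F (at ?y) b)"
      if b: "b \<in> Basis" for b
      using tangent_mult[OF v flag_smooth_mult[OF aC \<psi>C] gC[OF b], of b] tangent_mult[OF v aC \<psi>C, of b]
        r(1) by (simp add: a_def[of _ p] va g_def Gy[OF b] c_def)
    then show "(\<Sum>b\<in>Basis. v (\<lambda>q. a b q * \<psi> q * g b q)) =
      (\<Sum>b\<in>Basis. c * c * (v (\<lambda>q. Phi q \<bullet> b) * frechet_derivative F (at ?y) b))"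
      by simp
  qed
  ultimately have "c * c * v f = c * c * (\<Sum>b\<in>Basis. v (\<lambda>q. Phi q \<bullet> b) * frechet_derivative F (at ?y) b)"
    using eq by (simp add: sum_distrib_left)
  then have "v f = (\<Sum>b\<in>Basis. v (\<lambda>q. Phi q \<bullet> b) * frechet_derivative F (at ?y) b)"
    using c by simp
  moreover have "linear (frechet_derivative F (at ?y))"
    using smooth_on_has_derivative[OF F U(2)] has_derivative_linear by blast
  ultimately show ?thesis
    by (simp add: mvec_def linear_sum linear_scale)
qed

lemma tangent_linear_Phi:
  assumes v: "v \<in> tangent_space flag_smooth p" and L: "linear (L :: _ \<Rightarrow> real)"
  shows "v (\<lambda>q. L (Phi q)) = L (mvec v)"
proof -
  have "(L has_derivative L) (at (Phi p))"
    using L by (simp add: bounded_linear_imp_has_derivative linear_conv_bounded_linear)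
  then show ?thesis
    using tangent_chain[OF v flag_smooth_linear[OF L], of UNIV L] L
    by (simp add: smooth_on_def Ck_on_linear flip: frechet_derivative_at)
qed

text \<open>By \<open>tangent_chain\<close> the value \<open>v f\<close> depends on \<open>v\<close>
  only through \<open>mvec v\<close>; for functions outside the algebra tangent vectors are 0 by
  convention.\<close>

lemma mvec_inject:
  assumes "v \<in> tangent_space flag_smooth p" "w \<in> tangent_space flag_smooth p" "mvec v = mvec w"
  shows "v = w"
proof
  fix f
  show "v f = w f"
  proof (cases "f \<in> flag_smooth")
    case True
    obtain U F where "open U" "Phi p \<in> U" "smooth_on U F" "\<And>q. Phi q \<in> U \<Longrightarrow> f q = F (Phi q)"
      using smooth_atE[OF flag_smoothD[OF True]] by blast
    then show ?thesis
      using tangent_chain[OF assms(1) True] tangent_chain[OF assms(2) True] assms(3) by metis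
  qed (use assms tangent_outside in metis)
qed

section \<open>The differential of the action and the equations of the tangent space\<close>

lemma left_action_diffeomorphism:
  assumes g: "g \<in> SU" shows "diffeomorphism flag_smooth (left_action g)"
proof -
  have inv: "inv (left_action g) = left_action (adj g)"
    by (rule inv_unique_comp) (use g in \<open>auto simp: fun_eq_iff\<close>)
  have "f \<circ> left_action h \<in> flag_smooth" if f: "f \<in> flag_smooth" and h: "h \<in> SU" for f h
  proof (rule flag_smoothI)
    fix p
    obtain U F where U: "open U" "Phi (left_action h p) \<in> U" "smooth_on U F"
      "\<And>q. Phi q \<in> U \<Longrightarrow> f q = F (Phi q)"
      using smooth_atE[OF flag_smoothD[OF f]] by blast
    let ?c = "\<lambda>Y. h ** Y ** adj h"
    have o: "open (?c -` U)"
      by (intro open_vimage U smooth_map_continuous_on smooth_map_conj open_UNIV)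
    have "smooth_on (?c -` U) (\<lambda>Y. F (?c Y))"
      by (rule smooth_on_compose[OF o U(3) smooth_map_conj[OF o]]) auto
    then show "smooth_at (f \<circ> left_action h) p"
      by (rule smooth_atI[OF o, rotated]) (use U h in \<open>simp_all add: Phi_left_action[symmetric]\<close>)
  qed
  moreover have "bij (left_action g)"
    using g by (intro bij_betw_byWitness[where f' = "left_action (adj g)"]) auto
  ultimately show ?thesis
    using g SU_adj[OF g] unfolding diffeomorphism_def inv by blast
qed

lemma linear_matrix_conj: "linear (\<lambda>Y. a ** Y ** b)" for a b :: "complex^'m^'m"
  by (simp add: linear_iff matrix_add_ldistrib matrix_add_rdistrib matrix_scaleR_left matrix_scaleR_right)

lemma mvec_pushforward:
  assumes g: "g \<in> SU" and v: "v \<in> tangent_space flag_smooth p"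
  shows "mvec (pushforward (left_action g) v) = g ** mvec v ** adj g"
proof (rule euclidean_eqI)
  fix b :: "'a cmat" assume b: "b \<in> Basis"
  have "linear (\<lambda>Y. (g ** Y ** adj g) \<bullet> b)"
    using linear_compose[OF linear_matrix_conj linear_inner_left] by (simp add: o_def)
  from tangent_linear_Phi[OF v this]
  show "mvec (pushforward (left_action g) v) \<bullet> b = (g ** mvec v ** adj g) \<bullet> b"
    using g b by (simp add: mvec_inner pushforward_def o_def Phi_left_action)
qed

text \<open>The model of the tangent space at the base point; \<open>tangent_image_base\<close>
  proves the identification.\<close>

definition Hoff :: "'n::finite cmat set" where
  "Hoff = {w. adj w = w \<and> (\<forall>i j. fst i = fst j \<longrightarrow> w $ i $ j = 0)}"

lemma mvec_adj:
  assumes v: "v \<in> tangent_space flag_smooth p" shows "adj (mvec v) = mvec v"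
proof (rule euclidean_eqI)
  fix b :: "'a cmat" assume b: "b \<in> Basis"
  have "linear (\<lambda>Y. adj Y \<bullet> b)"
    using linear_compose[OF linear_adj linear_inner_left] by (simp add: o_def)
  from tangent_linear_Phi[OF v this] show "adj (mvec v) \<bullet> b = mvec v \<bullet> b"
    using b by (simp add: mvec_inner)
qed

text \<open>Differentiating the relation \<open>Y\<^sup>3 = Y\<close>.\<close>

lemma mvec_cube:
  assumes v: "v \<in> tangent_space flag_smooth p"
  shows "mvec v ** Phi p ** Phi p + Phi p ** mvec v ** Phi p + Phi p ** Phi p ** mvec v = mvec v"
proof (rule euclidean_eqI)
  fix b :: "'a cmat" assume b: "b \<in> Basis"
  let ?Y = "Phi p"
  let ?Q = "\<lambda>Y :: 'a cmat. (Y ** Y ** Y) \<bullet> b"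
  have sm: "smooth_on UNIV ?Q"
    by (intro smooth_map_inner open_UNIV smooth_map_bilinear[OF _ bilinear_matrix_mult] smooth_map_id)
  have bb: "bounded_bilinear ((**) :: 'a cmat \<Rightarrow> 'a cmat \<Rightarrow> 'a cmat)"
    using bilinear_matrix_mult by (simp add: bilinear_conv_bounded_bilinear)
  have "((\<lambda>Y. Y ** Y ** Y) has_derivative (\<lambda>w. (?Y ** ?Y) ** w + (?Y ** w + w ** ?Y) ** ?Y)) (at ?Y)"
    by (intro bounded_bilinear.FDERIV[OF bb] has_derivative_ident)
  from has_derivative_inner_left[OF this, of b]
  have "frechet_derivative ?Q (at ?Y) = (\<lambda>w. ((?Y ** ?Y) ** w + (?Y ** w + w ** ?Y) ** ?Y) \<bullet> b)"
    by (rule frechet_derivative_at[symmetric])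
  then have "v (\<lambda>q. ?Q (Phi q)) = ((?Y ** ?Y) ** mvec v + (?Y ** mvec v + mvec v ** ?Y) ** ?Y) \<bullet> b"
    using tangent_chain[OF v flag_smooth_ambient[OF sm], of UNIV ?Q] sm by simp
  then show "(mvec v ** ?Y ** ?Y + ?Y ** mvec v ** ?Y + ?Y ** ?Y ** mvec v) \<bullet> b = mvec v \<bullet> b"
    using b by (simp add: Phi_cube mvec_inner matrix_add_rdistrib inner_add_left algebra_simps)
qed

abbreviation base :: "'n::finite flag" where "base \<equiv> flag_of (mat 1)"

lemma Phi_base [simp]: "Phi base = Lam"
  by (simp add: Phi_flag_of SU_one)

lemma mvec_base_Hoff:
  assumes v: "v \<in> tangent_space flag_smooth base" shows "mvec v \<in> Hoff"
proof -
  have "mvec v $ i $ j = 0" if "fst i = fst j" for i j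
  proof -
    define z where "z = mvec v $ i $ j"
    define l where "l = complex_of_real (lam (fst j))"
    have "(mvec v ** Lam ** Lam + Lam ** mvec v ** Lam + Lam ** (Lam ** mvec v)) $ i $ j = mvec v $ i $ j"
      using mvec_cube[OF v] by (simp add: matrix_mul_assoc)
    \<comment> \<open>Inside a diagonal block the relation reads 3 l^2 z = z; as l^2 is 0 or 1, this
      forces z = 0.\<close>
    then have "z * l * l + l * z * l + l * l * z = z"
      unfolding Lam_def using that by (simp add: z_def l_def mult_ac)
    moreover have "l = 1 \<or> l = 0 \<or> l = -1" by (simp add: l_def lam_def)
    ultimately show ?thesis by (auto simp: z_def)
  qed
  then show ?thesis using mvec_adj[OF v] by (simp add: Hoff_def)
qed

text \<open>Differentiation along the curve is a derivation. Differentiability of the embedded curve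
  at 0 suffices, because every smooth function is an ambient one near \<open>p\<close>.\<close>

lemma tangent_of_curve:
  fixes \<gamma> :: "real \<Rightarrow> 'n::finite flag"
  assumes "\<gamma> 0 = p" and d: "((\<lambda>t. Phi (\<gamma> t)) has_vector_derivative w) (at 0)"
  shows "\<exists>v\<in>tangent_space flag_smooth p. mvec v = w"
proof -
  \<comment> \<open>The value 0 outside the algebra is the convention of
    \<open>tangent_space\<close>; without the case distinction \<open>deriv\<close> would give
    arbitrary values there.\<close>
  define v where "v f = (if f \<in> flag_smooth then deriv (\<lambda>t. f (\<gamma> t)) 0 else 0)" for f
  have der: "((\<lambda>t. f (\<gamma> t)) has_real_derivative v f) (at 0)" if f: "f \<in> flag_smooth" for f
  proof -
    obtain U F where U: "open U" "Phi p \<in> U" "smooth_on U F" "\<And>q. Phi q \<in> U \<Longrightarrow> f q = F (Phi q)"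
      using smooth_atE[OF flag_smoothD[OF f]] by blast
    have "isCont (\<lambda>t. Phi (\<gamma> t)) 0"
      using d has_vector_derivative_continuous by blast
    then have ev: "eventually (\<lambda>t. Phi (\<gamma> t) \<in> U) (nhds 0)"
      using U(1,2) assms(1) by (simp add: isCont_def tendsto_def eventually_nhds_conv_at)
    have "(F has_derivative frechet_derivative F (at (Phi p))) (at (Phi (\<gamma> 0)))"
      using smooth_on_has_derivative[OF U(3,2)] assms(1) by simp
    from vector_derivative_diff_chain_within[OF d has_derivative_at_withinI[OF this]]
    have "((F \<circ> (\<lambda>t. Phi (\<gamma> t))) has_vector_derivative frechet_derivative F (at (Phi p)) w) (at 0)"
      by simp
    then have "((\<lambda>t. F (Phi (\<gamma> t))) has_real_derivative frechet_derivative F (at (Phi p)) w) (at 0)"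
      by (simp add: o_def has_real_derivative_iff_has_vector_derivative)
    moreover have "eventually (\<lambda>t. f (\<gamma> t) = F (Phi (\<gamma> t))) (nhds 0)"
      using ev by eventually_elim (rule U(4))
    ultimately have "((\<lambda>t. f (\<gamma> t)) has_real_derivative frechet_derivative F (at (Phi p)) w) (at 0)"
      by (subst DERIV_cong_ev[OF refl _ refl])
    then show ?thesis using f by (simp add: v_def DERIV_imp_deriv)
  qed
  have vf: "v f = d" if "((\<lambda>t. f (\<gamma> t)) has_real_derivative d) (at 0)" "f \<in> flag_smooth" for f d
    using der[OF that(2)] that(1) DERIV_unique by blast
  have "v \<in> tangent_space flag_smooth p"
    unfolding tangent_space_def
  proof (intro CollectI conjI ballI allI impI)
    fix f g :: "'n flag \<Rightarrow> real" and a b :: real assume fg: "f \<in> flag_smooth" "g \<in> flag_smooth"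
    show "v (\<lambda>x. a * f x + b * g x) = a * v f + b * v g"
      by (rule vf[OF _ flag_smooth_lincomb[OF fg]]) (auto intro!: derivative_eq_intros der fg)
    show "v (\<lambda>x. f x * g x) = f p * v g + g p * v f"
      by (rule vf[OF _ flag_smooth_mult[OF fg]])
         (auto intro!: derivative_eq_intros der fg simp: assms(1))
  qed (simp add: v_def)
  moreover have "mvec v = w"
  proof (rule euclidean_eqI)
    fix b :: "'n cmat" assume b: "b \<in> Basis"
    have "((\<lambda>t. Phi (\<gamma> t) \<bullet> b) has_real_derivative (w \<bullet> b)) (at 0)"
      using has_derivative_inner_left[OF d[unfolded has_vector_derivative_def], of b]
      by (simp add: has_field_derivative_def mult.commute[of _ "w \<bullet> b"])
    then show "mvec v \<bullet> b = w \<bullet> b"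
      using b by (simp add: mvec_inner vf flag_smooth_coord)
  qed
  ultimately show ?thesis by blast
qed

section \<open>Curves realising all off-diagonal Hermitian directions\<close>

definition skew :: "'m \<Rightarrow> 'm \<Rightarrow> complex \<Rightarrow> complex^'m^'m" where
  "skew i j u = (\<chi> k l. if k = i \<and> l = j then u else if k = j \<and> l = i then - cnj u else 0)"

definition herm :: "'m \<Rightarrow> 'm \<Rightarrow> complex \<Rightarrow> complex^'m^'m" where
  "herm i j z = (\<chi> k l. if k = i \<and> l = j then z else if k = j \<and> l = i then cnj z else 0)"

lemma skew_nth: "skew i j u $ k $ l = (if k = i \<and> l = j then u else if k = j \<and> l = i then - cnj u else 0)"
  by (simp add: skew_def)

lemma herm_nth: "herm i j z $ k $ l = (if k = i \<and> l = j then z else if k = j \<and> l = i then cnj z else 0)"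
  by (simp add: herm_def)

lemma skew_square:
  assumes "i \<noteq> j" "cmod u = 1"
  shows "skew i j u ** skew i j u = diag (\<lambda>k. if k = i \<or> k = j then -1 else 0)"
proof -
  have u: "u * cnj u = 1" using assms(2) by (simp add: complex_norm_square[symmetric])
  have "(\<Sum>m\<in>UNIV. skew i j u $ k $ m * skew i j u $ m $ l) =
      (if k = i then u * skew i j u $ j $ l else if k = j then - cnj u * skew i j u $ i $ l else 0)" for k l
  proof -
    have "(\<Sum>m\<in>UNIV. skew i j u $ k $ m * skew i j u $ m $ l) =
       (\<Sum>m\<in>UNIV. (if m = j then (if k = i then u * skew i j u $ j $ l else 0) else 0) +
          (if m = i then (if k = j then - cnj u * skew i j u $ i $ l else 0) else 0))"
      using assms(1) by (intro sum.cong) (auto simp: skew_nth)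
    then show ?thesis using assms(1) by (simp add: sum.distrib)
  qed
  then show ?thesis
    using assms(1) u by (auto simp: vec_eq_iff matrix_matrix_mult_def skew_nth diag_nth mult.commute)
qed

lemma skew_cube:
  assumes "i \<noteq> j" "cmod u = 1"
  shows "skew i j u ** skew i j u ** skew i j u = - skew i j u"
  unfolding skew_square[OF assms] using assms(1) by (auto simp: vec_eq_iff skew_nth)

lemma adj_skew: "i \<noteq> j \<Longrightarrow> adj (skew i j u) = - skew i j u"
  by (auto simp: vec_eq_iff skew_nth)

lemma matrix_minus_left: "(- A) ** B = - (A ** B)" for A B :: "complex^'m^'m"
  using matrix_scaleR_left[of "-1" A B] by simp

lemma matrix_minus_right: "A ** (- B) = - (A ** B)" for A B :: "complex^'m^'m"
  using matrix_scaleR_right[of A "-1" B] by simp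

lemma adj_add: "adj (A + B) = adj A + adj B" and adj_scaleR: "adj (c *\<^sub>R A) = c *\<^sub>R adj A"
  using linear_adj by (auto simp: linear_iff)

text \<open>The exponential of \<open>t X\<close> for a matrix with \<open>X\<^sup>3 = - X\<close>.\<close>

definition rotation :: "complex^'m^'m \<Rightarrow> real \<Rightarrow> complex^'m^'m" where
  "rotation X t = mat 1 + sin t *\<^sub>R X + (1 - cos t) *\<^sub>R (X ** X)"

lemma rotation_unitary:
  assumes "adj X = - X" "X ** X ** X = - X"
  shows "adj (rotation X t) ** rotation X t = mat 1"
proof -
  have a: "adj (rotation X t) = mat 1 - sin t *\<^sub>R X + (1 - cos t) *\<^sub>R (X ** X)"
    by (simp add: rotation_def adj_add adj_scaleR adj_mult assms matrix_minus_left matrix_minus_right)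
  have x3: "X ** (X ** X) = - X" using assms(2) by (simp add: matrix_mul_assoc)
  have x4: "X ** X ** (X ** X) = - (X ** X)"
    using assms(2) by (metis matrix_minus_left matrix_mul_assoc)
  let ?s = "sin t" and ?c = "cos t"
  have sc: "(?c * ?c) *\<^sub>R (X ** X) + (?s * ?s) *\<^sub>R (X ** X) = X ** X"
    using sin_cos_squared_add2[of t] by (simp add: power2_eq_square flip: scaleR_left_distrib)
  show ?thesis
    unfolding a unfolding rotation_def
    by (simp add: matrix_add_ldistrib matrix_add_rdistrib matrix_diff_ldistrib matrix_diff_rdistrib
      matrix_scaleR_left matrix_scaleR_right x3 x4 assms(2) sc algebra_simps)
qed

lemma rotation_derivative: "(rotation X has_vector_derivative X) (at 0)"
  unfolding rotation_def[abs_def]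
  by (auto intro!: derivative_eq_intros)

text \<open>The orbit curve of the one-parameter group generated by X = \<open>skew i j u\<close>
  has velocity X \<open>Lam\<close> - \<open>Lam\<close> X, which is \<open>herm i j u\<close> times
  the difference of the two eigenvalues. The difference is nonzero between different blocks and can
  be divided out.\<close>

lemma herm_in_tangent_image:
  assumes ij: "fst i \<noteq> fst j"
  shows "\<exists>v\<in>tangent_space flag_smooth base. mvec v = herm i j z"
proof -
  \<comment> \<open>The phase of \<open>z\<close>, with 1 as its value at 0: the closed formula for
    the exponential needs a unit entry.\<close>
  define u where "u = (if z = 0 then 1 else z / cmod z)"
  have u: "cmod u = 1" "z = cmod z *\<^sub>R u" by (auto simp: u_def norm_divide scaleR_conv_of_real)
  have ne: "i \<noteq> j" using ij by auto
  let ?X = "skew i j u"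
  have un: "adj (rotation ?X t) ** rotation ?X t = mat 1" for t
    by (rule rotation_unitary[OF adj_skew[OF ne] skew_cube[OF ne u(1)]])
  \<comment> \<open>A pointwise choice is enough, since only the embedded curve
    \<open>Phi (\<gamma> t)\<close>, which is given by a formula, gets differentiated.\<close>
  then have "\<exists>\<gamma>. \<forall>t. Phi (\<gamma> t) = rotation ?X t ** Lam ** adj (rotation ?X t)"
    by (intro choice allI ex_Phi_unitary)
  then obtain \<gamma> where \<gamma>: "\<And>t. Phi (\<gamma> t) = rotation ?X t ** Lam ** adj (rotation ?X t)"
    by blast
  have r0: "rotation ?X 0 = mat 1" by (simp add: rotation_def)
  have "Phi (\<gamma> 0) = Phi base" by (simp only: \<gamma> r0) simp
  then have \<gamma>0: "\<gamma> 0 = base" by (simp only: Phi_inject)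
  have bb: "bounded_bilinear ((**) :: 'a cmat \<Rightarrow> 'a cmat \<Rightarrow> 'a cmat)"
    using bilinear_matrix_mult by (simp add: bilinear_conv_bounded_bilinear)
  have bl: "bounded_linear (adj :: 'a cmat \<Rightarrow> _)"
    using linear_adj by (simp add: linear_conv_bounded_linear)
  have "((\<lambda>t. rotation ?X t ** Lam ** adj (rotation ?X t)) has_vector_derivative
      (rotation ?X 0 ** Lam) ** adj ?X + (rotation ?X 0 ** 0 + ?X ** Lam) ** adj (rotation ?X 0)) (at 0)"
    by (intro bounded_bilinear.has_vector_derivative[OF bb] rotation_derivative
        has_vector_derivative_const bounded_linear.has_vector_derivative[OF bl])
  then have "((\<lambda>t. Phi (\<gamma> t)) has_vector_derivative (Lam ** adj ?X + ?X ** Lam)) (at 0)"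
    unfolding \<gamma> r0 using matrix_scaleR_right[of "mat 1" 0 0] by simp
  from tangent_of_curve[OF \<gamma>0 this] obtain v where v: "v \<in> tangent_space flag_smooth base"
    "mvec v = Lam ** adj ?X + ?X ** Lam" by blast
  have eq: "Lam ** adj ?X + ?X ** Lam = (lam (fst j) - lam (fst i)) *\<^sub>R herm i j u"
    using ne by (auto simp: vec_eq_iff Lam_def skew_nth herm_nth scaleR_complex algebra_simps)
  have d: "lam (fst j) - lam (fst i) \<noteq> 0" using ij by simp
  define c where "c = cmod z / (lam (fst j) - lam (fst i))"
  have "mvec (\<lambda>f. c * v f + 0 * v f) = herm i j z"
  proof -
    have "herm i j (r *\<^sub>R u) = r *\<^sub>R herm i j u" for r
      by (auto simp: vec_eq_iff herm_nth scaleR_complex)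
    then have "herm i j z = cmod z *\<^sub>R herm i j u" using u(2) by metis
    then show ?thesis unfolding mvec_lincomb v(2) eq using d by (simp add: c_def)
  qed
  then show ?thesis using tangent_space_lincomb[OF v(1) v(1)] by blast
qed

lemma mvec_image_sum:
  assumes "finite I" "\<And>i. i \<in> I \<Longrightarrow> \<exists>v\<in>tangent_space flag_smooth p. mvec v = w i"
  shows "\<exists>v\<in>tangent_space flag_smooth p. mvec v = (\<Sum>i\<in>I. w i)"
  using assms
proof (induction I rule: finite_induct)
  case empty
  have "(\<lambda>f. 0) \<in> tangent_space flag_smooth p" by (simp add: tangent_space_def)
  then show ?case by (auto simp: mvec_def intro!: bexI[of _ "\<lambda>f. 0"])
next
  case (insert i I)
  then obtain v' where v': "v' \<in> tangent_space flag_smooth p" "mvec v' = (\<Sum>i\<in>I. w i)" by auto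
  obtain v where "v \<in> tangent_space flag_smooth p" "mvec v = w i" using insert.prems by blast
  note v = this v'
  then have "mvec (\<lambda>f. 1 * v f + 1 * v' f) = (\<Sum>i\<in>insert i I. w i)"
    unfolding mvec_lincomb using insert by simp
  then show ?case using tangent_space_lincomb[OF v(1,3)] by blast
qed

text \<open>In the double sum an off-diagonal position is met twice, once through (i,j) and once
  through (j,i), but a diagonal one only once. The second sum restores the missing half of the
  diagonal.\<close>

lemma herm_decomposition:
  assumes "adj w = w"
  shows "w = (\<Sum>i\<in>UNIV. \<Sum>j\<in>UNIV. herm i j (w $ i $ j / 2)) +
    (\<Sum>i\<in>UNIV. herm i i (w $ i $ i / 2))"
proof -
  have c: "cnj (w $ l $ k) = w $ k $ l" for k l
    using assms by (metis adj_nth)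
  have "(\<Sum>i\<in>UNIV. \<Sum>j\<in>UNIV. herm i j (w $ i $ j / 2) $ k $ l) =
      w $ k $ l / 2 + (if k = l then 0 else w $ k $ l / 2)" for k l
  proof -
    have "herm i j (w $ i $ j / 2) $ k $ l = (if j = l then (if i = k then w $ k $ l / 2 else 0) else 0) +
       (if j = k then (if i = l then (if k = l then 0 else w $ k $ l / 2) else 0) else 0)" for i j
    proof (cases "k = l")
      case True
      then show ?thesis by (simp add: herm_nth)
    next
      case False
      then show ?thesis
        by (cases "i = k"; cases "j = l"; cases "i = l"; cases "j = k") (simp_all add: herm_nth c)
    qed
    then show ?thesis by (simp add: sum.distrib)
  qed
  moreover have "(\<Sum>i\<in>UNIV. herm i i (w $ i $ i / 2) $ k $ l) = (if k = l then w $ k $ l / 2 else 0)" for k l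
  proof -
    have "herm i i (w $ i $ i / 2) $ k $ l = (if i = k then (if k = l then w $ k $ l / 2 else 0) else 0)" for i
      by (auto simp: herm_nth)
    then show ?thesis by simp
  qed
  ultimately show ?thesis by (simp add: vec_eq_iff)
qed

lemma tangent_image_base:
  "mvec ` tangent_space flag_smooth base = (Hoff :: 'n::finite cmat set)"
proof
  show "mvec ` tangent_space flag_smooth base \<subseteq> Hoff"
    using mvec_base_Hoff by blast
  show "(Hoff :: 'n cmat set) \<subseteq> mvec ` tangent_space flag_smooth base"
  proof
    fix w :: "'n cmat" assume w: "w \<in> Hoff"
    then have w0: "w $ i $ j = 0" if "fst i = fst j" for i j
      using w that unfolding Hoff_def by blast
    have ex: "\<exists>v\<in>tangent_space flag_smooth base. mvec v = herm i j (w $ i $ j / 2)" for i j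
    proof (cases "fst i = fst j")
      case True
      then have "herm i j (w $ i $ j / 2) = 0"
        using w0 by (simp add: herm_def vec_eq_iff)
      then show ?thesis using mvec_image_sum[of "{}" base] by simp
    qed (rule herm_in_tangent_image)
    have "herm i i (w $ i $ i / 2) = 0" for i
      by (simp add: vec_eq_iff herm_nth w0)
    then have "(\<Sum>i\<in>UNIV. herm i i (w $ i $ i / 2)) = 0"
      by simp
    then have "w = (\<Sum>i\<in>UNIV. \<Sum>j\<in>UNIV. herm i j (w $ i $ j / 2))"
      using herm_decomposition[of w] w by (simp add: Hoff_def)
    moreover have "\<exists>v\<in>tangent_space flag_smooth base.
        mvec v = (\<Sum>i\<in>UNIV. \<Sum>j\<in>UNIV. herm i j (w $ i $ j / 2))"
      by (intro mvec_image_sum ex) simp_all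
    ultimately show "w \<in> mvec ` tangent_space flag_smooth base"
      by (metis imageI)
  qed
qed

lemma pushforward_left_action_inverse:
  assumes "g \<in> SU"
  shows "pushforward (left_action g) (pushforward (left_action (adj g)) v) = v"
    and "pushforward (left_action (adj g)) (pushforward (left_action g) v) = v"
  using assms by (simp_all add: pushforward_def o_def)

lemma tangent_image:
  assumes g: "g \<in> SU"
  shows "mvec ` tangent_space flag_smooth (flag_of g) = {w. adj g ** w ** g \<in> Hoff}"
proof (intro equalityI subsetI CollectI)
  fix w assume "w \<in> mvec ` tangent_space flag_smooth (flag_of g)"
  then obtain v where v: "v \<in> tangent_space flag_smooth (flag_of g)" "w = mvec v" by blast
  have "left_action (adj g) (flag_of g) = base"
    using g by (simp add: left_action_flag_of SU_adj SU_adj_mult)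
  then have "pushforward (left_action (adj g)) v \<in> tangent_space flag_smooth base"
    using pushforward_tangent[OF left_action_diffeomorphism[OF SU_adj[OF g]] v(1)] by simp
  then show "adj g ** w ** g \<in> Hoff"
    using mvec_base_Hoff mvec_pushforward[OF SU_adj[OF g] v(1)] v(2) by fastforce
next
  fix w assume "w \<in> {w. adj g ** w ** g \<in> Hoff}"
  then have "adj g ** w ** g \<in> mvec ` tangent_space flag_smooth base"
    by (simp add: tangent_image_base)
  then obtain v where v: "v \<in> tangent_space flag_smooth base" "mvec v = adj g ** w ** g"
    by auto
  have "left_action g base = flag_of g"
    using g by (simp add: left_action_flag_of SU_one)
  then have "pushforward (left_action g) v \<in> tangent_space flag_smooth (flag_of g)"
    using pushforward_tangent[OF left_action_diffeomorphism[OF g] v(1)] by simp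
  moreover have "mvec (pushforward (left_action g) v) = (g ** adj g) ** w ** (g ** adj g)"
    using mvec_pushforward[OF g v(1)] v(2) by (simp add: matrix_mul_assoc)
  ultimately show "w \<in> mvec ` tangent_space flag_smooth (flag_of g)"
    using SU_mult_adj[OF g] by (metis image_eqI matrix_mul_lid matrix_mul_rid)
qed

section \<open>Invariant almost complex structures\<close>

definition imul :: "complex^'m^'m \<Rightarrow> complex^'m^'m" where
  "imul A = (\<chi> i j. \<i> * A $ i $ j)"

lemma imul_nth [simp]: "imul A $ i $ j = \<i> * A $ i $ j"
  by (simp add: imul_def)

lemma linear_imul: "linear imul"
  by (simp add: linear_iff vec_eq_iff algebra_simps)

lemma imul_mult_left: "imul A ** B = imul (A ** B)"
  by (simp add: vec_eq_iff matrix_matrix_mult_def sum_distrib_left mult_ac)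

lemma imul_mult_right: "A ** imul B = imul (A ** B)"
  by (simp add: vec_eq_iff matrix_matrix_mult_def sum_distrib_left mult_ac)

text \<open>An edge a -> b is recorded as \<epsilon> a b = 1. Antisymmetry matches Hermitian
  symmetry, because conjugation turns multiplication by i into multiplication by -i; it also forces
  \<epsilon> a a = 0.\<close>

definition orient :: "(3 \<Rightarrow> 3 \<Rightarrow> real) \<Rightarrow> bool" where
  "orient \<epsilon> \<longleftrightarrow> (\<forall>a b. \<epsilon> b a = - \<epsilon> a b) \<and> (\<forall>a b. a \<noteq> b \<longrightarrow> \<epsilon> a b = 1 \<or> \<epsilon> a b = -1)"

lemma orient_antisym: "orient \<epsilon> \<Longrightarrow> \<epsilon> b a = - \<epsilon> a b"
  unfolding orient_def by blast

lemma orient_diag: "orient \<epsilon> \<Longrightarrow> \<epsilon> a a = 0"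
  using orient_antisym[of \<epsilon> a a] by simp

lemma orient_square: "orient \<epsilon> \<Longrightarrow> a \<noteq> b \<Longrightarrow> \<epsilon> a b * \<epsilon> a b = 1"
proof -
  assume "orient \<epsilon>" "a \<noteq> b"
  then have "\<epsilon> a b = 1 \<or> \<epsilon> a b = -1" unfolding orient_def by blast
  then show ?thesis by auto
qed

text \<open>Multiplication of the (a,b) block of \<open>w\<close>, taken with respect to the
  eigenspaces of \<open>Y\<close>, by \<epsilon> a b times i. Written with the polynomials
  \<open>Proj\<close>, it is defined for all matrices \<open>Y\<close>, smooth in \<open>Y\<close>
  and equivariant.\<close>

definition Jmat :: "(3 \<Rightarrow> 3 \<Rightarrow> real) \<Rightarrow> 'n::finite cmat \<Rightarrow> 'n cmat \<Rightarrow> 'n cmat" where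
  "Jmat \<epsilon> Y w = (\<Sum>a\<in>UNIV. \<Sum>b\<in>UNIV. \<epsilon> a b *\<^sub>R imul (Proj a Y ** w ** Proj b Y))"

lemma linear_Jmat: "linear (Jmat \<epsilon> Y)"
proof -
  have "linear (\<lambda>w. \<epsilon> a b *\<^sub>R imul (Proj a Y ** w ** Proj b Y))" for a b
    using linear_compose[OF linear_compose[OF linear_matrix_conj linear_imul] linear_scale_self]
    by (simp add: o_def linear_iff scaleR_add_right linear_add[OF linear_imul]
        linear_scale[OF linear_imul] linear_add[OF linear_matrix_conj] linear_scale[OF linear_matrix_conj])
  then show ?thesis
    unfolding Jmat_def by (intro linear_compose_sum ballI)
qed

lemma smooth_map_Jmat: "open U \<Longrightarrow> smooth_map U (\<lambda>Y. Jmat \<epsilon> Y w)"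
  unfolding Jmat_def
  by (intro smooth_map_sum smooth_map_scaleR smooth_map_linear_compose[OF _ linear_imul]
      smooth_map_bilinear[OF _ bilinear_matrix_mult] smooth_map_const smooth_Proj)
     (auto simp: smooth_on_def Ck_on_const)

lemma Jmat_Lam_nth:
  "Jmat \<epsilon> Lam w $ k $ l = of_real (\<epsilon> (fst k) (fst l)) * \<i> * w $ k $ l"
proof -
  have "(\<epsilon> a b *\<^sub>R imul (Proj a Lam ** w ** Proj b Lam)) $ k $ l =
     (if b = fst l then (if a = fst k then of_real (\<epsilon> a b) * \<i> * w $ k $ l else 0) else 0)" for a b
    by (simp add: Proj_Lam scaleR_complex)
  then show ?thesis by (simp add: Jmat_def)
qed

lemma Jmat_conj:
  assumes g: "adj g ** g = mat 1"
  shows "Jmat \<epsilon> (g ** Y ** adj g) (g ** w ** adj g) = g ** Jmat \<epsilon> Y w ** adj g"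
  unfolding Jmat_def linear_sum[OF linear_matrix_conj] linear_scale[OF linear_matrix_conj]
  by (simp add: Proj_conj[OF g] conj_mult[OF g] imul_mult_left imul_mult_right)

lemma Jmat_Lam_Hoff:
  assumes "orient \<epsilon>" "w \<in> Hoff" shows "Jmat \<epsilon> Lam w \<in> Hoff"
proof -
  have w: "adj w = w" "\<And>i j. fst i = fst j \<Longrightarrow> w $ i $ j = 0" using assms(2) unfolding Hoff_def by blast+
  have c: "cnj (w $ j $ i) = w $ i $ j" for i j using w(1) by (metis adj_nth)
  have "cnj (Jmat \<epsilon> Lam w $ j $ i) = Jmat \<epsilon> Lam w $ i $ j" for i j
    using orient_antisym[OF assms(1), of "fst j" "fst i"] by (simp add: Jmat_Lam_nth c)
  then have "adj (Jmat \<epsilon> Lam w) = Jmat \<epsilon> Lam w"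
    by (simp add: vec_eq_iff)
  then show ?thesis unfolding Hoff_def using w(2) by (auto simp: Jmat_Lam_nth)
qed

lemma Jmat_Lam_square:
  assumes "orient \<epsilon>" "w \<in> Hoff" shows "Jmat \<epsilon> Lam (Jmat \<epsilon> Lam w) = - w"
proof -
  have "of_real (\<epsilon> (fst k) (fst l)) * \<i> * (of_real (\<epsilon> (fst k) (fst l)) * \<i> * w $ k $ l) = - w $ k $ l" for k l
  proof (cases "fst k = fst l")
    case True
    then have "w $ k $ l = 0" using assms(2) unfolding Hoff_def by blast
    then show ?thesis by simp
  next
    case False
    have "of_real (\<epsilon> (fst k) (fst l)) * of_real (\<epsilon> (fst k) (fst l)) = (1::complex)"
      using orient_square[OF assms(1) False] by (metis of_real_1 of_real_mult)
    moreover have "e * \<i> * (e * \<i> * z) = - (e * e * z)" for e z :: complex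
      by (simp add: algebra_simps)
    ultimately show ?thesis by simp
  qed
  then show ?thesis by (simp add: vec_eq_iff Jmat_Lam_nth)
qed

lemma SU_conj_cancel: "g \<in> SU \<Longrightarrow> g ** (adj g ** w ** g) ** adj g = w"
proof -
  assume "g \<in> SU"
  moreover have "g ** (adj g ** w ** g) ** adj g = (g ** adj g) ** w ** (g ** adj g)"
    by (simp only: matrix_mul_assoc)
  ultimately show ?thesis by (simp add: SU_mult_adj)
qed

lemma Jmat_flag_of:
  assumes "g \<in> SU"
  shows "adj g ** Jmat \<epsilon> (Phi (flag_of g)) w ** g = Jmat \<epsilon> Lam (adj g ** w ** g)"
proof -
  have "Jmat \<epsilon> (Phi (flag_of g)) w = g ** Jmat \<epsilon> Lam (adj g ** w ** g) ** adj g"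
    using Jmat_conj[OF SU_adj_mult[OF assms], of \<epsilon> Lam "adj g ** w ** g"]
    by (simp add: Phi_flag_of assms SU_conj_cancel)
  then show ?thesis
    using SU_conj_cancel[OF SU_adj[OF assms]] by simp
qed

text \<open>Near a point, X f is the sum of the partial derivatives of an ambient extension of f
  times the coordinates of \<open>mvec (X q)\<close>. Smoothness of a field can thus be tested on
  the ambient coordinates.\<close>

lemma vector_field_mvecI:
  fixes X :: "'n::finite flag \<Rightarrow> 'n flag vect"
  assumes Xt: "\<And>p. X p \<in> tangent_space flag_smooth p"
    and Xm: "\<And>b. (\<lambda>q. mvec (X q) \<bullet> b) \<in> flag_smooth"
  shows "vector_field flag_smooth X"
  unfolding vector_field_def
proof (intro conjI allI ballI Xt)
  fix f :: "'n flag \<Rightarrow> real" assume f: "f \<in> flag_smooth"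
  show "(\<lambda>p. X p f) \<in> flag_smooth"
  proof (rule flag_smoothI)
    fix p :: "'n flag"
    obtain U F where U: "open U" "Phi p \<in> U" "smooth_on U F" "\<And>q. Phi q \<in> U \<Longrightarrow> f q = F (Phi q)"
      using smooth_atE[OF flag_smoothD[OF f]] by blast
    have "smooth_at (\<lambda>q. \<Sum>b\<in>Basis. frechet_derivative F (at (Phi q)) b * (mvec (X q) \<bullet> b)) p"
      by (intro smooth_at_sum smooth_at_mult flag_smoothD[OF Xm]
          smooth_atI[OF U(1,2) smooth_on_derivative[OF U(3)]]) simp
    then show "smooth_at (\<lambda>p. X p f) p"
    proof (rule smooth_at_cong[OF _ U(1,2)])
      fix q assume q: "Phi q \<in> U"
      have "linear (frechet_derivative F (at (Phi q)))"
        using smooth_on_has_derivative[OF U(3) q] has_derivative_linear by blast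
      then have E: "frechet_derivative F (at (Phi q)) (\<Sum>b\<in>Basis. (y \<bullet> b) *\<^sub>R b) =
          (\<Sum>b\<in>Basis. frechet_derivative F (at (Phi q)) b * (y \<bullet> b))" for y
        by (simp add: linear_sum linear_scale mult.commute)
      have "X q f = frechet_derivative F (at (Phi q)) (mvec (X q))"
        by (rule tangent_chain[OF Xt f U(1) q U(3,4)])
      then show "X q f = (\<Sum>b\<in>Basis. frechet_derivative F (at (Phi q)) b * (mvec (X q) \<bullet> b))"
        using E[of "mvec (X q)"] by (simp only: euclidean_representation)
    qed
  qed
qed

text \<open>The matrix operator is transported back to abstract derivations by inverting
  \<open>mvec\<close> on the tangent space; \<open>Jmat_tangent\<close> shows that the inverse is
  applied inside the image.\<close>

definition Jst :: "(3 \<Rightarrow> 3 \<Rightarrow> real) \<Rightarrow> 'n::finite flag \<Rightarrow> 'n flag vect \<Rightarrow> 'n flag vect" where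
  "Jst \<epsilon> p v = inv_into (tangent_space flag_smooth p) mvec (Jmat \<epsilon> (Phi p) (mvec v))"

context
  fixes \<epsilon> assumes \<epsilon>: "orient \<epsilon>"
begin

lemma Jmat_tangent:
  assumes v: "v \<in> tangent_space flag_smooth p"
  shows "Jmat \<epsilon> (Phi p) (mvec v) \<in> mvec ` tangent_space flag_smooth p"
    and "Jmat \<epsilon> (Phi p) (Jmat \<epsilon> (Phi p) (mvec v)) = - mvec v"
proof -
  obtain g where g: "g \<in> SU" "p = flag_of g" by (rule flag_cases)
  have H: "adj g ** mvec v ** g \<in> Hoff"
    using v tangent_image[OF g(1)] g(2) by auto
  then show "Jmat \<epsilon> (Phi p) (mvec v) \<in> mvec ` tangent_space flag_smooth p"
    using g by (simp add: tangent_image Jmat_flag_of Jmat_Lam_Hoff[OF \<epsilon>])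
  have "adj g ** Jmat \<epsilon> (Phi p) (Jmat \<epsilon> (Phi p) (mvec v)) ** g = adj g ** (- mvec v) ** g"
    using g H by (simp add: Jmat_flag_of Jmat_Lam_square[OF \<epsilon>] matrix_minus_left matrix_minus_right)
  then show "Jmat \<epsilon> (Phi p) (Jmat \<epsilon> (Phi p) (mvec v)) = - mvec v"
    using SU_conj_cancel[OF g(1)] by metis
qed

lemma Jst_tangent: "v \<in> tangent_space flag_smooth p \<Longrightarrow> Jst \<epsilon> p v \<in> tangent_space flag_smooth p"
  unfolding Jst_def by (rule inv_into_into[OF Jmat_tangent(1)])

lemma mvec_Jst: "v \<in> tangent_space flag_smooth p \<Longrightarrow> mvec (Jst \<epsilon> p v) = Jmat \<epsilon> (Phi p) (mvec v)"
  unfolding Jst_def by (rule f_inv_into_f[OF Jmat_tangent(1)])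

lemma Jst_almost_complex: "almost_complex flag_smooth (Jst \<epsilon> :: 'n::finite flag \<Rightarrow> _)"
  unfolding almost_complex_def
proof (intro conjI allI ballI impI)
  fix p :: "'n flag" and v w a b
  assume v: "v \<in> tangent_space flag_smooth p" and w: "w \<in> tangent_space flag_smooth p"
  show "Jst \<epsilon> p (\<lambda>f. a * v f + b * w f) = (\<lambda>f. a * Jst \<epsilon> p v f + b * Jst \<epsilon> p w f)"
    by (rule mvec_inject[of _ p])
       (simp_all add: Jst_tangent tangent_space_lincomb v w mvec_Jst mvec_lincomb
         linear_add[OF linear_Jmat] linear_scale[OF linear_Jmat])
next
  fix p :: "'n flag" and v assume v: "v \<in> tangent_space flag_smooth p"
  show "Jst \<epsilon> p (Jst \<epsilon> p v) = (\<lambda>f. - v f)"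
    by (rule mvec_inject[of _ p])
       (simp_all add: Jst_tangent tangent_space_uminus v mvec_Jst mvec_uminus Jmat_tangent)
next
  fix X :: "'n flag \<Rightarrow> 'n flag vect" assume X: "vector_field flag_smooth X"
  then have Xt: "X p \<in> tangent_space flag_smooth p" and Xs: "f \<in> flag_smooth \<Longrightarrow> (\<lambda>p. X p f) \<in> flag_smooth" for p f
    by (auto simp: vector_field_def)
  have "(\<lambda>q. mvec (Jst \<epsilon> q (X q)) \<bullet> b) \<in> flag_smooth" for b
  proof -
    have "(\<lambda>q. mvec (Jst \<epsilon> q (X q)) \<bullet> b) =
        (\<lambda>q. \<Sum>c\<in>Basis. X q (\<lambda>r. Phi r \<bullet> c) * (Jmat \<epsilon> (Phi q) c \<bullet> b))"
      unfolding mvec_Jst[OF Xt]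
      by (simp add: mvec_def linear_sum[OF linear_Jmat] linear_scale[OF linear_Jmat] inner_sum_left)
    moreover have "(\<lambda>q. Jmat \<epsilon> (Phi q) c \<bullet> b) \<in> flag_smooth" for c
      by (intro flag_smooth_ambient smooth_map_inner open_UNIV smooth_map_Jmat)
    ultimately show ?thesis
      by (auto intro!: flag_smooth_sum flag_smooth_mult Xs flag_smooth_coord)
  qed
  then show "vector_field flag_smooth (\<lambda>p. Jst \<epsilon> p (X p))"
    by (intro vector_field_mvecI Jst_tangent Xt)
qed (rule Jst_tangent)

lemma Jst_intertwines:
  assumes g: "g \<in> SU" shows "intertwines flag_smooth (left_action g) (Jst \<epsilon>) (Jst \<epsilon>)"
  unfolding intertwines_def
proof (intro allI ballI)
  fix p :: "'a flag" and v assume v: "v \<in> tangent_space flag_smooth p"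
  note pf = pushforward_tangent[OF left_action_diffeomorphism[OF g]]
  show "pushforward (left_action g) (Jst \<epsilon> p v) = Jst \<epsilon> (left_action g p) (pushforward (left_action g) v)"
    by (rule mvec_inject[OF pf[OF Jst_tangent[OF v]] Jst_tangent[OF pf[OF v]]])
       (simp add: mvec_pushforward[OF g v] mvec_pushforward[OF g Jst_tangent[OF v]] mvec_Jst[OF v]
          mvec_Jst[OF pf[OF v]] Phi_left_action g Jmat_conj[OF SU_adj_mult[OF g]])
qed

lemma Jst_invariant: "Jst \<epsilon> \<in> invariant_acs"
  by (simp add: invariant_acs_def Jst_almost_complex Jst_intertwines)

end

text \<open>Here the determinant is corrected by a scalar, a root of its inverse of order the matrix
  size. In contrast to rescaling one column, a scalar acts trivially by conjugation on every matrix
  and not merely on \<open>Lam\<close>.\<close>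

lemma unitary_scale_SU:
  fixes V :: "complex^'m^'m"
  assumes V: "adj V ** V = mat 1"
  obtains c where "cmod c = 1" "V ** diag (\<lambda>_. c) \<in> SU"
proof
  define N where "N = CARD('m)"
  have N: "N > 0" by (simp add: N_def)
  define c where "c = cis (- Arg (det V) / N)"
  show c1: "cmod c = 1" by (simp add: c_def)
  have "cmod (det V) = 1"
  proof -
    have "complex_of_real ((cmod (det V))\<^sup>2) = 1"
      using unitary_det[OF V] by (simp only: complex_norm_square mult.commute)
    then have "(cmod (det V))\<^sup>2 = 1" by (simp only: of_real_eq_1_iff)
    then show ?thesis using norm_ge_zero[of "det V"] by (auto simp: power2_eq_1_iff)
  qed
  then have "det V = cis (Arg (det V))"
    using rcis_cmod_Arg[of "det V"] by (simp add: rcis_def)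
  moreover have "c ^ N = cis (- Arg (det V))"
    unfolding c_def Complex.DeMoivre using N by simp
  ultimately have "det V * c ^ N = 1"
    by (metis cis_mult add.right_inverse cis_zero)
  then have "det (V ** diag (\<lambda>_. c)) = 1"
    by (simp add: det_mul det_diag N_def)
  moreover have "adj (V ** diag (\<lambda>_. c)) ** (V ** diag (\<lambda>_. c)) = mat 1"
  proof -
    have "adj (V ** diag (\<lambda>_. c)) ** (V ** diag (\<lambda>_. c)) = adj (diag (\<lambda>_. c)) ** (adj V ** V) ** diag (\<lambda>_. c)"
      by (simp only: adj_mult matrix_mul_assoc)
    also have "\<dots> = mat 1"
      using c1 by (auto simp: V vec_eq_iff adj_diag diag_nth mat_def complex_norm_square[symmetric] mult.commute)
    finally show ?thesis .
  qed
  ultimately show "V ** diag (\<lambda>_. c) \<in> SU" by (simp add: SU_iff)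
qed

section \<open>Elementary Hermitian matrices and permutation matrices\<close>

lemma Hoff_zero: "w \<in> Hoff \<Longrightarrow> fst i = fst j \<Longrightarrow> w $ i $ j = 0"
  unfolding Hoff_def by blast

lemma Hoff_cnj: "w \<in> Hoff \<Longrightarrow> cnj (w $ j $ i) = w $ i $ j"
  unfolding Hoff_def by (metis (mono_tags, lifting) adj_nth mem_Collect_eq)

lemma herm_swap: "i \<noteq> j \<Longrightarrow> herm j i z = herm i j (cnj z)"
proof -
  assume "i \<noteq> j"
  then have "herm j i z $ k $ l = herm i j (cnj z) $ k $ l" for k l
    by (cases "k = i"; cases "k = j"; cases "l = i"; cases "l = j") (simp_all add: herm_nth)
  then show ?thesis by (simp add: vec_eq_iff)
qed

lemma herm_Hoff: "fst i \<noteq> fst j \<Longrightarrow> herm i j z \<in> Hoff"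
proof -
  assume ij: "fst i \<noteq> fst j"
  then have "i \<noteq> j" by auto
  then have "cnj (herm i j z $ l $ k) = herm i j z $ k $ l" for k l
    by (cases "k = i"; cases "k = j"; cases "l = i"; cases "l = j") (simp_all add: herm_nth)
  then have "adj (herm i j z) = herm i j z" by (simp add: vec_eq_iff)
  moreover have "herm i j z $ k $ l = 0" if "fst k = fst l" for k l
    using ij that by (auto simp: herm_nth)
  ultimately show ?thesis unfolding Hoff_def by blast
qed

lemma herm_lincomb: "herm i j (a *\<^sub>R x + b *\<^sub>R y) = a *\<^sub>R herm i j x + b *\<^sub>R herm i j y"
proof -
  have "herm i j (a *\<^sub>R x + b *\<^sub>R y) $ k $ l = (a *\<^sub>R herm i j x + b *\<^sub>R herm i j y) $ k $ l" for k l
  proof (cases "i = j")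
    case True
    then show ?thesis by (cases "k = j"; cases "l = j") (simp_all add: herm_nth)
  next
    case False
    then show ?thesis
      by (cases "k = i"; cases "k = j"; cases "l = i"; cases "l = j") (simp_all add: herm_nth)
  qed
  then show ?thesis by (simp add: vec_eq_iff)
qed

lemma herm_inject: "herm i j x = herm i j y \<Longrightarrow> x = y"
  by (metis herm_nth)

lemma Hoff_decomposition:
  assumes w: "w \<in> Hoff"
  shows "w = (\<Sum>i\<in>UNIV. \<Sum>j\<in>UNIV. herm i j (w $ i $ j / 2))"
proof -
  have "herm i i (w $ i $ i / 2) = 0" for i
    by (simp add: vec_eq_iff herm_nth Hoff_zero[OF w])
  then show ?thesis
    using herm_decomposition[of w] w by (simp add: Hoff_def)
qed

lemma Hoff_lincomb: "w \<in> Hoff \<Longrightarrow> w' \<in> Hoff \<Longrightarrow> a *\<^sub>R w + b *\<^sub>R w' \<in> Hoff"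
  unfolding Hoff_def by (auto simp: adj_add adj_scaleR)

lemma Hoff_sum: "(\<And>i. i \<in> I \<Longrightarrow> f i \<in> Hoff) \<Longrightarrow> (\<Sum>i\<in>I. f i) \<in> Hoff"
proof (induction I rule: infinite_finite_induct)
  case (insert i I)
  then show ?case using Hoff_lincomb[of "f i" "sum f I" 1 1] by simp
qed (auto simp: Hoff_def vec_eq_iff)

definition perm_mat :: "('m \<Rightarrow> 'm) \<Rightarrow> complex^'m^'m" where
  "perm_mat \<tau> = (\<chi> k l. if k = \<tau> l then 1 else 0)"

lemma perm_mat_right: "(A ** perm_mat \<tau>) $ k $ l = A $ k $ \<tau> l"
proof -
  have "A $ k $ m * perm_mat \<tau> $ m $ l = (if m = \<tau> l then A $ k $ m else 0)" for m
    by (auto simp: perm_mat_def)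
  then show ?thesis by (simp add: matrix_matrix_mult_def)
qed

context
  fixes \<tau> :: "'m::finite \<Rightarrow> 'm" assumes \<tau>: "\<And>m. \<tau> (\<tau> m) = m"
begin

lemma perm_mat_left: "(perm_mat \<tau> ** A) $ k $ l = A $ \<tau> k $ l"
proof -
  have "k = \<tau> m \<longleftrightarrow> m = \<tau> k" for m by (metis \<tau>)
  then have "perm_mat \<tau> $ k $ m * A $ m $ l = (if m = \<tau> k then A $ m $ l else 0)" for m
    by (simp add: perm_mat_def)
  then show ?thesis by (simp add: matrix_matrix_mult_def)
qed

lemma adj_perm_mat: "adj (perm_mat \<tau>) = perm_mat \<tau>"
proof -
  have "l = \<tau> k \<longleftrightarrow> k = \<tau> l" for k l by (metis \<tau>)
  then show ?thesis by (simp add: vec_eq_iff perm_mat_def)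
qed

lemma unitary_perm_mat: "adj (perm_mat \<tau>) ** perm_mat \<tau> = mat 1"
proof -
  have "\<tau> k = \<tau> l \<longleftrightarrow> k = l" for k l by (metis \<tau>)
  then show ?thesis unfolding vec_eq_iff adj_perm_mat perm_mat_left
    by (simp add: perm_mat_def mat_def)
qed

end

text \<open>An invariant structure at the base point, read through \<open>mvec\<close>. Equivariance
  under \<open>S_UUU\<close> is what invariance means at a point fixed by this group. Since
  \<open>T\<close> may be arbitrary elsewhere, all conditions are limited to
  \<open>Hoff\<close>.\<close>

locale isotropy_structure =
  fixes T :: "'n::finite cmat \<Rightarrow> 'n cmat"
  assumes T_Hoff: "w \<in> Hoff \<Longrightarrow> T w \<in> Hoff"
    and T_lincomb: "w \<in> Hoff \<Longrightarrow> w' \<in> Hoff \<Longrightarrow> T (a *\<^sub>R w + b *\<^sub>R w') = a *\<^sub>R T w + b *\<^sub>R T w'"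
    and T_square: "w \<in> Hoff \<Longrightarrow> T (T w) = - w"
    and T_equivariant: "w \<in> Hoff \<Longrightarrow> k \<in> S_UUU \<Longrightarrow> T (k ** w ** adj k) = k ** T w ** adj k"
begin

text \<open>Scalar matrices act trivially, so the determinant condition on the isotropy group is immaterial.\<close>

lemma T_unitary:
  assumes w: "w \<in> Hoff" and V: "adj V ** V = mat 1" "V ** Lam = Lam ** V"
  shows "T (V ** w ** adj V) = V ** T w ** adj V"
proof -
  obtain c where c: "cmod c = 1" "V ** diag (\<lambda>_. c) \<in> SU"
    by (rule unitary_scale_SU[OF V(1)])
  have act: "(V ** diag (\<lambda>_. c)) ** A ** adj (V ** diag (\<lambda>_. c)) = V ** A ** adj V" for A
  proof -
    have "diag (\<lambda>_. c) ** A ** adj (diag (\<lambda>_. c)) = A"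
    proof -
      have "c * cnj c = 1" using c(1) by (simp add: complex_norm_square[symmetric])
      moreover have "c * z * cnj c = z * (c * cnj c)" for z by (simp add: mult_ac)
      ultimately show ?thesis by (simp add: vec_eq_iff adj_diag)
    qed
    moreover have "(V ** diag (\<lambda>_. c)) ** A ** adj (V ** diag (\<lambda>_. c)) =
        V ** (diag (\<lambda>_. c) ** A ** adj (diag (\<lambda>_. c))) ** adj V"
      by (simp only: adj_mult matrix_mul_assoc)
    ultimately show ?thesis by simp
  qed
  have "diag (\<lambda>_. c) ** Lam = Lam ** diag (\<lambda>_. c)"
    by (simp add: vec_eq_iff mult.commute)
  then have "(V ** diag (\<lambda>_. c)) ** Lam = Lam ** (V ** diag (\<lambda>_. c))"
    using V(2) by (metis matrix_mul_assoc)
  then have "V ** diag (\<lambda>_. c) \<in> S_UUU"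
    using c(2) by (simp add: S_UUU_iff)
  from T_equivariant[OF w this] show ?thesis unfolding act .
qed

lemma T_diag:
  assumes w: "w \<in> Hoff" and d: "\<And>k. cmod (d k) = 1"
  shows "T (diag d ** w ** adj (diag d)) $ k $ l = d k * cnj (d l) * T w $ k $ l"
proof -
  have "d k * cnj (d k) = 1" for k using d[of k] by (simp add: complex_norm_square[symmetric])
  then have "adj (diag d) ** diag d = mat 1"
    by (auto simp: vec_eq_iff adj_diag diag_nth mat_def mult.commute)
  moreover have "diag d ** Lam = Lam ** diag d"
    by (auto simp: vec_eq_iff Lam_def diag_nth)
  ultimately have "T (diag d ** w ** adj (diag d)) = diag d ** T w ** adj (diag d)"
    by (rule T_unitary[OF w])
  then show ?thesis by (simp add: adj_diag mult_ac)
qed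

text \<open>For k different from i and j, the diagonal matrix with entry \<i> at k and 1 elsewhere
  fixes \<open>herm i j z\<close>, but multiplies the (k,l) entry of its image by \<i>. So row k of
  the image vanishes, and by Hermitian symmetry also column k.\<close>

lemma T_herm_support:
  assumes ij: "fst i \<noteq> fst j"
  shows "T (herm i j z) = herm i j (T (herm i j z) $ i $ j)"
proof -
  let ?H = "herm i j z"
  have ne: "i \<noteq> j" using ij by auto
  have H: "?H \<in> Hoff" using ij by (rule herm_Hoff)
  have zero: "T ?H $ k $ l = 0" if k: "k \<noteq> i" "k \<noteq> j" for k l
  proof (cases "l = k")
    case True
    then show ?thesis using Hoff_zero[OF T_Hoff[OF H]] by simp
  next
    case False
    define d where "d m = (if m = k then \<i> else 1)" for m
    have "diag d ** ?H ** adj (diag d) = ?H"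
      using k by (auto simp: vec_eq_iff adj_diag herm_nth d_def)
    then have "T ?H $ k $ l = d k * cnj (d l) * T ?H $ k $ l"
      using T_diag[OF H, of d k l] by (simp add: d_def)
    then have "(1 - \<i>) * T ?H $ k $ l = 0" using False by (simp add: d_def algebra_simps)
    then show ?thesis by (simp add: complex_eq_iff)
  qed
  have sym: "cnj (T ?H $ l $ k) = T ?H $ k $ l" for k l by (rule Hoff_cnj[OF T_Hoff[OF H]])
  have "T ?H $ k $ l = herm i j (T ?H $ i $ j) $ k $ l" for k l
  proof -
    consider "k = i" "l = j" | "k = j" "l = i" | "k = l" "k = i \<or> k = j" | "k \<noteq> i" "k \<noteq> j" | "l \<noteq> i" "l \<noteq> j"
      by blast
    then show ?thesis
    proof cases
      case 2
      then show ?thesis using sym[of i j] ne by (simp add: herm_nth)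
    next
      case 3
      then show ?thesis using Hoff_zero[OF T_Hoff[OF H], of k k] ne by (auto simp: herm_nth)
    next
      case 4
      then show ?thesis using zero[of k l] by (simp add: herm_nth)
    next
      case 5
      then show ?thesis using zero[of l k] sym[of l k] by (simp add: herm_nth)
    qed (simp add: herm_nth)
  qed
  then show ?thesis unfolding vec_eq_iff by blast
qed

text \<open>The entry turns out to be \<i> or -\<i>, and the imaginary part extracts its
  sign.\<close>

definition sign_of where "sign_of i j = Im (T (herm i j 1) $ i $ j)"

text \<open>On one entry \<open>T\<close> is a real-linear map c of the complex numbers. The
  diagonal matrix with \<i> at position i turns \<open>herm i j z\<close> into
  \<open>herm i j (\<i> * z)\<close>, so c commutes with \<i> and is multiplication by c 1. Squaring
  to -1 leaves c 1 = \<i> or -\<i>.\<close>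

lemma T_herm:
  assumes ij: "fst i \<noteq> fst j"
  shows "T (herm i j z) = herm i j (of_real (sign_of i j) * \<i> * z)" and "sign_of i j = 1 \<or> sign_of i j = -1"
proof -
  have H: "herm i j z \<in> Hoff" for z using ij by (rule herm_Hoff)
  have ne: "i \<noteq> j" using ij by auto
  define c where "c z = T (herm i j z) $ i $ j" for z
  have Tc: "T (herm i j z) = herm i j (c z)" for z
    using T_herm_support[OF ij] by (simp add: c_def)
  have c_lin: "c (a *\<^sub>R x + b *\<^sub>R y) = a *\<^sub>R c x + b *\<^sub>R c y" for a b x y
    unfolding c_def herm_lincomb T_lincomb[OF H H] by simp
  have c_i: "c (\<i> * z) = \<i> * c z" for z
  proof -
    define d where "d m = (if m = i then \<i> else 1)" for m
    have "diag d ** herm i j z ** adj (diag d) = herm i j (\<i> * z)"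
      using ne by (auto simp: vec_eq_iff adj_diag herm_nth d_def)
    then show ?thesis
      using T_diag[OF H, of d z i j] ne by (simp add: d_def c_def)
  qed
  have cz: "c z = c 1 * z" for z
  proof -
    have "z = Re z *\<^sub>R 1 + Im z *\<^sub>R \<i>" by (simp add: complex_eq_iff)
    then have "c z = Re z *\<^sub>R c 1 + Im z *\<^sub>R c \<i>" using c_lin by metis
    also have "c \<i> = \<i> * c 1" using c_i[of 1] by simp
    finally show ?thesis by (simp add: complex_eq_iff algebra_simps)
  qed
  have "herm i j (c (c 1)) = herm i j (- 1)"
  proof -
    have "herm i j (c (c 1)) = - herm i j 1" using T_square[OF H, of 1] by (simp add: Tc)
    also have "\<dots> = herm i j (- 1)" by (auto simp: vec_eq_iff herm_nth)
    finally show ?thesis .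
  qed
  then have "c 1 * c 1 = - 1" using herm_inject cz[of "c 1"] by metis
  then have "(c 1 - \<i>) * (c 1 + \<i>) = 0" by (simp add: algebra_simps)
  then have "c 1 = \<i> \<or> c 1 = - \<i>" by (auto simp: eq_neg_iff_add_eq_0)
  then have c1: "(c 1 = \<i> \<and> sign_of i j = 1) \<or> (c 1 = - \<i> \<and> sign_of i j = -1)"
    by (auto simp: sign_of_def c_def)
  then show "sign_of i j = 1 \<or> sign_of i j = -1" by blast
  have "c 1 = of_real (sign_of i j) * \<i>" using c1 by auto
  then show "T (herm i j z) = herm i j (of_real (sign_of i j) * \<i> * z)"
    using Tc[of z] cz[of z] by simp
qed

lemma sign_of_antisym:
  assumes ij: "fst i \<noteq> fst j" shows "sign_of j i = - sign_of i j"
proof -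
  have ne: "i \<noteq> j" using ij by auto
  have "herm j i (of_real (sign_of j i) * \<i>) = T (herm j i 1)"
    using T_herm(1)[of j i 1] ij by simp
  also have "\<dots> = T (herm i j 1)" using herm_swap[OF ne, of 1] by simp
  also have "\<dots> = herm i j (of_real (sign_of i j) * \<i>)" using T_herm(1)[OF ij, of 1] by simp
  also have "\<dots> = herm j i (- (of_real (sign_of i j) * \<i>))"
    using herm_swap[OF ne[symmetric], of "of_real (sign_of i j) * \<i>"] by simp
  finally have "of_real (sign_of j i) * \<i> = - (of_real (sign_of i j) * \<i>)" by (rule herm_inject)
  then show ?thesis by (simp add: complex_eq_iff)
qed

text \<open>Exchanging the indices i and i' of one block is a unitary matrix commuting with
  \<open>Lam\<close>. It fixes j and carries \<open>herm i j z\<close> to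
  \<open>herm i' j z\<close>, so equivariance equates the signs.\<close>

lemma sign_of_block_left:
  assumes ij: "fst i \<noteq> fst j" and i': "fst i' = fst i" shows "sign_of i' j = sign_of i j"
proof -
  define \<tau> where "\<tau> m = (if m = i then i' else if m = i' then i else m)" for m
  have \<tau>\<tau>: "\<tau> (\<tau> m) = m" for m by (auto simp: \<tau>_def)
  have f\<tau>: "fst (\<tau> m) = fst m" for m using i' by (auto simp: \<tau>_def)
  define V :: "'n cmat" where "V = perm_mat \<tau>"
  note Vl = perm_mat_left[of \<tau>, OF \<tau>\<tau>, folded V_def] and Vr = perm_mat_right[of _ \<tau>, folded V_def]
    and aV = adj_perm_mat[of \<tau>, OF \<tau>\<tau>, folded V_def] and u = unitary_perm_mat[of \<tau>, OF \<tau>\<tau>, folded V_def]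
  have cL: "V ** Lam = Lam ** V"
  proof -
    have "\<tau> k = l \<longleftrightarrow> k = \<tau> l" for k l by (metis \<tau>\<tau>)
    then show ?thesis unfolding vec_eq_iff Vl Vr by (simp add: Lam_def diag_nth f\<tau>)
  qed
  have act: "V ** herm i j z ** adj V = herm i' j z" for z
  proof -
    have "\<tau> k = i \<longleftrightarrow> k = i'" "\<tau> k = j \<longleftrightarrow> k = j" for k
      using ij i' by (auto simp: \<tau>_def)
    then show ?thesis by (simp add: vec_eq_iff aV Vl Vr herm_nth)
  qed
  have ij': "fst i' \<noteq> fst j" using ij i' by simp
  have "herm i' j (of_real (sign_of i' j) * \<i> * 1) = T (herm i' j 1)"
    using T_herm(1)[OF ij', of 1] by simp
  also have "\<dots> = V ** T (herm i j 1) ** adj V"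
    using T_unitary[OF herm_Hoff[OF ij] u cL] by (simp add: act)
  also have "\<dots> = herm i' j (of_real (sign_of i j) * \<i> * 1)"
    by (simp only: T_herm(1)[OF ij] act)
  finally have "of_real (sign_of i' j) * \<i> * 1 = of_real (sign_of i j) * \<i> * 1" by (rule herm_inject)
  then show ?thesis by (simp add: complex_eq_iff)
qed

lemma sign_of_block_right:
  assumes ij: "fst i \<noteq> fst j" and j': "fst j' = fst j" shows "sign_of i j' = sign_of i j"
  using sign_of_block_left[of j i j'] sign_of_antisym[of i j] sign_of_antisym[of i j'] assms by simp

lemma T_sum:
  "finite I \<Longrightarrow> (\<And>i. i \<in> I \<Longrightarrow> f i \<in> Hoff) \<Longrightarrow> T (\<Sum>i\<in>I. f i) = (\<Sum>i\<in>I. T (f i))"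
proof (induction I rule: finite_induct)
  case empty
  have "(0 :: 'n cmat) \<in> Hoff" using Hoff_sum[of "{}"] by simp
  then show ?case using T_lincomb[of 0 0 0 0] by simp
next
  case (insert i I)
  then show ?case using T_lincomb[of "f i" "sum f I" 1 1] Hoff_sum[of I f] by simp
qed

theorem isotropy_classification: "\<exists>\<epsilon>. orient \<epsilon> \<and> (\<forall>w\<in>Hoff. T w = Jmat \<epsilon> Lam w)"
proof -
  \<comment> \<open>\<open>undefined\<close> is an arbitrary position in the block: by the two
    preceding block lemmas the sign does not depend on it.\<close>
  define \<epsilon> where "\<epsilon> a b = (if a = b then 0 else sign_of (a, undefined) (b, undefined))" for a b
  have or: "orient \<epsilon>"
    unfolding orient_def
  proof (intro conjI allI impI)
    fix a b :: 3
    show "\<epsilon> b a = - \<epsilon> a b"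
      using sign_of_antisym[of "(a, undefined)" "(b, undefined)"] by (cases "a = b") (auto simp: \<epsilon>_def)
    show "\<epsilon> a b = 1 \<or> \<epsilon> a b = - 1" if "a \<noteq> b"
      using T_herm(2)[of "(a, undefined)" "(b, undefined)"] that by (simp add: \<epsilon>_def)
  qed
  have \<epsilon>: "sign_of i j = \<epsilon> (fst i) (fst j)" if ij: "fst i \<noteq> fst j" for i j
    using sign_of_block_left[of i j "(fst i, undefined)"]
      sign_of_block_right[of "(fst i, undefined)" j "(fst j, undefined)"] ij by (simp add: \<epsilon>_def)
  have "T w = Jmat \<epsilon> Lam w" if w: "w \<in> Hoff" for w
  proof -
    let ?J = "Jmat \<epsilon> Lam w"
    have z: "(0 :: 'n cmat) \<in> Hoff" using Hoff_sum[of "{}"] by simp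
    have T0: "T 0 = 0" using T_sum[of "{}"] by simp
    have h0: "herm i j 0 = 0" for i j :: "3 \<times> 'n" by (simp add: vec_eq_iff herm_nth)
    have HH: "herm i j (w $ i $ j / 2) \<in> Hoff" for i j
      using Hoff_zero[OF w, of i j] h0[of i j] z herm_Hoff[of i j] by (cases "fst i = fst j") auto
    have "T (herm i j (w $ i $ j / 2)) = herm i j (?J $ i $ j / 2)" for i j
    proof (cases "fst i = fst j")
      case True
      then show ?thesis using Hoff_zero[OF w True] by (simp add: h0 T0 Jmat_Lam_nth)
    next
      case False
      then show ?thesis using T_herm(1)[OF False] by (simp add: \<epsilon> Jmat_Lam_nth mult_ac)
    qed
    moreover have "T w = (\<Sum>i\<in>UNIV. \<Sum>j\<in>UNIV. T (herm i j (w $ i $ j / 2)))"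
    proof -
      have "T w = T (\<Sum>i\<in>UNIV. \<Sum>j\<in>UNIV. herm i j (w $ i $ j / 2))"
        using Hoff_decomposition[OF w] by simp
      also have "\<dots> = (\<Sum>i\<in>UNIV. T (\<Sum>j\<in>UNIV. herm i j (w $ i $ j / 2)))"
        by (rule T_sum) (auto intro: Hoff_sum HH)
      also have "\<dots> = (\<Sum>i\<in>UNIV. \<Sum>j\<in>UNIV. T (herm i j (w $ i $ j / 2)))"
        by (intro sum.cong refl T_sum HH) simp
      finally show ?thesis .
    qed
    ultimately show ?thesis
      using Hoff_decomposition[OF Jmat_Lam_Hoff[OF or w]] by simp
  qed
  then show ?thesis using or by blast
qed

end

text \<open>At the base point this is \<open>isotropy_classification\<close>; transitivity of the
  action spreads it to all points. The two structures agree on tangent vectors only, as the values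
  of \<open>J p\<close> elsewhere are unconstrained.\<close>

theorem invariant_acs_classification:
  assumes J: "J \<in> (invariant_acs :: ('n::finite flag \<Rightarrow> 'n flag vect \<Rightarrow> 'n flag vect) set)"
  obtains \<epsilon> where "orient \<epsilon>" "\<And>p v. v \<in> tangent_space flag_smooth p \<Longrightarrow> J p v = Jst \<epsilon> p v"
proof -
  let ?TS = "tangent_space flag_smooth :: 'n flag \<Rightarrow> _"
  have Jt: "J p v \<in> ?TS p" if "v \<in> ?TS p" for p v
    using J that by (simp add: invariant_acs_def almost_complex_def)
  have Jl: "J p (\<lambda>f. a * v f + b * w f) = (\<lambda>f. a * J p v f + b * J p w f)" if "v \<in> ?TS p" "w \<in> ?TS p" for p v w a b
    using J that by (simp add: invariant_acs_def almost_complex_def)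
  have Js: "J p (J p v) = (\<lambda>f. - v f)" if "v \<in> ?TS p" for p v
    using J that by (simp add: invariant_acs_def almost_complex_def)
  have Ji: "pushforward (left_action g) (J p v) = J (left_action g p) (pushforward (left_action g) v)"
    if "g \<in> SU" "v \<in> ?TS p" for g p v
    using J that by (simp add: invariant_acs_def intertwines_def)
  define tv where "tv = inv_into (?TS base) mvec"
  have tv: "tv w \<in> ?TS base" "mvec (tv w) = w" if "w \<in> Hoff" for w
    using that tangent_image_base inv_into_into f_inv_into_f unfolding tv_def by metis+
  have tvm: "tv (mvec v) = v" if "v \<in> ?TS base" for v
    using mvec_inject[OF tv(1) that] tv(2) mvec_base_Hoff[OF that] by blast
  define T where "T w = mvec (J base (tv w))" for w
  interpret isotropy_structure T
  proof
    fix w :: "'n cmat" assume w: "w \<in> Hoff"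
    show "T w \<in> Hoff" unfolding T_def by (rule mvec_base_Hoff[OF Jt[OF tv(1)[OF w]]])
    show "T (T w) = - w"
      unfolding T_def by (simp add: tvm Jt tv w Js mvec_uminus)
    show "T (a *\<^sub>R w + b *\<^sub>R w') = a *\<^sub>R T w + b *\<^sub>R T w'" if w': "w' \<in> Hoff" for w' a b
    proof -
      have "tv (a *\<^sub>R w + b *\<^sub>R w') = (\<lambda>f. a * tv w f + b * tv w' f)"
        by (rule mvec_inject[of _ base])
           (simp_all add: tv w w' Hoff_lincomb tangent_space_lincomb mvec_lincomb)
      then show ?thesis by (simp add: T_def Jl tv w w' mvec_lincomb)
    qed
    show "T (k ** w ** adj k) = k ** T w ** adj k" if k: "k \<in> S_UUU" for k
    proof -
      have kS: "k \<in> SU" using k by (rule S_UUU_SU)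
      have "k ** Lam = Lam ** k" using k by (simp add: S_UUU_iff)
      then have "k ** Lam ** adj k = Lam ** (k ** adj k)" by (simp add: matrix_mul_assoc)
      then have "Phi (left_action k base) = Phi base"
        unfolding Phi_left_action[OF kS] Phi_base by (simp add: SU_mult_adj[OF kS])
      then have kb: "left_action k base = base" by (simp only: Phi_inject)
      have pt: "pushforward (left_action k) (tv w) \<in> ?TS base"
        using pushforward_tangent[OF left_action_diffeomorphism[OF kS] tv(1)[OF w]] by (simp add: kb)
      have "mvec (pushforward (left_action k) (tv w)) = k ** w ** adj k"
        using mvec_pushforward[OF kS tv(1)[OF w]] by (simp add: tv(2)[OF w])
      then have "tv (k ** w ** adj k) = pushforward (left_action k) (tv w)"
        using tvm[OF pt] by simp
      then show ?thesis
        using Ji[OF kS tv(1)[OF w]] mvec_pushforward[OF kS Jt[OF tv(1)[OF w]]] by (simp add: T_def kb)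
    qed
  qed
  obtain \<epsilon> where \<epsilon>: "orient \<epsilon>" "\<And>w. w \<in> Hoff \<Longrightarrow> T w = Jmat \<epsilon> Lam w"
    using isotropy_classification by blast
  have b: "J base v = Jst \<epsilon> base v" if v: "v \<in> ?TS base" for v
    by (rule mvec_inject[OF Jt[OF v] Jst_tangent[OF \<epsilon>(1) v]])
       (use \<epsilon>(2)[OF mvec_base_Hoff[OF v]] in \<open>simp add: mvec_Jst[OF \<epsilon>(1) v] T_def tvm[OF v]\<close>)
  have "J p v = Jst \<epsilon> p v" if v: "v \<in> ?TS p" for p v
  proof -
    obtain g where g: "g \<in> SU" "p = flag_of g" by (rule flag_cases)
    have ga: "left_action g base = p" using g by (simp add: left_action_flag_of SU_one)
    have gb: "left_action (adj g) p = base" using ga g left_action_adj(1) by metis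
    let ?u = "pushforward (left_action (adj g)) v"
    have u: "?u \<in> ?TS base"
      using pushforward_tangent[OF left_action_diffeomorphism[OF SU_adj[OF g(1)]] v] by (simp add: gb)
    have "J p v = pushforward (left_action g) (J base ?u)"
      using Ji[OF g(1) u] by (simp add: ga pushforward_left_action_inverse[OF g(1)])
    also have "\<dots> = pushforward (left_action g) (Jst \<epsilon> base ?u)"
      using b[OF u] by simp
    also have "\<dots> = Jst \<epsilon> p v"
      using Jst_intertwines[OF \<epsilon>(1) g(1)] u
      by (simp add: intertwines_def ga pushforward_left_action_inverse[OF g(1)])
    finally show ?thesis .
  qed
  then show ?thesis using that \<epsilon>(1) by blast
qed

section \<open>Equivalences between the invariant structures\<close>

lemma same_refl: "same_up_to_conj_equiv C J J"
  by (simp add: same_up_to_conj_equiv_def)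

lemma same_sym: "same_up_to_conj_equiv C J J' \<Longrightarrow> same_up_to_conj_equiv C J' J"
  unfolding same_up_to_conj_equiv_def by (rule equivclp_sym)

lemma same_trans:
  "same_up_to_conj_equiv C J J' \<Longrightarrow> same_up_to_conj_equiv C J' J'' \<Longrightarrow> same_up_to_conj_equiv C J J''"
  unfolding same_up_to_conj_equiv_def by (rule equivclp_trans)

lemma same_equivalent:
  "almost_complex C J \<Longrightarrow> almost_complex C J' \<Longrightarrow> equivalent_structures C J J' \<Longrightarrow>
    same_up_to_conj_equiv C J J'"
  unfolding same_up_to_conj_equiv_def by (simp add: r_into_equivclp)

lemma same_conjugate:
  "almost_complex C J \<Longrightarrow> almost_complex C (conjugate_structure J) \<Longrightarrow>
    same_up_to_conj_equiv C J (conjugate_structure J)"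
  unfolding same_up_to_conj_equiv_def by (simp add: r_into_equivclp)

text \<open>The identity map is an equivalence. This disposes of the irrelevant values outside the
  tangent spaces.\<close>

lemma equivalent_if_eq_on_tangent:
  assumes "\<And>p v. v \<in> tangent_space C p \<Longrightarrow> J p v = J' p v"
  shows "equivalent_structures C J J'"
  unfolding equivalent_structures_def
proof (intro exI conjI)
  show "diffeomorphism C id" by (simp add: diffeomorphism_def inv_id)
  show "intertwines C id J J'" using assms by (simp add: intertwines_def pushforward_def)
qed

lemma almost_complex_conjugate:
  fixes J :: "'n::finite flag \<Rightarrow> _"
  assumes J: "almost_complex flag_smooth J"
  shows "almost_complex flag_smooth (conjugate_structure J)"
proof -
  let ?T = "tangent_space flag_smooth :: 'n flag \<Rightarrow> _"
  have Jt: "J p v \<in> ?T p" if "v \<in> ?T p" for p v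
    using J that by (simp add: almost_complex_def)
  have Jl: "J p (\<lambda>f. a * v f + b * w f) = (\<lambda>f. a * J p v f + b * J p w f)" if "v \<in> ?T p" "w \<in> ?T p" for p v w a b
    using J that by (simp add: almost_complex_def)
  have Js: "J p (J p v) = (\<lambda>f. - v f)" if "v \<in> ?T p" for p v
    using J that by (simp add: almost_complex_def)
  have Jm: "J p (\<lambda>f. - v f) = (\<lambda>f. - J p v f)" if "v \<in> ?T p" for p v
    using Jl[OF that that, of "-1" 0] by simp
  show ?thesis
    unfolding almost_complex_def conjugate_structure_def
  proof (intro conjI allI ballI impI)
    fix X :: "'n flag \<Rightarrow> 'n flag vect" assume "vector_field flag_smooth X"
    then have V: "vector_field flag_smooth (\<lambda>p. J p (X p))" using J by (simp add: almost_complex_def)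
    then have "(\<lambda>p. (-1) * J p (X p) f + 0 * J p (X p) f) \<in> flag_smooth" if "f \<in> flag_smooth" for f
      using that unfolding vector_field_def by (intro flag_smooth_lincomb) auto
    then show "vector_field flag_smooth (\<lambda>p f. - J p (X p) f)"
      using V unfolding vector_field_def by (auto intro: tangent_space_uminus)
  qed (use Jt Jl Js Jm in \<open>auto intro!: tangent_space_uminus simp: fun_eq_iff\<close>)
qed

lemma orient_uminus: "orient \<epsilon> \<Longrightarrow> orient (\<lambda>a b. - \<epsilon> a b)"
  unfolding orient_def
proof (intro conjI allI impI)
  fix a b :: 3
  assume \<epsilon>: "(\<forall>a b. \<epsilon> b a = - \<epsilon> a b) \<and> (\<forall>a b. a \<noteq> b \<longrightarrow> \<epsilon> a b = 1 \<or> \<epsilon> a b = - 1)"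
  then have "\<epsilon> b a = - \<epsilon> a b" by blast
  then show "- \<epsilon> b a = - (- \<epsilon> a b)" by linarith
  assume "a \<noteq> b"
  then have "\<epsilon> a b = 1 \<or> \<epsilon> a b = -1" using \<epsilon> by blast
  then show "- \<epsilon> a b = 1 \<or> - \<epsilon> a b = -1" by linarith
qed

lemma conjugate_Jst:
  assumes \<epsilon>: "orient \<epsilon>" and v: "v \<in> tangent_space flag_smooth p"
  shows "conjugate_structure (Jst \<epsilon>) p v = Jst (\<lambda>a b. - \<epsilon> a b) p v"
proof (rule mvec_inject[of _ p])
  note o = orient_uminus[OF \<epsilon>]
  show "conjugate_structure (Jst \<epsilon>) p v \<in> tangent_space flag_smooth p"
    unfolding conjugate_structure_def by (intro tangent_space_uminus Jst_tangent \<epsilon> v)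
  show "Jst (\<lambda>a b. - \<epsilon> a b) p v \<in> tangent_space flag_smooth p"
    by (rule Jst_tangent[OF o v])
  show "mvec (conjugate_structure (Jst \<epsilon>) p v) = mvec (Jst (\<lambda>a b. - \<epsilon> a b) p v)"
    unfolding mvec_Jst[OF o v] conjugate_structure_def mvec_uminus mvec_Jst[OF \<epsilon> v]
    by (simp add: Jmat_def sum_negf)
qed

text \<open>Two generating steps are used because the conjugate of \<open>Jst \<epsilon>\<close> and
  the structure of the reversed orientation need agree only on tangent vectors.\<close>

lemma same_Jst_uminus:
  assumes \<epsilon>: "orient \<epsilon>"
  shows "same_up_to_conj_equiv flag_smooth (Jst \<epsilon> :: 'n::finite flag \<Rightarrow> _) (Jst (\<lambda>a b. - \<epsilon> a b))"
proof (rule same_trans)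
  let ?J = "Jst \<epsilon> :: 'n flag \<Rightarrow> _"
  have c: "almost_complex flag_smooth (conjugate_structure ?J)"
    by (rule almost_complex_conjugate[OF Jst_almost_complex[OF \<epsilon>]])
  show "same_up_to_conj_equiv flag_smooth ?J (conjugate_structure ?J)"
    by (rule same_conjugate[OF Jst_almost_complex[OF \<epsilon>] c])
  show "same_up_to_conj_equiv flag_smooth (conjugate_structure ?J) (Jst (\<lambda>a b. - \<epsilon> a b))"
    by (intro same_equivalent c Jst_almost_complex orient_uminus \<epsilon> equivalent_if_eq_on_tangent
        conjugate_Jst)
qed

text \<open>A permutation \<open>\<tau>\<close> of the three blocks acts on the flag manifold on the right. In terms of
  \<open>Phi\<close> it replaces the eigenvalue \<open>lam a\<close> by \<open>lam (\<tau> a)\<close>.\<close>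

definition weyl :: "(3 \<Rightarrow> 3) \<Rightarrow> complex^'m^'m \<Rightarrow> complex^'m^'m" where
  "weyl \<tau> Y = (\<Sum>a\<in>UNIV. lam (\<tau> a) *\<^sub>R Proj a Y)"

text \<open>Existence of the chosen point is \<open>Phi_weyl_map\<close>, and its uniqueness is
  injectivity of \<open>Phi\<close>.\<close>

definition weyl_map :: "(3 \<Rightarrow> 3) \<Rightarrow> 'n::finite flag \<Rightarrow> 'n flag" where
  "weyl_map \<tau> p = (SOME q. Phi q = weyl \<tau> (Phi p))"

definition dweyl :: "(3 \<Rightarrow> 3) \<Rightarrow> complex^'m^'m \<Rightarrow> complex^'m^'m \<Rightarrow> complex^'m^'m" where
  "dweyl \<tau> Y w = (\<Sum>a\<in>UNIV. lam (\<tau> a) *\<^sub>R (proj2 a *\<^sub>R (Y ** w + w ** Y) + proj1 a *\<^sub>R w))"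

lemma Proj_derivative:
  "(Proj a has_derivative (\<lambda>w. proj2 a *\<^sub>R (Y ** w + w ** Y) + proj1 a *\<^sub>R w)) (at Y)"
proof -
  have bb: "bounded_bilinear ((**) :: complex^'a^'a \<Rightarrow> complex^'a^'a \<Rightarrow> complex^'a^'a)"
    using bilinear_matrix_mult by (simp add: bilinear_conv_bounded_bilinear)
  show ?thesis
    unfolding Proj_def[abs_def]
    using has_derivative_add[OF has_derivative_add[OF
        has_derivative_scaleR_right[OF bounded_bilinear.FDERIV[OF bb has_derivative_ident has_derivative_ident]]
        has_derivative_scaleR_right[OF has_derivative_ident]] has_derivative_const] by simp
qed

lemma weyl_derivative: "(weyl \<tau> has_derivative dweyl \<tau> Y) (at Y)"
  unfolding weyl_def[abs_def] dweyl_def[abs_def]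
  by (intro has_derivative_sum has_derivative_scaleR_right Proj_derivative)

lemma smooth_weyl: "open U \<Longrightarrow> smooth_map U (weyl \<tau>)"
  unfolding weyl_def[abs_def]
  by (intro smooth_map_sum smooth_map_scaleR smooth_Proj) (auto simp: smooth_on_def Ck_on_const)

lemma weyl_conj:
  "adj g ** g = mat 1 \<Longrightarrow> weyl \<tau> (g ** Y ** adj g) = g ** weyl \<tau> Y ** adj g"
  unfolding weyl_def linear_sum[OF linear_matrix_conj] linear_scale[OF linear_matrix_conj]
  by (simp add: Proj_conj)

lemma dweyl_conj:
  assumes "adj g ** g = mat 1"
  shows "dweyl \<tau> (g ** Y ** adj g) (g ** w ** adj g) = g ** dweyl \<tau> Y w ** adj g"
  unfolding dweyl_def linear_sum[OF linear_matrix_conj] linear_scale[OF linear_matrix_conj]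
    linear_add[OF linear_matrix_conj] conj_mult[OF assms] ..

context
  fixes \<tau> :: "3 \<Rightarrow> 3" assumes \<tau>: "\<And>a. \<tau> (\<tau> a) = a"
begin

abbreviation "weyl_mat \<equiv> perm_mat (map_prod \<tau> id)"

lemma map_prod_involution: "map_prod \<tau> id (map_prod \<tau> id k) = k" for k :: "3 \<times> 'n"
  by (cases k) (simp add: \<tau>)

lemmas W_left = perm_mat_left[of "map_prod \<tau> id", OF map_prod_involution]
lemmas W_adj = adj_perm_mat[of "map_prod \<tau> id", OF map_prod_involution]
lemmas W_unitary = unitary_perm_mat[of "map_prod \<tau> id", OF map_prod_involution]

text \<open>At \<open>Lam\<close> the map is conjugation by a permutation matrix, which is why it
  preserves the orbit. For an involution this matrix is its own adjoint and \<open>weyl_map\<close>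
  its own inverse; the transpositions used later generate all permutations of the blocks.\<close>

lemma weyl_Lam: "weyl \<tau> Lam = weyl_mat ** Lam ** adj (weyl_mat :: 'n::finite cmat)"
proof -
  have "weyl \<tau> Lam $ k $ l = (if k = l then of_real (lam (\<tau> (fst k))) else 0)" for k l :: "3 \<times> 'n"
  proof -
    have "(lam (\<tau> a) *\<^sub>R Proj a Lam) $ k $ l =
        (if a = fst k then (if k = l then of_real (lam (\<tau> a)) else 0) else 0)" for a
      by (simp add: Proj_Lam diag_nth scaleR_complex)
    then show ?thesis by (simp add: weyl_def)
  qed
  moreover have "map_prod \<tau> id k = map_prod \<tau> id l \<longleftrightarrow> k = l" for k l :: "3 \<times> 'n"
    by (metis map_prod_involution)
  ultimately show ?thesis
    unfolding vec_eq_iff W_adj W_left perm_mat_right by (simp add: Lam_def diag_nth)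
qed

lemma weyl_weyl_Lam: "weyl \<tau> (weyl \<tau> Lam) = (Lam :: 'n::finite cmat)"
proof -
  let ?weyl_mat = "weyl_mat :: 'n cmat"
  have WW: "?weyl_mat ** ?weyl_mat = mat 1" using W_unitary by (simp add: W_adj)
  have "weyl \<tau> (weyl \<tau> Lam) = ?weyl_mat ** weyl \<tau> Lam ** adj ?weyl_mat"
    by (subst weyl_Lam, rule weyl_conj[OF W_unitary])
  also have "\<dots> = (?weyl_mat ** ?weyl_mat) ** Lam ** (adj ?weyl_mat ** adj ?weyl_mat)"
    by (simp only: weyl_Lam matrix_mul_assoc)
  finally show ?thesis
    by (simp add: W_adj WW)
qed

lemma Phi_weyl_map: "Phi (weyl_map \<tau> p) = weyl \<tau> (Phi p)"
  unfolding weyl_map_def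
proof (rule someI_ex)
  obtain g where g: "g \<in> SU" "p = flag_of g" by (rule flag_cases)
  have "weyl \<tau> (Phi p) = (g ** weyl_mat) ** Lam ** adj (g ** weyl_mat)"
    using g by (simp add: Phi_flag_of weyl_conj SU_adj_mult weyl_Lam adj_mult matrix_mul_assoc)
  moreover have "adj (g ** weyl_mat) ** (g ** weyl_mat) = mat 1"
  proof -
    have "adj (g ** weyl_mat) ** (g ** weyl_mat) = adj weyl_mat ** (adj g ** g) ** weyl_mat"
      by (simp only: adj_mult matrix_mul_assoc)
    then show ?thesis using g by (simp add: SU_adj_mult W_unitary)
  qed
  ultimately show "\<exists>q. Phi q = weyl \<tau> (Phi p)" using ex_Phi_unitary by metis
qed

lemma weyl_map_involution: "weyl_map \<tau> (weyl_map \<tau> p) = p"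
proof -
  obtain g where g: "g \<in> SU" "p = flag_of g" by (rule flag_cases)
  have "Phi (weyl_map \<tau> (weyl_map \<tau> p)) = Phi p"
    unfolding Phi_weyl_map using g by (simp add: Phi_flag_of weyl_conj SU_adj_mult weyl_weyl_Lam)
  then show ?thesis by (simp only: Phi_inject)
qed

lemma weyl_map_diffeomorphism: "diffeomorphism flag_smooth (weyl_map \<tau>)"
proof -
  have inv: "inv (weyl_map \<tau>) = weyl_map \<tau>"
    by (rule inv_unique_comp) (auto simp: fun_eq_iff weyl_map_involution)
  have "f \<circ> weyl_map \<tau> \<in> flag_smooth" if f: "f \<in> flag_smooth" for f
  proof (rule flag_smoothI)
    fix p
    obtain U F where U: "open U" "Phi (weyl_map \<tau> p) \<in> U" "smooth_on U F"
      "\<And>q. Phi q \<in> U \<Longrightarrow> f q = F (Phi q)"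
      using smooth_atE[OF flag_smoothD[OF f]] by blast
    have o: "open (weyl \<tau> -` U)"
      by (intro open_vimage U smooth_map_continuous_on smooth_weyl open_UNIV)
    have "smooth_on (weyl \<tau> -` U) (\<lambda>Y. F (weyl \<tau> Y))"
      by (rule smooth_on_compose[OF o U(3) smooth_weyl[OF o]]) auto
    then show "smooth_at (f \<circ> weyl_map \<tau>) p"
      by (rule smooth_atI[OF o, rotated]) (use U in \<open>simp_all add: Phi_weyl_map[symmetric]\<close>)
  qed
  moreover have "bij (weyl_map \<tau>)"
    by (intro bij_betw_byWitness[where f' = "weyl_map \<tau>"]) (auto simp: weyl_map_involution)
  ultimately show ?thesis
    unfolding diffeomorphism_def inv by blast
qed

lemma mvec_pushforward_weyl:
  assumes v: "v \<in> tangent_space flag_smooth p"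
  shows "mvec (pushforward (weyl_map \<tau>) v) = dweyl \<tau> (Phi p) (mvec v)"
proof (rule euclidean_eqI)
  fix b :: "'a cmat" assume b: "b \<in> Basis"
  let ?Q = "\<lambda>Y :: 'a cmat. weyl \<tau> Y \<bullet> b"
  have sm: "smooth_on UNIV ?Q"
    by (intro smooth_map_inner open_UNIV smooth_weyl)
  have "(?Q has_derivative (\<lambda>w. dweyl \<tau> (Phi p) w \<bullet> b)) (at (Phi p))"
    by (rule has_derivative_inner_left[OF weyl_derivative])
  then have "frechet_derivative ?Q (at (Phi p)) = (\<lambda>w. dweyl \<tau> (Phi p) w \<bullet> b)"
    by (rule frechet_derivative_at[symmetric])
  then have "v (\<lambda>q. ?Q (Phi q)) = dweyl \<tau> (Phi p) (mvec v) \<bullet> b"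
    using tangent_chain[OF v flag_smooth_ambient[OF sm], of UNIV ?Q] sm by simp
  then show "mvec (pushforward (weyl_map \<tau>) v) \<bullet> b = dweyl \<tau> (Phi p) (mvec v) \<bullet> b"
    using b by (simp add: mvec_inner pushforward_def o_def Phi_weyl_map)
qed

text \<open>At \<open>Lam\<close> both the differential of \<open>weyl\<close> and the two
  structures multiply each entry by a scalar, so they commute entry by entry. Equivariance under
  \<open>SU\<close> carries this to every point.\<close>

lemma dweyl_Jmat:
  fixes p :: "'n::finite flag"
  shows "dweyl \<tau> (Phi p) (Jmat (\<lambda>a b. \<epsilon> (\<tau> a) (\<tau> b)) (Phi p) w) = Jmat \<epsilon> (weyl \<tau> (Phi p)) (dweyl \<tau> (Phi p) w)"
proof -
  let ?\<epsilon> = "\<lambda>a b. \<epsilon> (\<tau> a) (\<tau> b)"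
  let ?weyl_mat = "weyl_mat :: 'n cmat"
  have WW: "?weyl_mat ** (?weyl_mat ** A ** ?weyl_mat) ** ?weyl_mat = A" for A
  proof -
    have "?weyl_mat ** (?weyl_mat ** A ** ?weyl_mat) ** ?weyl_mat = (?weyl_mat ** ?weyl_mat) ** A ** (?weyl_mat ** ?weyl_mat)" by (simp only: matrix_mul_assoc)
    moreover have "?weyl_mat ** ?weyl_mat = mat 1" using W_unitary by (simp add: W_adj)
    ultimately show ?thesis by simp
  qed
  have L: "dweyl \<tau> Lam (Jmat ?\<epsilon> Lam w) = Jmat \<epsilon> (weyl \<tau> Lam) (dweyl \<tau> Lam w)" for w :: "'n cmat"
  proof -
    \<comment> \<open>The scalar by which the differential at \<open>Lam\<close> multiplies the
      (k,l) entry: left and right multiplication by \<open>Lam\<close> contribute the two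
      eigenvalues.\<close>
    define c where "c k l = (\<Sum>a\<in>UNIV. lam (\<tau> a) * (proj2 a * (lam (fst k) + lam (fst l)) + proj1 a))"
      for k l :: "3 \<times> 'n"
    have d: "dweyl \<tau> Lam w $ k $ l = of_real (c k l) * w $ k $ l" for w :: "'n cmat" and k l
      by (simp add: dweyl_def Lam_def c_def sum_distrib_right sum_distrib_left scaleR_complex algebra_simps)
    have J: "Jmat \<epsilon> (weyl \<tau> Lam) w' $ k $ l = of_real (?\<epsilon> (fst k) (fst l)) * \<i> * w' $ k $ l"
      for w' :: "'n cmat" and k l
    proof -
      have "Jmat \<epsilon> (weyl \<tau> Lam) w' = Jmat \<epsilon> (?weyl_mat ** Lam ** adj ?weyl_mat) (?weyl_mat ** (?weyl_mat ** w' ** ?weyl_mat) ** adj ?weyl_mat)"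
        by (simp add: weyl_Lam W_adj WW)
      also have "\<dots> = ?weyl_mat ** Jmat \<epsilon> Lam (?weyl_mat ** w' ** ?weyl_mat) ** ?weyl_mat"
        using Jmat_conj[OF W_unitary, of \<epsilon> Lam "?weyl_mat ** w' ** ?weyl_mat"] by (simp only: W_adj)
      finally show ?thesis
        by (simp add: W_left perm_mat_right Jmat_Lam_nth map_prod_involution)
    qed
    show ?thesis by (simp add: vec_eq_iff d J Jmat_Lam_nth mult_ac)
  qed
  obtain g where g: "g \<in> SU" "p = flag_of g" by (rule flag_cases)
  define w0 where "w0 = adj g ** w ** g"
  have w: "w = g ** w0 ** adj g" using SU_conj_cancel[OF g(1)] by (simp add: w0_def)
  note u = SU_adj_mult[OF g(1)]
  show ?thesis
    unfolding w g(2) Phi_flag_of[OF g(1)]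
    by (simp only: Jmat_conj[OF u] dweyl_conj[OF u] weyl_conj[OF u] L)
qed

lemma same_Jst_weyl:
  assumes \<epsilon>: "orient \<epsilon>"
  shows "same_up_to_conj_equiv flag_smooth (Jst (\<lambda>a b. \<epsilon> (\<tau> a) (\<tau> b)) :: 'n::finite flag \<Rightarrow> _) (Jst \<epsilon>)"
proof -
  let ?\<epsilon> = "\<lambda>a b. \<epsilon> (\<tau> a) (\<tau> b)"
  have inj: "\<tau> a = \<tau> b \<longleftrightarrow> a = b" for a b by (metis \<tau>)
  have o: "orient ?\<epsilon>"
    unfolding orient_def
  proof (intro conjI allI impI)
    fix a b
    show "\<epsilon> (\<tau> b) (\<tau> a) = - \<epsilon> (\<tau> a) (\<tau> b)" using \<epsilon> by (rule orient_antisym)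
    show "\<epsilon> (\<tau> a) (\<tau> b) = 1 \<or> \<epsilon> (\<tau> a) (\<tau> b) = -1" if "a \<noteq> b"
      using \<epsilon> that inj unfolding orient_def by blast
  qed
  have "intertwines flag_smooth (weyl_map \<tau>) (Jst ?\<epsilon>) (Jst \<epsilon> :: 'n flag \<Rightarrow> _)"
    unfolding intertwines_def
  proof (intro allI ballI)
    fix p :: "'n flag" and v assume v: "v \<in> tangent_space flag_smooth p"
    note pf = pushforward_tangent[OF weyl_map_diffeomorphism]
    show "pushforward (weyl_map \<tau>) (Jst ?\<epsilon> p v) = Jst \<epsilon> (weyl_map \<tau> p) (pushforward (weyl_map \<tau>) v)"
      by (rule mvec_inject[OF pf[OF Jst_tangent[OF o v]] Jst_tangent[OF \<epsilon> pf[OF v]]])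
         (simp only: mvec_pushforward_weyl[OF Jst_tangent[OF o v]] mvec_Jst[OF \<epsilon> pf[OF v]] mvec_Jst[OF o v]
            mvec_pushforward_weyl[OF v] Phi_weyl_map dweyl_Jmat)
  qed
  then show ?thesis
    using weyl_map_diffeomorphism
    by (intro same_equivalent Jst_almost_complex o \<epsilon>) (auto simp: equivalent_structures_def)
qed

end

text \<open>The parameters are the signs of the edges (1,2), (2,3) and (1,3). Thus
  \<open>sig 1 1 1\<close> is the linear order 1, 2, 3 and \<open>sig 1 1 (-1)\<close> is the cycle
  1 -> 2 -> 3 -> 1.\<close>

definition sig :: "real \<Rightarrow> real \<Rightarrow> real \<Rightarrow> 3 \<Rightarrow> 3 \<Rightarrow> real" where
  "sig x y z a b = (if a = 1 \<and> b = 2 then x else if a = 2 \<and> b = 1 then - x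
    else if a = 2 \<and> b = 3 then y else if a = 3 \<and> b = 2 then - y
    else if a = 1 \<and> b = 3 then z else if a = 3 \<and> b = 1 then - z else 0)"

lemma orient_sig:
  assumes "x = 1 \<or> x = -1" "y = 1 \<or> y = -1" "z = 1 \<or> z = -1"
  shows "orient (sig x y z)"
  using assms unfolding orient_def forall_3 by (auto simp: sig_def)

lemma orient_eq_sig:
  assumes "orient \<epsilon>" shows "\<epsilon> = sig (\<epsilon> 1 2) (\<epsilon> 2 3) (\<epsilon> 1 3)"
proof -
  have "\<forall>a b. \<epsilon> a b = sig (\<epsilon> 1 2) (\<epsilon> 2 3) (\<epsilon> 1 3) a b"
    unfolding forall_3
    using orient_diag[OF assms] orient_antisym[OF assms, of 2 1] orient_antisym[OF assms, of 3 1]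
      orient_antisym[OF assms, of 3 2]
    by (simp add: sig_def)
  then show ?thesis by blast
qed

lemma sig_uminus: "(\<lambda>a b. - sig x y z a b) = sig (-x) (-y) (-z)"
proof -
  have "\<forall>a b. - sig x y z a b = sig (-x) (-y) (-z) a b"
    unfolding forall_3 by (simp add: sig_def)
  then show ?thesis by blast
qed

definition swap12 :: "3 \<Rightarrow> 3" where "swap12 a = (if a = 1 then 2 else if a = 2 then 1 else a)"
definition swap23 :: "3 \<Rightarrow> 3" where "swap23 a = (if a = 2 then 3 else if a = 3 then 2 else a)"

lemma sig_swap12: "(\<lambda>a b. sig x y z (swap12 a) (swap12 b)) = sig (-x) z y"
proof -
  have "\<forall>a b. sig x y z (swap12 a) (swap12 b) = sig (-x) z y a b"
    unfolding forall_3 by (simp add: sig_def swap12_def)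
  then show ?thesis by blast
qed

lemma sig_swap23: "(\<lambda>a b. sig x y z (swap23 a) (swap23 b)) = sig z (-y) x"
proof -
  have "\<forall>a b. sig x y z (swap23 a) (swap23 b) = sig z (-y) x a b"
    unfolding forall_3 by (simp add: sig_def swap23_def)
  then show ?thesis by blast
qed

text \<open>Among the eight sign triples, (1,1,-1) and (-1,-1,1) are the cycles, related by
  reversal. The other six are linear orders; swaps of neighbouring blocks and reversal connect them
  all to (1,1,1).\<close>

lemma orient_same_cases:
  fixes dummy :: "'n::finite itself"
  assumes \<epsilon>: "orient \<epsilon>"
  shows "same_up_to_conj_equiv flag_smooth (Jst \<epsilon> :: 'n flag \<Rightarrow> _) (Jst (sig 1 1 1)) \<or>
    same_up_to_conj_equiv flag_smooth (Jst \<epsilon> :: 'n flag \<Rightarrow> _) (Jst (sig 1 1 (-1)))"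
proof -
  let ?S = "\<lambda>x y z x' y' z'. same_up_to_conj_equiv flag_smooth (Jst (sig x y z) :: 'n flag \<Rightarrow> _) (Jst (sig x' y' z'))"
  have neg: "?S x y z (-x) (-y) (-z)"
    if "x = 1 \<or> x = -1" "y = 1 \<or> y = -1" "z = 1 \<or> z = -1" for x y z
    using same_Jst_uminus[OF orient_sig[OF that], where 'n='n] unfolding sig_uminus .
  have s12: "?S (-x) z y x y z"
    if "x = 1 \<or> x = -1" "y = 1 \<or> y = -1" "z = 1 \<or> z = -1" for x y z
    using same_Jst_weyl[OF _ orient_sig[OF that], of swap12, where 'n='n] unfolding sig_swap12
    by (simp add: swap12_def)
  have s23: "?S z (-y) x x y z"
    if "x = 1 \<or> x = -1" "y = 1 \<or> y = -1" "z = 1 \<or> z = -1" for x y z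
    using same_Jst_weyl[OF _ orient_sig[OF that], of swap23, where 'n='n] unfolding sig_swap23
    by (simp add: swap23_def)
  define x y z where xyz: "x = \<epsilon> 1 2" "y = \<epsilon> 2 3" "z = \<epsilon> 1 3"
  have eq: "\<epsilon> = sig x y z" using orient_eq_sig[OF \<epsilon>] by (simp add: xyz)
  have or: "\<epsilon> a b = 1 \<or> \<epsilon> a b = -1" if "a \<noteq> b" for a b using \<epsilon> that unfolding orient_def by blast
  have x: "x = 1 \<or> x = -1" and y: "y = 1 \<or> y = -1" and z: "z = 1 \<or> z = -1"
    unfolding xyz by (rule or, simp)+
  have a: "?S 1 1 1 1 1 1" "?S 1 1 (-1) 1 1 (-1)" by (rule same_refl)+
  have b: "?S (-1) (-1) (-1) 1 1 1" "?S (-1) (-1) 1 1 1 (-1)"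
    using neg[of "-1" "-1" "-1"] neg[of "-1" "-1" 1] by simp_all
  have c: "?S 1 (-1) 1 1 1 1" "?S (-1) 1 1 1 1 1"
    using s23[of 1 1 1] s12[of 1 1 1] by simp_all
  have d: "?S 1 (-1) (-1) (-1) 1 1" "?S (-1) 1 (-1) 1 (-1) 1"
    using neg[of 1 "-1" "-1"] neg[of "-1" 1 "-1"] by simp_all
  have e: "?S 1 (-1) (-1) 1 1 1" "?S (-1) 1 (-1) 1 1 1"
    using same_trans[OF d(1) c(2)] same_trans[OF d(2) c(1)] .
  show ?thesis unfolding eq using x y z a b c e by (elim disjE) simp_all
qed

section \<open>Integrability\<close>

lemma T10_iff:
  "z \<in> T10 C J p \<longleftrightarrow> Re_vect z \<in> tangent_space C p \<and> Im_vect z \<in> tangent_space C p \<and>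
    J p (Re_vect z) = (\<lambda>f. - Im_vect z f) \<and> J p (Im_vect z) = Re_vect z"
  unfolding T10_def complex_tangent_space_def complexify_def
  by (auto simp: fun_eq_iff complex_eq_iff Re_vect_def Im_vect_def)

definition cpush :: "('a \<Rightarrow> 'a) \<Rightarrow> 'a cvect \<Rightarrow> 'a cvect" where
  "cpush \<phi> z = (\<lambda>f. z (f \<circ> \<phi>))"

lemma Re_cpush: "Re_vect (cpush \<phi> z) = pushforward \<phi> (Re_vect z)"
  and Im_cpush: "Im_vect (cpush \<phi> z) = pushforward \<phi> (Im_vect z)"
  by (simp_all add: cpush_def Re_vect_def Im_vect_def pushforward_def)

lemma T10_cpush:
  assumes "diffeomorphism C \<phi>" "intertwines C \<phi> J1 J2" "z \<in> T10 C J1 p"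
  shows "cpush \<phi> z \<in> T10 C J2 (\<phi> p)"
proof -
  have z: "Re_vect z \<in> tangent_space C p" "Im_vect z \<in> tangent_space C p"
    "J1 p (Re_vect z) = (\<lambda>f. - Im_vect z f)" "J1 p (Im_vect z) = Re_vect z"
    using assms(3) by (simp_all add: T10_iff)
  have "J2 (\<phi> p) (pushforward \<phi> (Re_vect z)) = pushforward \<phi> (\<lambda>f. - Im_vect z f)"
    using assms(2) z(1,3) unfolding intertwines_def by metis
  moreover have "J2 (\<phi> p) (pushforward \<phi> (Im_vect z)) = pushforward \<phi> (Re_vect z)"
    using assms(2) z(2,4) unfolding intertwines_def by metis
  ultimately show ?thesis
    using pushforward_tangent[OF assms(1)] z(1,2)
    by (simp add: T10_iff Re_cpush Im_cpush) (simp add: pushforward_def)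
qed

lemma diffeomorphism_inv:
  assumes "diffeomorphism C \<phi>" shows "diffeomorphism C (inv \<phi>)"
  using assms unfolding diffeomorphism_def by (simp add: bij_imp_bij_inv inv_inv_eq)

lemma intertwines_inv:
  assumes \<phi>: "diffeomorphism C \<phi>" and i: "intertwines C \<phi> J1 J2" and J1: "almost_complex C J1"
  shows "intertwines C (inv \<phi>) J2 J1"
  unfolding intertwines_def
proof (intro allI ballI)
  fix q w assume w: "w \<in> tangent_space C q"
  have b: "\<phi> (inv \<phi> q) = q" "\<And>f. f \<circ> inv \<phi> \<circ> \<phi> = f" "\<And>f. f \<circ> \<phi> \<circ> inv \<phi> = f"
    using \<phi> by (auto simp: diffeomorphism_def bij_def surj_f_inv_f fun_eq_iff)
  let ?v = "pushforward (inv \<phi>) w"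
  have v: "?v \<in> tangent_space C (inv \<phi> q)" by (rule pushforward_tangent[OF diffeomorphism_inv[OF \<phi>] w])
  have "pushforward \<phi> ?v = w" by (simp add: pushforward_def b)
  then have "pushforward \<phi> (J1 (inv \<phi> q) ?v) = J2 q w"
    using i v unfolding intertwines_def by (metis b(1))
  then have "pushforward (inv \<phi>) (J2 q w) = pushforward (inv \<phi>) (pushforward \<phi> (J1 (inv \<phi> q) ?v))"
    by simp
  then show "pushforward (inv \<phi>) (J2 q w) = J1 (inv \<phi> q) ?v"
    by (simp add: pushforward_def b)
qed

definition push_field :: "('a \<Rightarrow> 'a) \<Rightarrow> ('a \<Rightarrow> 'a cvect) \<Rightarrow> ('a \<Rightarrow> 'a cvect)" where
  "push_field \<phi> Z = (\<lambda>q. cpush \<phi> (Z (inv \<phi> q)))"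

lemma vector_field_push:
  assumes \<phi>: "diffeomorphism C \<phi>" and X: "vector_field C X"
  shows "vector_field C (\<lambda>q. pushforward \<phi> (X (inv \<phi> q)))"
  unfolding vector_field_def
proof (intro conjI allI ballI)
  fix q
  have "\<phi> (inv \<phi> q) = q" using \<phi> by (simp add: diffeomorphism_def bij_def surj_f_inv_f)
  then show "pushforward \<phi> (X (inv \<phi> q)) \<in> tangent_space C q"
    using pushforward_tangent[OF \<phi>, of "X (inv \<phi> q)" "inv \<phi> q"] X by (simp add: vector_field_def)
next
  fix f assume f: "f \<in> C"
  then have "(\<lambda>p. X p (f \<circ> \<phi>)) \<circ> inv \<phi> \<in> C"
    using \<phi> X by (simp add: diffeomorphism_def vector_field_def)
  then show "(\<lambda>p. pushforward \<phi> (X (inv \<phi> p)) f) \<in> C"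
    by (simp add: pushforward_def o_def)
qed

lemma complex_vector_field_push:
  "diffeomorphism C \<phi> \<Longrightarrow> complex_vector_field C Z \<Longrightarrow> complex_vector_field C (push_field \<phi> Z)"
  unfolding complex_vector_field_def push_field_def Re_cpush Im_cpush
  using vector_field_push by blast

lemma lie_bracket_push:
  assumes "diffeomorphism C \<phi>"
  shows "lie_bracket (push_field \<phi> Z) (push_field \<phi> W) (\<phi> p) = cpush \<phi> (lie_bracket Z W p)"
proof -
  have "inv \<phi> (\<phi> q) = q" for q using assms by (simp add: diffeomorphism_def bij_def)
  then show ?thesis
    by (simp add: lie_bracket_def cderiv_def push_field_def cpush_def fun_eq_iff o_def)
qed

lemma T10_push_field:
  assumes "diffeomorphism C \<phi>" "intertwines C \<phi> J1 J2" "\<forall>p. Z p \<in> T10 C J1 p"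
  shows "push_field \<phi> Z q \<in> T10 C J2 q"
proof -
  have "\<phi> (inv \<phi> q) = q" using assms(1) by (simp add: diffeomorphism_def bij_def surj_f_inv_f)
  then show ?thesis
    using T10_cpush[OF assms(1,2), of "Z (inv \<phi> q)" "inv \<phi> q"] assms(3) by (simp add: push_field_def)
qed

lemma bracket_T10_pullback:
  assumes \<phi>: "diffeomorphism C \<phi>" and i: "intertwines C \<phi> J1 J2" and J1: "almost_complex C J1"
    and "lie_bracket (push_field \<phi> Z) (push_field \<phi> W) (\<phi> p) \<in> T10 C J2 (\<phi> p)"
  shows "lie_bracket Z W p \<in> T10 C J1 p"
proof -
  have "cpush (inv \<phi>) (cpush \<phi> (lie_bracket Z W p)) \<in> T10 C J1 (inv \<phi> (\<phi> p))"
    using T10_cpush[OF diffeomorphism_inv[OF \<phi>] intertwines_inv[OF \<phi> i J1] assms(4)]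
    by (simp add: lie_bracket_push[OF \<phi>])
  moreover have "inv \<phi> (\<phi> p) = p" "\<And>f :: _ \<Rightarrow> real. f \<circ> inv \<phi> \<circ> \<phi> = f"
    using \<phi> by (auto simp: diffeomorphism_def bij_def fun_eq_iff)
  ultimately show ?thesis by (simp add: cpush_def)
qed

lemma integrable_pullback:
  assumes \<phi>: "diffeomorphism C \<phi>" and i: "intertwines C \<phi> J1 J2" and J1: "almost_complex C J1"
    and J2: "integrable_structure C J2"
  shows "integrable_structure C J1"
  unfolding integrable_structure_def
proof (intro allI impI)
  fix Z W p
  assume *: "complex_vector_field C Z \<and> (\<forall>p. Z p \<in> T10 C J1 p) \<and>
    complex_vector_field C W \<and> (\<forall>p. W p \<in> T10 C J1 p)"
  have "lie_bracket (push_field \<phi> Z) (push_field \<phi> W) (\<phi> p) \<in> T10 C J2 (\<phi> p)"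
    using J2 * complex_vector_field_push[OF \<phi>] T10_push_field[OF \<phi> i]
    unfolding integrable_structure_def by blast
  then show "lie_bracket Z W p \<in> T10 C J1 p" by (rule bracket_T10_pullback[OF \<phi> i J1])
qed

text \<open>Stated for every function, since outside the algebra both sides are 0. It moves complex
  conjugation through \<open>cderiv\<close>, where conjugating the function negates its imaginary
  part.\<close>

lemma tangent_neg:
  assumes v: "v \<in> tangent_space flag_smooth p" shows "v (\<lambda>x. - f x) = - v f"
proof (cases "f \<in> flag_smooth")
  case True
  then show ?thesis using tangent_linear[OF v True True, of "-1" 0] by simp
next
  case False
  have "(\<lambda>x. - f x) \<notin> flag_smooth"
  proof
    assume "(\<lambda>x. - f x) \<in> flag_smooth"
    from flag_smooth_lincomb[OF this this, of "-1" 0] show False using False by simp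
  qed
  then show ?thesis using False tangent_outside[OF v] by simp
qed

lemma Re_cnj: "Re_vect (\<lambda>f. cnj (z f)) = Re_vect z"
  and Im_cnj: "Im_vect (\<lambda>f. cnj (z f)) = (\<lambda>f. - Im_vect z f)"
  by (simp_all add: Re_vect_def Im_vect_def)

lemma complex_tangent_neg:
  assumes "z \<in> complex_tangent_space flag_smooth p" shows "z (\<lambda>x. - f x) = - z f"
  using tangent_neg[of "Re_vect z" p f] tangent_neg[of "Im_vect z" p f] assms
  by (simp add: complex_tangent_space_def Re_vect_def Im_vect_def complex_eq_iff)

lemma complex_field_tangent:
  "complex_vector_field C Z \<Longrightarrow> Z p \<in> complex_tangent_space C p"
  by (simp add: complex_vector_field_def complex_tangent_space_def vector_field_def)

lemma lie_bracket_cnj: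
  assumes "complex_vector_field flag_smooth Z" "complex_vector_field flag_smooth W"
  shows "lie_bracket (\<lambda>p f. cnj (Z p f)) (\<lambda>p f. cnj (W p f)) p = (\<lambda>f. cnj (lie_bracket Z W p f))"
  using complex_tangent_neg[OF complex_field_tangent[OF assms(1)]]
    complex_tangent_neg[OF complex_field_tangent[OF assms(2)]]
  by (simp add: lie_bracket_def cderiv_def fun_eq_iff)

text \<open>The +\<i> eigenspace of -J is the -\<i> eigenspace of J, which complex conjugation
  exchanges with the +\<i> eigenspace because J is real.\<close>

lemma T10_conjugate:
  fixes J :: "'n::finite flag \<Rightarrow> _"
  assumes J: "almost_complex flag_smooth J"
  shows "(\<lambda>f. cnj (z f)) \<in> T10 flag_smooth (conjugate_structure J) p \<longleftrightarrow> z \<in> T10 flag_smooth J p"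
proof -
  have Jm: "J p (\<lambda>f. - v f) = (\<lambda>f. - J p v f)" if "v \<in> tangent_space flag_smooth p" for v
  proof -
    have "J p (\<lambda>f. (-1) * v f + 0 * v f) = (\<lambda>f. (-1) * J p v f + 0 * J p v f)"
      using J that unfolding almost_complex_def by blast
    then show ?thesis by simp
  qed
  have t: "(\<lambda>f. - v f) \<in> tangent_space flag_smooth p \<longleftrightarrow> v \<in> tangent_space flag_smooth p" for v :: "'n flag vect"
    using tangent_space_uminus[of v] tangent_space_uminus[of "\<lambda>f. - v f"] by auto
  show ?thesis
    unfolding T10_iff Re_cnj Im_cnj t
    using Jm[of "Im_vect z"] by (auto simp: conjugate_structure_def fun_eq_iff) (metis minus_minus)
qed

lemma complex_vector_field_cnj:
  assumes "complex_vector_field flag_smooth Z"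
  shows "complex_vector_field flag_smooth (\<lambda>p f. cnj (Z p f))"
proof -
  have "vector_field flag_smooth (\<lambda>p f. - X p f)" if X: "vector_field flag_smooth X" for X :: "'a flag \<Rightarrow> 'a flag vect"
    unfolding vector_field_def
  proof (intro conjI allI ballI)
    show "(\<lambda>f. - X p f) \<in> tangent_space flag_smooth p" for p
      using X by (intro tangent_space_uminus) (simp add: vector_field_def)
    show "(\<lambda>p. - X p f) \<in> flag_smooth" if "f \<in> flag_smooth" for f
      using flag_smooth_lincomb[of "\<lambda>p. X p f" "\<lambda>p. X p f" "-1" 0] X that
      by (simp add: vector_field_def)
  qed
  then show ?thesis
    using assms unfolding complex_vector_field_def Re_cnj Im_cnj by blast
qed

lemma integrable_conjugate:
  assumes J: "almost_complex flag_smooth J" and i: "integrable_structure flag_smooth (conjugate_structure J)"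
  shows "integrable_structure flag_smooth J"
  unfolding integrable_structure_def
proof (intro allI impI)
  fix Z W p
  assume *: "complex_vector_field flag_smooth Z \<and> (\<forall>p. Z p \<in> T10 flag_smooth J p) \<and>
    complex_vector_field flag_smooth W \<and> (\<forall>p. W p \<in> T10 flag_smooth J p)"
  have "lie_bracket (\<lambda>p f. cnj (Z p f)) (\<lambda>p f. cnj (W p f)) p \<in> T10 flag_smooth (conjugate_structure J) p"
    using i * complex_vector_field_cnj T10_conjugate[OF J] unfolding integrable_structure_def by blast
  then show "lie_bracket Z W p \<in> T10 flag_smooth J p"
    using * T10_conjugate[OF J] by (simp add: lie_bracket_cnj)
qed

lemma conjugate_conjugate: "conjugate_structure (conjugate_structure J) = J"
  by (simp add: conjugate_structure_def)

text \<open>It suffices to treat one generating step: conjugation takes (1,0)-fields and their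
  brackets to the conjugate fields and brackets, and a diffeomorphism pushes both forward.\<close>

lemma same_integrable:
  fixes J1 :: "'n::finite flag \<Rightarrow> _"
  assumes "same_up_to_conj_equiv flag_smooth J1 J2"
  shows "integrable_structure flag_smooth J1 \<longleftrightarrow> integrable_structure flag_smooth J2"
proof -
  have step: "integrable_structure flag_smooth J1 \<longleftrightarrow> integrable_structure flag_smooth J2"
    if r: "almost_complex flag_smooth J1 \<and> almost_complex flag_smooth J2 \<and>
     (J2 = conjugate_structure J1 \<or> equivalent_structures flag_smooth J1 J2)" for J1 J2 :: "'n flag \<Rightarrow> _"
  proof (cases "J2 = conjugate_structure J1")
    case True
    then show ?thesis
      using r integrable_conjugate[of J1] integrable_conjugate[of J2] by (auto simp: conjugate_conjugate)
  next
    case False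
    then obtain \<phi> where \<phi>: "diffeomorphism flag_smooth \<phi>" "intertwines flag_smooth \<phi> J1 J2"
      using r by (auto simp: equivalent_structures_def)
    show ?thesis
      using r integrable_pullback[OF \<phi>] integrable_pullback[OF diffeomorphism_inv[OF \<phi>(1)] intertwines_inv[OF \<phi>]]
      by blast
  qed
  show ?thesis
    using assms unfolding same_up_to_conj_equiv_def
    by (induction rule: equivclp_induct) (use step in blast)+
qed

subsection \<open>Matrix-valued derivations\<close>

definition csmooth :: "('n::finite flag \<Rightarrow> complex) \<Rightarrow> bool" where
  "csmooth h \<longleftrightarrow> (\<lambda>q. Re (h q)) \<in> flag_smooth \<and> (\<lambda>q. Im (h q)) \<in> flag_smooth"

lemma csmooth_const: "csmooth (\<lambda>q. c)" by (simp add: csmooth_def)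

lemma csmooth_add: "csmooth f \<Longrightarrow> csmooth g \<Longrightarrow> csmooth (\<lambda>q. f q + g q)"
  by (simp add: csmooth_def flag_smooth_add)

lemma csmooth_mult: "csmooth f \<Longrightarrow> csmooth g \<Longrightarrow> csmooth (\<lambda>q. f q * g q)"
proof -
  assume fg: "csmooth f" "csmooth g"
  then have s: "(\<lambda>x. Re (f x)) \<in> flag_smooth" "(\<lambda>x. Im (f x)) \<in> flag_smooth"
    "(\<lambda>x. Re (g x)) \<in> flag_smooth" "(\<lambda>x. Im (g x)) \<in> flag_smooth"
    by (simp_all add: csmooth_def)
  have "(\<lambda>q. 1 * (Re (f q) * Re (g q)) + (-1) * (Im (f q) * Im (g q))) \<in> flag_smooth"
    by (intro flag_smooth_lincomb flag_smooth_mult s)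
  moreover have "(\<lambda>q. Re (f q) * Im (g q) + Im (f q) * Re (g q)) \<in> flag_smooth"
    by (intro flag_smooth_add flag_smooth_mult s)
  ultimately
  show ?thesis by (simp add: csmooth_def)
qed

lemma csmooth_sum: "(\<And>i. i \<in> I \<Longrightarrow> csmooth (f i)) \<Longrightarrow> csmooth (\<lambda>q. \<Sum>i\<in>I. f i q)"
  by (induction I rule: infinite_finite_induct) (auto intro: csmooth_add csmooth_const)

context
  fixes z :: "'n::finite flag cvect" and p :: "'n flag"
  assumes z: "z \<in> complex_tangent_space flag_smooth p"
begin

lemma ctangent_linear:
  "f \<in> flag_smooth \<Longrightarrow> g \<in> flag_smooth \<Longrightarrow> z (\<lambda>x. a * f x + b * g x) = of_real a * z f + of_real b * z g"
  using z tangent_linear[of "Re_vect z" flag_smooth p f g a b] tangent_linear[of "Im_vect z" flag_smooth p f g a b]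
  by (simp add: complex_tangent_space_def Re_vect_def Im_vect_def complex_eq_iff)

lemma ctangent_mult:
  "f \<in> flag_smooth \<Longrightarrow> g \<in> flag_smooth \<Longrightarrow> z (\<lambda>x. f x * g x) = of_real (f p) * z g + of_real (g p) * z f"
  using z tangent_mult[of "Re_vect z" flag_smooth p f g] tangent_mult[of "Im_vect z" flag_smooth p f g]
  by (simp add: complex_tangent_space_def Re_vect_def Im_vect_def complex_eq_iff)

lemma ctangent_outside: "f \<notin> flag_smooth \<Longrightarrow> z f = 0"
  using z tangent_outside[of "Re_vect z" flag_smooth p f] tangent_outside[of "Im_vect z" flag_smooth p f]
  by (simp add: complex_tangent_space_def Re_vect_def Im_vect_def complex_eq_iff)

lemma ctangent_const: "z (\<lambda>q. c) = 0"
  using z tangent_const[of "Re_vect z" p c] tangent_const[of "Im_vect z" p c]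
  by (simp add: complex_tangent_space_def Re_vect_def Im_vect_def complex_eq_iff)

lemma cderiv_const: "cderiv z (\<lambda>q. c) = 0"
  by (simp add: cderiv_def ctangent_const)

lemma cderiv_add:
  assumes "csmooth f" "csmooth g" shows "cderiv z (\<lambda>q. f q + g q) = cderiv z f + cderiv z g"
proof -
  have "z (\<lambda>x. Re (f x) + Re (g x)) = z (\<lambda>x. Re (f x)) + z (\<lambda>x. Re (g x))"
    "z (\<lambda>x. Im (f x) + Im (g x)) = z (\<lambda>x. Im (f x)) + z (\<lambda>x. Im (g x))"
    using assms ctangent_linear[of "\<lambda>x. Re (f x)" "\<lambda>x. Re (g x)" 1 1]
      ctangent_linear[of "\<lambda>x. Im (f x)" "\<lambda>x. Im (g x)" 1 1] by (simp_all add: csmooth_def)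
  then show ?thesis by (simp add: cderiv_def algebra_simps)
qed

lemma cderiv_mult:
  assumes "csmooth f" "csmooth g" shows "cderiv z (\<lambda>q. f q * g q) = f p * cderiv z g + g p * cderiv z f"
proof -
  have s: "(\<lambda>x. Re (f x)) \<in> flag_smooth" "(\<lambda>x. Im (f x)) \<in> flag_smooth"
    "(\<lambda>x. Re (g x)) \<in> flag_smooth" "(\<lambda>x. Im (g x)) \<in> flag_smooth"
    using assms by (simp_all add: csmooth_def)
  have r: "z (\<lambda>x. Re (f x) * Re (g x) - Im (f x) * Im (g x)) =
      z (\<lambda>x. Re (f x) * Re (g x)) - z (\<lambda>x. Im (f x) * Im (g x))"
    using ctangent_linear[OF flag_smooth_mult[OF s(1,3)] flag_smooth_mult[OF s(2,4)], of 1 "-1"] by simp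
  have i: "z (\<lambda>x. Re (f x) * Im (g x) + Im (f x) * Re (g x)) =
      z (\<lambda>x. Re (f x) * Im (g x)) + z (\<lambda>x. Im (f x) * Re (g x))"
    using ctangent_linear[OF flag_smooth_mult[OF s(1,4)] flag_smooth_mult[OF s(2,3)], of 1 1] by simp
  have fp: "f p = of_real (Re (f p)) + \<i> * of_real (Im (f p))"
    and gp: "g p = of_real (Re (g p)) + \<i> * of_real (Im (g p))"
    by (simp_all add: complex_eq_iff)
  show ?thesis
    by (subst fp, subst gp)
      (simp add: cderiv_def r i ctangent_mult s, simp add: algebra_simps)
qed

lemma cderiv_sum:
  "(\<And>i. i \<in> I \<Longrightarrow> csmooth (f i)) \<Longrightarrow> cderiv z (\<lambda>q. \<Sum>i\<in>I. f i q) = (\<Sum>i\<in>I. cderiv z (f i))"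
  by (induction I rule: infinite_finite_induct) (auto simp: cderiv_const cderiv_add csmooth_sum)

lemma cderiv_of_real: "cderiv z (\<lambda>q. of_real (f q)) = z f"
  by (simp add: cderiv_def ctangent_const)

end

lemma complex_tangentI:
  fixes z :: "'n::finite flag cvect"
  assumes "\<And>f g a b. f \<in> flag_smooth \<Longrightarrow> g \<in> flag_smooth \<Longrightarrow>
      z (\<lambda>x. a * f x + b * g x) = of_real a * z f + of_real b * z g"
    and "\<And>f g. f \<in> flag_smooth \<Longrightarrow> g \<in> flag_smooth \<Longrightarrow> z (\<lambda>x. f x * g x) = of_real (f p) * z g + of_real (g p) * z f"
    and "\<And>f. f \<notin> flag_smooth \<Longrightarrow> z f = 0"
  shows "z \<in> complex_tangent_space flag_smooth p"
  using assms by (simp add: complex_tangent_space_def tangent_space_def Re_vect_def Im_vect_def)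

lemma complex_field_csmooth:
  assumes "complex_vector_field flag_smooth Z" "f \<in> flag_smooth" shows "csmooth (\<lambda>q. Z q f)"
  using assms by (simp add: complex_vector_field_def vector_field_def csmooth_def Re_vect_def Im_vect_def)

text \<open>In the product rule the mixed terms Z f W g + Z g W f are symmetric in the two fields
  and cancel.\<close>

lemma lie_bracket_tangent:
  assumes Z: "complex_vector_field flag_smooth Z" and W: "complex_vector_field flag_smooth W"
  shows "lie_bracket Z W p \<in> complex_tangent_space flag_smooth p"
proof (rule complex_tangentI)
  note Zt = complex_field_tangent[OF Z] and Wt = complex_field_tangent[OF W]
  note Zs = complex_field_csmooth[OF Z] and Ws = complex_field_csmooth[OF W]
  have co: "csmooth (\<lambda>q. of_real (f q))" if "f \<in> flag_smooth" for f :: "'a flag \<Rightarrow> real"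
    using that by (simp add: csmooth_def)
  fix f g :: "'a flag \<Rightarrow> real" and a b
  assume f: "f \<in> flag_smooth" and g: "g \<in> flag_smooth"
  show "lie_bracket Z W p (\<lambda>x. a * f x + b * g x) =
      of_real a * lie_bracket Z W p f + of_real b * lie_bracket Z W p g"
    unfolding lie_bracket_def
    by (simp add: ctangent_linear[OF Zt f g] ctangent_linear[OF Wt f g] cderiv_add[OF Zt] cderiv_add[OF Wt]
      csmooth_mult csmooth_const Zs Ws f g cderiv_mult[OF Zt] cderiv_mult[OF Wt] cderiv_const[OF Zt]
      cderiv_const[OF Wt] algebra_simps)
  show "lie_bracket Z W p (\<lambda>x. f x * g x) =
      of_real (f p) * lie_bracket Z W p g + of_real (g p) * lie_bracket Z W p f"
    unfolding lie_bracket_def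
    by (simp add: ctangent_mult[OF Zt f g] ctangent_mult[OF Wt f g] cderiv_add[OF Zt] cderiv_add[OF Wt]
      csmooth_mult co Zs Ws f g cderiv_mult[OF Zt] cderiv_mult[OF Wt] cderiv_of_real[OF Zt]
      cderiv_of_real[OF Wt] algebra_simps)
next
  fix f :: "'a flag \<Rightarrow> real" assume "f \<notin> flag_smooth"
  then show "lie_bracket Z W p f = 0"
    using ctangent_outside[OF complex_field_tangent[OF Z]] ctangent_outside[OF complex_field_tangent[OF W]]
      cderiv_const[OF complex_field_tangent[OF Z]] cderiv_const[OF complex_field_tangent[OF W]]
    by (simp add: lie_bracket_def)
qed

definition mderiv :: "'n::finite flag cvect \<Rightarrow> ('n flag \<Rightarrow> complex^'m^'m) \<Rightarrow> complex^'m^'m" where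
  "mderiv z H = (\<chi> k l. cderiv z (\<lambda>q. H q $ k $ l))"

definition msmooth :: "('n::finite flag \<Rightarrow> complex^'m^'m) \<Rightarrow> bool" where
  "msmooth H \<longleftrightarrow> (\<forall>k l. csmooth (\<lambda>q. H q $ k $ l))"

text \<open>The complex counterpart of \<open>mvec\<close>; \<open>cvec_eq\<close> compares the
  two.\<close>

definition cvec :: "'n::finite flag cvect \<Rightarrow> 'n cmat" where
  "cvec z = mderiv z Phi"

lemma msmooth_mult: "msmooth A \<Longrightarrow> msmooth B \<Longrightarrow> msmooth (\<lambda>q. A q ** B q)"
  by (simp add: msmooth_def matrix_matrix_mult_def csmooth_sum csmooth_mult)

lemma msmooth_add: "msmooth A \<Longrightarrow> msmooth B \<Longrightarrow> msmooth (\<lambda>q. A q + B q)"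
  by (simp add: msmooth_def csmooth_add)

lemma msmooth_scaleR: "msmooth A \<Longrightarrow> msmooth (\<lambda>q. c *\<^sub>R A q)"
  by (simp add: msmooth_def scaleR_complex csmooth_mult csmooth_const)

lemma msmooth_const: "msmooth (\<lambda>q. A)"
  by (simp add: msmooth_def csmooth_const)

lemma flag_smooth_Re_entry: "(\<lambda>q. Re (Phi q $ k $ l)) \<in> flag_smooth"
  and flag_smooth_Im_entry: "(\<lambda>q. Im (Phi q $ k $ l)) \<in> flag_smooth"
  by (rule flag_smooth_linear, simp add: linear_iff)+

lemma msmooth_Phi: "msmooth Phi"
  by (simp add: msmooth_def csmooth_def flag_smooth_Re_entry flag_smooth_Im_entry)

lemma msmooth_Proj: "msmooth (\<lambda>q. Proj a (Phi q))"
  unfolding Proj_def by (intro msmooth_add msmooth_scaleR msmooth_mult msmooth_Phi msmooth_const)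

context
  fixes z :: "'n::finite flag cvect" and p :: "'n flag"
  assumes z: "z \<in> complex_tangent_space flag_smooth p"
begin

lemma mderiv_mult:
  assumes "msmooth A" "msmooth B"
  shows "mderiv z (\<lambda>q. A q ** B q) = mderiv z A ** B p + A p ** mderiv z B"
proof -
  have "cderiv z (\<lambda>q. \<Sum>m\<in>UNIV. A q $ k $ m * B q $ m $ l) =
    (\<Sum>m\<in>UNIV. cderiv z (\<lambda>q. A q $ k $ m) * B p $ m $ l) + (\<Sum>m\<in>UNIV. A p $ k $ m * cderiv z (\<lambda>q. B q $ m $ l))" for k l
    using assms unfolding msmooth_def
    by (simp add: cderiv_sum[OF z] cderiv_mult[OF z] csmooth_mult sum.distrib mult.commute add.commute)
  then show ?thesis
    by (simp add: vec_eq_iff mderiv_def matrix_matrix_mult_def)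
qed

lemma mderiv_add: "msmooth A \<Longrightarrow> msmooth B \<Longrightarrow> mderiv z (\<lambda>q. A q + B q) = mderiv z A + mderiv z B"
  by (simp add: vec_eq_iff mderiv_def msmooth_def cderiv_add[OF z])

lemma mderiv_scaleR: "msmooth A \<Longrightarrow> mderiv z (\<lambda>q. c *\<^sub>R A q) = c *\<^sub>R mderiv z A"
  by (simp add: vec_eq_iff mderiv_def msmooth_def scaleR_complex
      cderiv_mult[OF z] csmooth_const cderiv_const[OF z])

lemma mderiv_const: "mderiv z (\<lambda>q. A) = 0"
  by (simp add: vec_eq_iff mderiv_def cderiv_const[OF z])

lemma mderiv_Proj:
  "mderiv z (\<lambda>q. Proj a (Phi q)) = proj2 a *\<^sub>R (cvec z ** Phi p + Phi p ** cvec z) + proj1 a *\<^sub>R cvec z"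
  unfolding Proj_def cvec_def
  by (simp add: mderiv_add mderiv_scaleR mderiv_mult mderiv_const msmooth_add msmooth_scaleR msmooth_mult
      msmooth_Phi msmooth_const)

lemma cvec_eq: "cvec z = mvec (Re_vect z) + imul (mvec (Im_vect z))"
proof -
  have v: "mvec v $ k $ l = of_real (v (\<lambda>q. Re (Phi q $ k $ l))) + \<i> * of_real (v (\<lambda>q. Im (Phi q $ k $ l)))"
    if "v \<in> tangent_space flag_smooth p" for v k l
    using tangent_linear_Phi[OF that, of "\<lambda>Y. Re (Y $ k $ l)"] tangent_linear_Phi[OF that, of "\<lambda>Y. Im (Y $ k $ l)"]
    by (simp add: linear_iff complex_eq_iff)
  have t: "Re_vect z \<in> tangent_space flag_smooth p" "Im_vect z \<in> tangent_space flag_smooth p"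
    using z by (simp_all add: complex_tangent_space_def)
  show ?thesis
    by (simp add: vec_eq_iff v[OF t(1)] v[OF t(2)] cvec_def mderiv_def cderiv_def)
       (simp add: complex_eq_iff Re_vect_def Im_vect_def)
qed

end

lemma msmooth_cvec:
  assumes Z: "complex_vector_field flag_smooth Z" shows "msmooth (\<lambda>q. cvec (Z q))"
  unfolding msmooth_def cvec_def mderiv_def cderiv_def
  by (simp add: csmooth_add csmooth_mult csmooth_const complex_field_csmooth[OF Z]
      flag_smooth_Re_entry flag_smooth_Im_entry)

text \<open>Applied to the coordinate functions of the embedding, the bracket becomes the commutator
  formula for vector fields in flat space.\<close>

lemma cvec_lie_bracket:
  assumes Z: "complex_vector_field flag_smooth Z" and W: "complex_vector_field flag_smooth W"
  shows "cvec (lie_bracket Z W p) = mderiv (Z p) (\<lambda>q. cvec (W q)) - mderiv (W p) (\<lambda>q. cvec (Z q))"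
proof -
  note Zt = complex_field_tangent[OF Z] and Wt = complex_field_tangent[OF W]
  note Zs = complex_field_csmooth[OF Z] and Ws = complex_field_csmooth[OF W]
  have c: "cvec z $ k $ l = z (\<lambda>q. Re (Phi q $ k $ l)) + \<i> * z (\<lambda>q. Im (Phi q $ k $ l))" for z :: "'a flag cvect" and k l
    by (simp add: cvec_def mderiv_def cderiv_def)
  show ?thesis
    by (simp add: vec_eq_iff c mderiv_def cderiv_add[OF Zt] cderiv_add[OF Wt] cderiv_mult[OF Zt]
      cderiv_mult[OF Wt] csmooth_mult csmooth_const Zs Ws flag_smooth_Re_entry flag_smooth_Im_entry
      cderiv_const[OF Zt] cderiv_const[OF Wt]) (simp add: lie_bracket_def algebra_simps)
qed

subsection \<open>The bracket of two fields of type (1,0)\<close>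

text \<open>The blocks of sign -1 carry the whole condition: on a block of sign 1 it is the
  conjugate transpose of the condition on the opposite block, and the diagonal blocks of
  \<open>A\<close> and \<open>B\<close> vanish.\<close>

lemma Hoff_T10_iff:
  fixes A B :: "'n::finite cmat"
  assumes \<epsilon>: "orient \<epsilon>" and A: "A \<in> Hoff" and B: "B \<in> Hoff"
  shows "Jmat \<epsilon> Lam A = - B \<and> Jmat \<epsilon> Lam B = A \<longleftrightarrow>
    (\<forall>k l. \<epsilon> (fst k) (fst l) = -1 \<longrightarrow> A $ k $ l + \<i> * B $ k $ l = 0)"
proof (intro iffI allI impI)
  fix k l :: "3 \<times> 'n"
  assume J: "Jmat \<epsilon> Lam A = - B \<and> Jmat \<epsilon> Lam B = A" and e: "\<epsilon> (fst k) (fst l) = -1"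
  have "Jmat \<epsilon> Lam B $ k $ l = A $ k $ l" using J by simp
  then have "A $ k $ l = - (\<i> * B $ k $ l)" by (simp add: Jmat_Lam_nth e)
  then show "A $ k $ l + \<i> * B $ k $ l = 0" by simp
next
  assume z: "\<forall>k l. \<epsilon> (fst k) (fst l) = -1 \<longrightarrow> A $ k $ l + \<i> * B $ k $ l = 0"
  have "Jmat \<epsilon> Lam A $ k $ l = - B $ k $ l \<and> Jmat \<epsilon> Lam B $ k $ l = A $ k $ l" for k l
  proof -
    consider "fst k = fst l" | "\<epsilon> (fst k) (fst l) = -1" | "\<epsilon> (fst k) (fst l) = 1"
      using \<epsilon> unfolding orient_def by blast
    then show ?thesis
    proof cases
      case 1
      then show ?thesis using Hoff_zero[OF A 1] Hoff_zero[OF B 1] by (simp add: Jmat_Lam_nth)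
    next
      case 2
      then have "A $ k $ l + \<i> * B $ k $ l = 0" using z by blast
      then have a: "A $ k $ l = - (\<i> * B $ k $ l)" by (simp add: eq_neg_iff_add_eq_0)
      show ?thesis unfolding Jmat_Lam_nth 2 a by (simp add: algebra_simps)
    next
      case 3
      then have "\<epsilon> (fst l) (fst k) = -1" using orient_antisym[OF \<epsilon>, of "fst l" "fst k"] by simp
      then have "A $ l $ k + \<i> * B $ l $ k = 0" using z by blast
      then have "A $ l $ k = - (\<i> * B $ l $ k)" by (simp add: eq_neg_iff_add_eq_0)
      then have "cnj (A $ l $ k) = cnj (- (\<i> * B $ l $ k))" by simp
      then have a: "A $ k $ l = \<i> * B $ k $ l"
        using Hoff_cnj[OF A, of l k] Hoff_cnj[OF B, of l k] by simp
      show ?thesis unfolding Jmat_Lam_nth 3 a by (simp add: algebra_simps)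
    qed
  qed
  then show "Jmat \<epsilon> Lam A = - B \<and> Jmat \<epsilon> Lam B = A" by (simp add: vec_eq_iff)
qed

lemma block_zero_iff:
  "Proj a Lam ** X ** Proj b Lam = 0 \<longleftrightarrow> (\<forall>k l. fst k = a \<longrightarrow> fst l = b \<longrightarrow> X $ k $ l = 0)"
  unfolding Proj_Lam vec_eq_iff by auto

text \<open>The eigenvalue condition becomes a family of matrix equations valid at all points,
  polynomial in \<open>Phi p\<close> and linear in \<open>cvec z\<close>, which can be
  differentiated along another field.\<close>

lemma T10_Jst_iff:
  assumes \<epsilon>: "orient \<epsilon>"
  shows "z \<in> T10 flag_smooth (Jst \<epsilon>) p \<longleftrightarrow> z \<in> complex_tangent_space flag_smooth p \<and>
    (\<forall>a b. \<epsilon> a b = -1 \<longrightarrow> Proj a (Phi p) ** cvec z ** Proj b (Phi p) = 0)"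
proof (cases "z \<in> complex_tangent_space flag_smooth p")
  case True
  then have R: "Re_vect z \<in> tangent_space flag_smooth p" and I: "Im_vect z \<in> tangent_space flag_smooth p"
    by (simp_all add: complex_tangent_space_def)
  obtain g where g: "g \<in> SU" "p = flag_of g" by (rule flag_cases)
  note u = SU_adj_mult[OF g(1)]
  define A B where "A = adj g ** mvec (Re_vect z) ** g" and "B = adj g ** mvec (Im_vect z) ** g"
  have AB: "A \<in> Hoff" "B \<in> Hoff"
    using R I tangent_image[OF g(1)] g(2) by (auto simp: A_def B_def)
  have RA: "mvec (Re_vect z) = g ** A ** adj g" and IB: "mvec (Im_vect z) = g ** B ** adj g"
    using SU_conj_cancel[OF g(1)] by (simp_all add: A_def B_def)
  have inj: "g ** X ** adj g = g ** Y ** adj g \<longleftrightarrow> X = Y" for X Y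
    using SU_conj_cancel[OF SU_adj[OF g(1)]] by (metis adj_adj)
  have neg: "- (g ** X ** adj g) = g ** (- X) ** adj g" for X
    by (simp add: matrix_minus_left matrix_minus_right)
  have "z \<in> T10 flag_smooth (Jst \<epsilon>) p \<longleftrightarrow>
      Jst \<epsilon> p (Re_vect z) = (\<lambda>f. - Im_vect z f) \<and> Jst \<epsilon> p (Im_vect z) = Re_vect z"
    using R I by (simp add: T10_iff)
  also have "\<dots> \<longleftrightarrow> mvec (Jst \<epsilon> p (Re_vect z)) = mvec (\<lambda>f. - Im_vect z f) \<and>
      mvec (Jst \<epsilon> p (Im_vect z)) = mvec (Re_vect z)"
    using mvec_inject[OF Jst_tangent[OF \<epsilon> R] tangent_space_uminus[OF I]]
      mvec_inject[OF Jst_tangent[OF \<epsilon> I] R] by metis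
  also have "\<dots> \<longleftrightarrow> Jmat \<epsilon> Lam A = - B \<and> Jmat \<epsilon> Lam B = A"
    unfolding mvec_Jst[OF \<epsilon> R] mvec_Jst[OF \<epsilon> I] mvec_uminus
    unfolding RA IB g(2) Phi_flag_of[OF g(1)] Jmat_conj[OF u] neg inj ..
  also have "\<dots> \<longleftrightarrow> (\<forall>k l. \<epsilon> (fst k) (fst l) = -1 \<longrightarrow> (A + imul B) $ k $ l = 0)"
    unfolding Hoff_T10_iff[OF \<epsilon> AB] by simp
  also have "\<dots> \<longleftrightarrow> (\<forall>a b. \<epsilon> a b = -1 \<longrightarrow> Proj a Lam ** (A + imul B) ** Proj b Lam = 0)"
    unfolding block_zero_iff by auto
  also have "\<dots> \<longleftrightarrow> (\<forall>a b. \<epsilon> a b = -1 \<longrightarrow> Proj a (Phi p) ** cvec z ** Proj b (Phi p) = 0)"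
  proof -
    have c: "cvec z = g ** (A + imul B) ** adj g"
      unfolding cvec_eq[OF True] RA IB
      by (simp add: matrix_add_ldistrib matrix_add_rdistrib imul_mult_left imul_mult_right)
    have "Proj a (Phi p) ** cvec z ** Proj b (Phi p) = g ** (Proj a Lam ** (A + imul B) ** Proj b Lam) ** adj g" for a b
      unfolding c g(2) Phi_flag_of[OF g(1)] Proj_conj[OF u] conj_mult[OF u] ..
    moreover have "g ** X ** adj g = 0 \<longleftrightarrow> X = 0" for X
      using inj[of X 0] matrix_scaleR_right[of g 0 0] matrix_scaleR_left[of 0 0 "adj g"] by simp
    ultimately show ?thesis by simp
  qed
  finally show ?thesis using True by simp
qed (simp add: T10_def)

lemma T10_base_zero:
  assumes \<epsilon>: "orient \<epsilon>" and z: "z \<in> T10 flag_smooth (Jst \<epsilon>) base" and e: "\<epsilon> (fst k) (fst l) \<noteq> 1"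
  shows "cvec z $ k $ l = 0"
proof (cases "fst k = fst l")
  case True
  have zt: "z \<in> complex_tangent_space flag_smooth base" using z by (simp add: T10_def)
  then have "mvec (Re_vect z) \<in> Hoff" "mvec (Im_vect z) \<in> Hoff"
    by (simp_all add: complex_tangent_space_def mvec_base_Hoff)
  then show ?thesis
    using Hoff_zero[OF _ True] by (simp add: cvec_eq[OF zt])
next
  case False
  then have "\<epsilon> (fst k) (fst l) = -1" using \<epsilon> e unfolding orient_def by blast
  then have "Proj (fst k) Lam ** cvec z ** Proj (fst l) Lam = 0"
    using z unfolding T10_Jst_iff[OF \<epsilon>] Phi_base by blast
  then show ?thesis unfolding block_zero_iff by blast
qed

text \<open>The factor of the (a,c) block in the derivative of \<open>Proj a\<close> at
  \<open>Lam\<close>, a divided difference of the interpolation polynomial. For distinct blocks it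
  equals 1 / (lam a - lam c), as in perturbation theory of eigenprojections.\<close>

definition kap :: "3 \<Rightarrow> 3 \<Rightarrow> real" where
  "kap a c = proj2 a * (lam a + lam c) + proj1 a"

text \<open>The relation \<open>P\<^sub>a Z P\<^sub>b = 0\<close> that defines the (1,0)-fields, differentiated at the base point.\<close>

lemma mderiv_T10_entry:
  assumes \<epsilon>: "orient \<epsilon>" and Z: "complex_vector_field flag_smooth Z" and ZT: "\<And>p. Z p \<in> T10 flag_smooth (Jst \<epsilon>) p"
    and u: "u \<in> complex_tangent_space flag_smooth base" and e: "\<epsilon> (fst i) (fst j) = -1"
  shows "mderiv u (\<lambda>q. cvec (Z q)) $ i $ j = - (\<Sum>k\<in>UNIV.
      of_real (kap (fst i) (fst k)) * cvec u $ i $ k * cvec (Z base) $ k $ j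
      + of_real (kap (fst j) (fst k)) * cvec (Z base) $ i $ k * cvec u $ k $ j)"
proof -
  let ?P = "\<lambda>a q. Proj a (Phi q)" and ?a = "fst i" and ?b = "fst j"
  let ?z = "cvec (Z base)" and ?u = "cvec u"
  have "?P ?a q ** cvec (Z q) ** ?P ?b q = 0" for q
    using ZT[of q] e unfolding T10_Jst_iff[OF \<epsilon>] by blast
  then have "mderiv u (\<lambda>q. ?P ?a q ** cvec (Z q) ** ?P ?b q) = 0"
    by (simp add: mderiv_const[OF u])
  then have "((mderiv u (?P ?a) ** ?z + Proj ?a Lam ** mderiv u (\<lambda>q. cvec (Z q))) ** Proj ?b Lam
      + (Proj ?a Lam ** ?z) ** mderiv u (?P ?b)) $ i $ j = 0"
    by (simp add: mderiv_mult[OF u] msmooth_mult msmooth_Proj msmooth_cvec[OF Z])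
  then have "(mderiv u (?P ?a) ** ?z) $ i $ j + mderiv u (\<lambda>q. cvec (Z q)) $ i $ j
      + ((Proj ?a Lam ** ?z) ** mderiv u (?P ?b)) $ i $ j = 0"
    by (simp add: Proj_Lam)
  moreover have "(mderiv u (?P ?a) ** ?z) $ i $ j =
      (\<Sum>k\<in>UNIV. of_real (kap ?a (fst k)) * ?u $ i $ k * ?z $ k $ j)"
  proof -
    have "mderiv u (?P ?a) $ i $ k = of_real (kap ?a (fst k)) * ?u $ i $ k" for k
      unfolding mderiv_Proj[OF u] Phi_base
      by (simp add: Lam_def kap_def scaleR_complex algebra_simps)
    then show ?thesis by (simp add: matrix_matrix_mult_def[of "mderiv u (?P ?a)"])
  qed
  moreover have "((Proj ?a Lam ** ?z) ** mderiv u (?P ?b)) $ i $ j =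
      (\<Sum>k\<in>UNIV. of_real (kap ?b (fst k)) * ?z $ i $ k * ?u $ k $ j)"
  proof -
    have "mderiv u (?P ?b) $ k $ j = of_real (kap ?b (fst k)) * ?u $ k $ j" for k
      unfolding mderiv_Proj[OF u] Phi_base
      by (simp add: Lam_def kap_def scaleR_complex algebra_simps)
    moreover have "(Proj ?a Lam ** ?z) $ i $ k = ?z $ i $ k" for k by (simp add: Proj_Lam)
    ultimately show ?thesis
      by (simp add: matrix_matrix_mult_def[of "Proj ?a Lam ** ?z"] mult_ac)
  qed
  ultimately show ?thesis
    by (simp add: sum.distrib eq_neg_iff_add_eq_0 algebra_simps)
qed

text \<open>The derivatives of Z along W and of W along Z involve the same products of entries, once
  with \<open>kap\<close> of the row block and once with that of the column block. These entries of
  the bracket therefore depend only on the values of the fields at the base point.\<close>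

lemma bracket_entry:
  assumes \<epsilon>: "orient \<epsilon>" and Z: "complex_vector_field flag_smooth Z" and ZT: "\<And>p. Z p \<in> T10 flag_smooth (Jst \<epsilon>) p"
    and W: "complex_vector_field flag_smooth W" and WT: "\<And>p. W p \<in> T10 flag_smooth (Jst \<epsilon>) p"
    and e: "\<epsilon> (fst i) (fst j) = -1"
  shows "cvec (lie_bracket Z W base) $ i $ j = (\<Sum>k\<in>UNIV.
      of_real (kap (fst j) (fst k) - kap (fst i) (fst k)) *
      (cvec (Z base) $ i $ k * cvec (W base) $ k $ j - cvec (W base) $ i $ k * cvec (Z base) $ k $ j))"
  unfolding cvec_lie_bracket[OF Z W] vector_minus_component
    mderiv_T10_entry[OF \<epsilon> Z ZT complex_field_tangent[OF W] e]
    mderiv_T10_entry[OF \<epsilon> W WT complex_field_tangent[OF Z] e]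
  by (simp add: sum_subtractf[symmetric] sum.distrib[symmetric] algebra_simps)

lemma integrable_sig: "integrable_structure flag_smooth (Jst (sig 1 1 1) :: 'n::finite flag \<Rightarrow> _)"
  unfolding integrable_structure_def
proof (intro allI impI)
  let ?\<epsilon> = "sig 1 1 1"
  let ?J = "Jst ?\<epsilon> :: 'n flag \<Rightarrow> _"
  have \<epsilon>: "orient ?\<epsilon>" by (rule orient_sig) simp_all
  \<comment> \<open>Transitivity: through a middle block, two edges of sign 1 cannot span an edge of
    sign -1, so every product in \<open>bracket_entry\<close> vanishes.\<close>
  have "\<forall>a c b. ?\<epsilon> a c = 1 \<longrightarrow> ?\<epsilon> c b = 1 \<longrightarrow> ?\<epsilon> a b = 1"
    unfolding forall_3 by (simp add: sig_def)
  then have tr: "?\<epsilon> a b = 1" if "?\<epsilon> a c = 1" "?\<epsilon> c b = 1" for a b c using that by blast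
  have base: "lie_bracket Z W base \<in> T10 flag_smooth ?J base"
    if Z: "complex_vector_field flag_smooth Z" and ZT: "\<And>p. Z p \<in> T10 flag_smooth ?J p"
    and W: "complex_vector_field flag_smooth W" and WT: "\<And>p. W p \<in> T10 flag_smooth ?J p" for Z W
  proof -
    have "cvec (lie_bracket Z W base) $ i $ j = 0" if e: "?\<epsilon> (fst i) (fst j) = -1" for i j
    proof -
      have "cvec z $ i $ k * cvec w $ k $ j = 0"
        if "z \<in> T10 flag_smooth ?J base" "w \<in> T10 flag_smooth ?J base" for k z w
        using T10_base_zero[OF \<epsilon> that(1), of i k] T10_base_zero[OF \<epsilon> that(2), of k j]
          tr[of "fst i" "fst k" "fst j"] e by fastforce
      from this[OF ZT WT] this[OF WT ZT] show ?thesis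
        unfolding bracket_entry[OF \<epsilon> Z ZT W WT e]
        by (simp only: diff_self mult_zero_right sum.neutral_const)
    qed
    then show ?thesis
      unfolding T10_Jst_iff[OF \<epsilon>] Phi_base block_zero_iff using lie_bracket_tangent[OF Z W] by blast
  qed
  fix Z W and p :: "'n flag"
  assume *: "complex_vector_field flag_smooth Z \<and> (\<forall>p. Z p \<in> T10 flag_smooth ?J p) \<and>
    complex_vector_field flag_smooth W \<and> (\<forall>p. W p \<in> T10 flag_smooth ?J p)"
  obtain g where g: "g \<in> SU" "p = flag_of g" by (rule flag_cases)
  \<comment> \<open>Translation by \<open>adj g\<close> moves p to the base point and preserves the
    structure, so the base point computation applies to the pushed fields.\<close>
  let ?\<phi> = "left_action (adj g) :: 'n flag \<Rightarrow> _"
  note \<phi> = left_action_diffeomorphism[OF SU_adj[OF g(1)]] and i = Jst_intertwines[OF \<epsilon> SU_adj[OF g(1)]]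
  have p: "?\<phi> p = base" using g by (simp add: left_action_flag_of SU_adj SU_adj_mult)
  have "lie_bracket (push_field ?\<phi> Z) (push_field ?\<phi> W) (?\<phi> p) \<in> T10 flag_smooth ?J (?\<phi> p)"
    unfolding p using * by (intro base complex_vector_field_push[OF \<phi>] T10_push_field[OF \<phi> i]) auto
  then show "lie_bracket Z W p \<in> T10 flag_smooth ?J p"
    by (rule bracket_T10_pullback[OF \<phi> i Jst_almost_complex[OF \<epsilon>]])
qed

subsection \<open>Global fields of type (1,0)\<close>

text \<open>The part of a constant matrix \<open>M\<close> in the blocks of sign 1, taken with
  respect to the eigenspaces of \<open>Y\<close>. As \<open>Y\<close> runs over the orbit this is a
  (1,0)-field given by a polynomial formula.\<close>

definition upper :: "(3 \<Rightarrow> 3 \<Rightarrow> real) \<Rightarrow> 'n::finite cmat \<Rightarrow> 'n cmat \<Rightarrow> 'n cmat" where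
  "upper \<epsilon> M Y = (\<Sum>a\<in>UNIV. \<Sum>b\<in>UNIV. (if \<epsilon> a b = 1 then 1 else 0 :: real) *\<^sub>R (Proj a Y ** M ** Proj b Y))"

lemma upper_Lam: "upper \<epsilon> M Lam $ k $ l = (if \<epsilon> (fst k) (fst l) = 1 then M $ k $ l else 0)"
proof -
  have "((if \<epsilon> a b = 1 then 1 else 0 :: real) *\<^sub>R (Proj a Lam ** M ** Proj b Lam)) $ k $ l =
     (if b = fst l then (if a = fst k then (if \<epsilon> a b = 1 then M $ k $ l else 0) else 0) else 0)" for a b
    by (simp add: Proj_Lam)
  then show ?thesis by (simp add: upper_def)
qed

lemma upper_conj:
  assumes g: "adj g ** g = mat 1"
  shows "upper \<epsilon> (g ** M ** adj g) (g ** Y ** adj g) = g ** upper \<epsilon> M Y ** adj g"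
  unfolding upper_def linear_sum[OF linear_matrix_conj] linear_scale[OF linear_matrix_conj]
  by (simp add: Proj_conj[OF g] conj_mult[OF g])

lemma smooth_upper: "open U \<Longrightarrow> smooth_map U (upper \<epsilon> M)"
  unfolding upper_def[abs_def]
  by (intro smooth_map_sum smooth_map_scaleR smooth_map_bilinear[OF _ bilinear_matrix_mult]
      smooth_map_const smooth_Proj) (auto simp: smooth_on_def Ck_on_const)

lemma vector_field_of_matrix_map:
  fixes A :: "'n::finite cmat \<Rightarrow> 'n cmat"
  assumes sm: "smooth_map UNIV A" and t: "\<And>p. A (Phi p) \<in> mvec ` tangent_space flag_smooth p"
  shows "\<exists>X. vector_field flag_smooth X \<and> (\<forall>p. mvec (X p) = A (Phi p))"
proof (intro exI conjI allI)
  let ?X = "\<lambda>p. inv_into (tangent_space flag_smooth p) mvec (A (Phi p))"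
  show m: "mvec (?X p) = A (Phi p)" for p by (rule f_inv_into_f[OF t])
  show "vector_field flag_smooth ?X"
    by (rule vector_field_mvecI[OF inv_into_into[OF t]], subst m)
       (intro flag_smooth_ambient smooth_map_inner open_UNIV sm)
qed

text \<open>Integrability quantifies over global fields, so refuting it requires global (1,0)-fields
  with prescribed values at the base point.\<close>

lemma T10_field_exists:
  fixes M :: "'n::finite cmat"
  assumes \<epsilon>: "orient \<epsilon>"
  obtains Z where "complex_vector_field flag_smooth Z" "\<And>p. Z p \<in> T10 flag_smooth (Jst \<epsilon>) p"
    "cvec (Z base) = upper \<epsilon> M Lam"
proof -
  \<comment> \<open>N = A N + i B N with both parts Hermitian, which gives the real and imaginary
    parts of the field. At the base point they lie in \<open>Hoff\<close> because
    \<open>upper\<close> has no diagonal blocks.\<close>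
  define A where "A N = (1 / 2) *\<^sub>R (N + adj N)" for N :: "'n cmat"
  define B where "B N = (1 / 2) *\<^sub>R imul (adj N + - N)" for N :: "'n cmat"
  have lA: "linear A"
    by (simp add: A_def linear_iff vec_eq_iff scaleR_complex algebra_simps)
  have lB: "linear B"
    by (simp add: B_def linear_iff vec_eq_iff scaleR_complex algebra_simps)
  have AB: "A N + imul (B N) = N" for N
    by (simp add: A_def B_def vec_eq_iff scaleR_complex algebra_simps)
  have AH: "A (upper \<epsilon> M' Lam) \<in> Hoff" and BH: "B (upper \<epsilon> M' Lam) \<in> Hoff" for M' :: "'n cmat"
  proof -
    have z: "upper \<epsilon> M' Lam $ i $ j = 0" if "fst i = fst j" for i j
      using that orient_diag[OF \<epsilon>] by (simp add: upper_Lam)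
    have "adj (A N) = A N" "adj (B N) = B N" for N
      by (simp_all add: A_def B_def vec_eq_iff scaleR_complex algebra_simps)
    moreover have "A (upper \<epsilon> M' Lam) $ i $ j = 0" "B (upper \<epsilon> M' Lam) $ i $ j = 0" if "fst i = fst j" for i j
      using z[OF that] z[OF that[symmetric]] by (simp_all add: A_def B_def)
    ultimately show "A (upper \<epsilon> M' Lam) \<in> Hoff" "B (upper \<epsilon> M' Lam) \<in> Hoff"
      unfolding Hoff_def by blast+
  qed
  have conj: "adj g ** upper \<epsilon> M (Phi (flag_of g)) ** g = upper \<epsilon> (adj g ** M ** g) Lam" if g: "g \<in> SU" for g
    using upper_conj[OF SU_adj_mult[OF g], of \<epsilon> "adj g ** M ** g" Lam]
      SU_conj_cancel[OF g, of M] SU_conj_cancel[OF SU_adj[OF g]]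
    by (simp add: Phi_flag_of[OF g])
  have Ac: "adj g ** A N ** g = A (adj g ** N ** g)" and Bc: "adj g ** B N ** g = B (adj g ** N ** g)"
    for g N :: "'n cmat"
    by (simp_all add: A_def B_def adj_mult matrix_mul_assoc matrix_add_ldistrib matrix_add_rdistrib
      matrix_scaleR_left matrix_scaleR_right imul_mult_left imul_mult_right matrix_diff_ldistrib
      matrix_diff_rdistrib)
  have tA: "A (upper \<epsilon> M (Phi p)) \<in> mvec ` tangent_space flag_smooth p"
    and tB: "B (upper \<epsilon> M (Phi p)) \<in> mvec ` tangent_space flag_smooth p" for p
  proof -
    obtain g where g: "g \<in> SU" "p = flag_of g" by (rule flag_cases)
    show "A (upper \<epsilon> M (Phi p)) \<in> mvec ` tangent_space flag_smooth p"
      "B (upper \<epsilon> M (Phi p)) \<in> mvec ` tangent_space flag_smooth p"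
      using AH BH g by (simp_all add: tangent_image Ac Bc conj)
  qed
  obtain X where X: "vector_field flag_smooth X" "\<And>p. mvec (X p) = A (upper \<epsilon> M (Phi p))"
    using vector_field_of_matrix_map[OF
        smooth_map_linear_compose[OF open_UNIV lA smooth_upper[OF open_UNIV]] tA] by blast
  obtain Y where Y: "vector_field flag_smooth Y" "\<And>p. mvec (Y p) = B (upper \<epsilon> M (Phi p))"
    using vector_field_of_matrix_map[OF
        smooth_map_linear_compose[OF open_UNIV lB smooth_upper[OF open_UNIV]] tB] by blast
  define Z where "Z p f = of_real (X p f) + \<i> * of_real (Y p f)" for p f
  have RI: "Re_vect (Z p) = X p" "Im_vect (Z p) = Y p" for p
    by (simp_all add: Z_def Re_vect_def Im_vect_def)
  have cZ: "complex_vector_field flag_smooth Z"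
    unfolding complex_vector_field_def RI using X(1) Y(1) by simp
  have cv: "cvec (Z p) = upper \<epsilon> M (Phi p)" for p
    unfolding cvec_eq[OF complex_field_tangent[OF cZ]] RI X(2) Y(2) AB ..
  have "Z p \<in> T10 flag_smooth (Jst \<epsilon>) p" for p
    unfolding T10_Jst_iff[OF \<epsilon>] cv
  proof (intro conjI allI impI complex_field_tangent[OF cZ])
    fix a b assume e: "\<epsilon> a b = -1"
    obtain g where g: "g \<in> SU" "p = flag_of g" by (rule flag_cases)
    have "Proj a Lam ** upper \<epsilon> (adj g ** M ** g) Lam ** Proj b Lam = 0"
      unfolding block_zero_iff using e by (auto simp: upper_Lam)
    moreover have "upper \<epsilon> M (Phi p) = g ** upper \<epsilon> (adj g ** M ** g) Lam ** adj g"
      using conj[OF g(1)] SU_conj_cancel[OF g(1)] g(2) by metis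
    moreover have "g ** 0 ** adj g = 0"
      using matrix_scaleR_right[of g 0 0] matrix_scaleR_left[of 0 0 "adj g"] by simp
    ultimately show "Proj a (Phi p) ** upper \<epsilon> M (Phi p) ** Proj b (Phi p) = 0"
      by (simp add: g(2) Phi_flag_of[OF g(1)] Proj_conj[OF SU_adj_mult[OF g(1)]] conj_mult[OF SU_adj_mult[OF g(1)]])
  qed
  then show ?thesis using that[OF cZ] cv[of base] by simp
qed

lemma not_integrable_sig:
  "\<not> integrable_structure flag_smooth (Jst (sig 1 1 (-1)) :: 'n::finite flag \<Rightarrow> _)"
proof
  let ?\<epsilon> = "sig 1 1 (-1)"
  let ?J = "Jst ?\<epsilon> :: 'n flag \<Rightarrow> _"
  assume int: "integrable_structure flag_smooth ?J"
  have \<epsilon>: "orient ?\<epsilon>" by (rule orient_sig) simp_all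
  define x :: 'n where "x = undefined"
  \<comment> \<open>Matrix units along the path 1 -> 2 -> 3. Both edges have sign 1 while (1,3) has
    sign -1, so their product feeds a forbidden block of the bracket.\<close>
  define E :: "3 \<Rightarrow> 3 \<Rightarrow> 'n cmat" where "E a b = (\<chi> k l. if k = (a, x) \<and> l = (b, x) then 1 else 0)" for a b
  obtain Z where Z: "complex_vector_field flag_smooth Z" "\<And>p. Z p \<in> T10 flag_smooth ?J p"
    "cvec (Z base) = upper ?\<epsilon> (E 1 2) Lam"
    using T10_field_exists[OF \<epsilon>] by blast
  obtain W where W: "complex_vector_field flag_smooth W" "\<And>p. W p \<in> T10 flag_smooth ?J p"
    "cvec (W base) = upper ?\<epsilon> (E 2 3) Lam"
    using T10_field_exists[OF \<epsilon>] by blast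
  have e: "?\<epsilon> (fst (1, x)) (fst (3, x)) = -1" by (simp add: sig_def)
  have z: "cvec (Z base) $ k $ l = (if k = (1, x) \<and> l = (2, x) then 1 else 0)" for k l
    unfolding Z(3) upper_Lam by (auto simp: E_def sig_def)
  have w: "cvec (W base) $ k $ l = (if k = (2, x) \<and> l = (3, x) then 1 else 0)" for k l
    unfolding W(3) upper_Lam by (auto simp: E_def sig_def)
  have "cvec (lie_bracket Z W base) $ (1, x) $ (3, x) =
      (\<Sum>k\<in>UNIV. if k = (2 :: 3, x) then of_real (kap 3 2 - kap 1 2) else 0)"
    unfolding bracket_entry[OF \<epsilon> Z(1,2) W(1,2) e] by (intro sum.cong) (auto simp: z w)
  \<comment> \<open>\<open>kap 3 2\<close> is -1 and \<open>kap 1 2\<close> is 1: the middle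
    eigenvalue 0 lies between the outer ones, so the two terms reinforce each other.\<close>
  also have "\<dots> = - 2"
    by (simp add: kap_def proj1_def proj2_def)
  finally have "cvec (lie_bracket Z W base) $ (1, x) $ (3, x) \<noteq> 0" by simp
  moreover have "lie_bracket Z W base \<in> T10 flag_smooth ?J base"
    using int Z W unfolding integrable_structure_def by blast
  ultimately show False
    using T10_base_zero[OF \<epsilon>, of _ "(1, x)" "(3, x)"] e by fastforce
qed

section \<open>The classification\<close>

theorem theorem8p5:
  shows "\<exists>c d. c \<noteq> d \<and>
    (invariant_acs :: ('n::finite flag \<Rightarrow> 'n flag vect \<Rightarrow> 'n flag vect) set) // acs_rel = {c, d} \<and>
    (\<forall>J\<in>c. integrable_structure flag_smooth J) \<and>
    (\<forall>J\<in>d. \<not> integrable_structure flag_smooth J)"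
proof -
  let ?A = "invariant_acs :: ('n flag \<Rightarrow> 'n flag vect \<Rightarrow> 'n flag vect) set"
  let ?r = "acs_rel :: (('n flag \<Rightarrow> 'n flag vect \<Rightarrow> 'n flag vect) \<times> _) set"
  let ?I = "Jst (sig 1 1 1) :: 'n flag \<Rightarrow> 'n flag vect \<Rightarrow> 'n flag vect"
  let ?N = "Jst (sig 1 1 (-1)) :: 'n flag \<Rightarrow> 'n flag vect \<Rightarrow> 'n flag vect"
  have I: "?I \<in> ?A" and N: "?N \<in> ?A"
    by (intro Jst_invariant orient_sig; simp)+
  have all: "(?I, J) \<in> ?r \<or> (?N, J) \<in> ?r" if J: "J \<in> ?A" for J
  proof -
    obtain \<epsilon> where \<epsilon>: "orient \<epsilon>" "\<And>p v. v \<in> tangent_space flag_smooth p \<Longrightarrow> J p v = Jst \<epsilon> p v"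
      using invariant_acs_classification[OF J] by metis
    have "almost_complex flag_smooth J" using J by (simp add: invariant_acs_def)
    then have "same_up_to_conj_equiv flag_smooth J (Jst \<epsilon>)"
      using equivalent_if_eq_on_tangent[of flag_smooth J "Jst \<epsilon>"] \<epsilon> by (intro same_equivalent Jst_almost_complex) auto
    then have "same_up_to_conj_equiv flag_smooth ?I J \<or> same_up_to_conj_equiv flag_smooth ?N J"
      using orient_same_cases[OF \<epsilon>(1), where 'n='n] same_trans same_sym by metis
    then show ?thesis using I N J by (auto simp: acs_rel_def)
  qed
  have int: "integrable_structure flag_smooth J \<longleftrightarrow> integrable_structure flag_smooth J'" if "(J, J') \<in> ?r" for J J'
    using that same_integrable by (auto simp: acs_rel_def)
  let ?c = "?r `` {?I}" and ?d = "?r `` {?N}"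
  have c: "\<forall>J\<in>?c. integrable_structure flag_smooth J"
    using int integrable_sig by blast
  have d: "\<forall>J\<in>?d. \<not> integrable_structure flag_smooth J"
    using int not_integrable_sig by blast
  have "?I \<in> ?c" using equiv_acs_rel I by (rule equiv_class_self)
  \<comment> \<open>The first class contains an integrable structure and the second contains
    none.\<close>
  then have ne: "?c \<noteq> ?d" using c d by blast
  have "?A // ?r = {?c, ?d}"
  proof
    show "?A // ?r \<subseteq> {?c, ?d}"
    proof
      fix X assume "X \<in> ?A // ?r"
      then obtain J where J: "J \<in> ?A" "X = ?r `` {J}" by (rule quotientE)
      then show "X \<in> {?c, ?d}"
        using all[OF J(1)] equiv_class_eq[OF equiv_acs_rel] by blast
    qed
    show "{?c, ?d} \<subseteq> ?A // ?r" using I N by (auto intro: quotientI)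
  qed
  with ne c d show ?thesis by blast
qed

end
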